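(* Let $L=\mathbb{Q}(\alpha)$ be a cubic number field, where $\alpha$ is a root of $f(x)=x^3-ax+b$ with $a,b\in\mathbb{Z}$ such that for every prime $p$ one has $v_p(a)<2$ or $v_p(b)<3$. Let $\Delta=4a^3-27b^2$, $g=\gcd(a,b)$, and let $H$ be the unique Hopf-Galois structure on $L/\mathbb{Q}$. Let $\mathcal{O}_L$ be the ring of integers of $L$ and $\mathfrak{A}_H=\mathfrak{A}_H(\mathcal{O}_L)$ its associated order in $H$. Let $(C_2)$, $(C_3)$ and $(C_{>3})$ be the conditions on $(a,b)$ listed in the context. Then: 1. If $3\nmid a$ and $(C_2)$, $(C_{>3})$ hold, then $\mathcal{O}_L$ is $\mathfrak{A}_H$-free if and only if there exist $x,y\in\mathbb{Z}$ with $x^2+3\Delta y^2=\pm12ag$ (for some choice of sign), $6a$ dividing at least one of $9by+x$, $9by-x$, and $3\nmid y$. 2. If $v_3(a)=v_3(b)=1$ and $(C_2)$, $(C_{>3})$ hold, then $\mathcal{O}_L$ is $\mathfrak{A}_H$-free if and only if there exist $x,y\in\mathbb{Z}$ with $x^2+3\Delta y^2=\pm36ag$ (for some choice of sign) and $6a$ dividing at least one of $9by+x$, $9by-x$. 3. If $v_3(a)>v_3(b)$ and $(C_2)$, $(C_3)$, $(C_{>3})$ hold, then $\mathcal{O}_L$ is $\mathfrak{A}_H$-free if and only if there exist $x,y\in\mathbb{Z}$ with $x^2+3\Delta y^2=\pm108ag$ (for some choice of sign) and $6a$ dividing at least one of $9by+x$, $9by-x$. Moreover, the hypotheses in these items are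 equivalent to $\mathcal{O}_L=\mathbb{Z}[\alpha]$ in the respective regimes: if $3\nmid a$, then $\mathcal{O}_L=\mathbb{Z}[\alpha]$ iff $(C_2)$ and $(C_{>3})$ hold; if $3\mid a$ and $v_3(a)\le v_3(b)$, then $\mathcal{O}_L=\mathbb{Z}[\alpha]$ iff $v_3(a)=v_3(b)=1$ and $(C_2)$, $(C_{>3})$ hold; if $v_3(a)>v_3(b)$, then $\mathcal{O}_L=\mathbb{Z}[\alpha]$ iff $(C_2)$, $(C_3)$, $(C_{>3})$ hold.
   Context: $v_p$ is the $p$-adic valuation, with $v_p(0)=\infty$; $0$ divides only $0$. Conditions on $(a,b)$: $(C_2)$: exactly one of the following holds: (a) $b\equiv1\pmod 2$; (b) $a\equiv0\pmod 2$ and $b\equiv2\pmod 4$; (c) $a\equiv3\pmod 4$ and $b\equiv0\pmod 4$; (d) $a\equiv1\pmod 4$ and $b\equiv2\pmod 4$. $(C_3)$: exactly one of the following holds: (a) $v_3(a)=0$; (b) $v_3(a)\ge1$ and $v_3(b)=1$; (c) $v_3(a)\ge1$, $a\not\equiv3\pmod 9$, $v_3(b)=0$ and $b^2\not\equiv a+1\pmod 9$; (d) $a\equiv3\pmod 9$, $v_3(b)=0$ and $b^2\not\equiv4\pmod 9$. $(C_{>3})$: for every prime $p>3$ exactly one of the following holds: (a) $v_p(a)=0$ and $v_p(b)\ge1$; (b) $v_p(a)\ge1$ and $v_p(b)\le1$; (c) $v_p(a)=v_p(b)=0$ and $v_p(\Delta)\le1$. A Hopf-Galois structure on a number field $L$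 is a finite-dimensional cocommutative $\mathbb{Q}$-Hopf algebra $H$ with a $\mathbb{Q}$-linear action $\cdot\colon H\otimes_{\mathbb{Q}}L\to L$ making $L$ an $H$-module algebra and such that $L\otimes_{\mathbb{Q}}H\to\mathrm{End}_{\mathbb{Q}}(L)$, $x\otimes h\mapsto (y\mapsto x(h\cdot y))$, is a $\mathbb{Q}$-linear isomorphism. Every cubic number field has exactly one Hopf-Galois structure (up to isomorphism). Concretely: let $\widetilde{L}$ be the normal closure of $L$, $G=\mathrm{Gal}(\widetilde L/\mathbb{Q})$, $G'=\mathrm{Gal}(\widetilde{L}/L)$, $\alpha_1=\alpha,\alpha_2,\alpha_3\in\widetilde L$ the roots of $f$, $\sigma\in G$ the element acting on them as the cycle $(\alpha_1,\alpha_2,\alpha_3)$, $J=\langle\sigma\rangle$, $M=\mathbb{Q}(\sqrt{\Delta})\subseteq\widetilde L$. Then $H=M[J]^{G'}$, where $G'$ acts on $M$ by Galois action and on $J$ by conjugation, and $h=\sum_i h_i\sigma^i\in H$ acts on $x\in L$ by $h\cdot x=\sum_i h_i\sigma^i(x)$. (If $L/\mathbb{Q}$ is Galois, $H=\mathbb{Q}[G]$ with its usual action.) The associated order of $\mathcal{O}_L$ in $H$ is $\mathfrak{A}_H=\{h\in H\mid h\cdot\mathcal{O}_L\subseteq\mathcal{O}_L\}$, a $\mathbb{Z}$-order in $H$ acting on $\mathcal{O}_L$. *)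

theory Defs
  imports
    "HOL-Computational_Algebra.Computational_Algebra"
    "HOL-Number_Theory.Cong"
    "HOL-Library.Extended_Nat"
    Complex_Main
begin

text \<open>\<^const>\<open>multiplicity\<close> takes the value 0 at 0, whereas the convention here is
  \<open>v\<^sub>p(0) = \<infinity>\<close>.\<close>

definition vp :: "int \<Rightarrow> int \<Rightarrow> enat" where
  "vp p x = (if x = 0 then \<infinity> else enat (multiplicity p x))"

definition exactly_one :: "bool list \<Rightarrow> bool" where
  "exactly_one Ps \<longleftrightarrow> count_list Ps True = 1"

definition cond2 :: "int \<Rightarrow> int \<Rightarrow> bool" where
  "cond2 a b \<longleftrightarrow> exactly_one
    [[b = 1] (mod 2),
     [a = 0] (mod 2) \<and> [b = 2] (mod 4),
     [a = 3] (mod 4) \<and> [b = 0] (mod 4),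
     [a = 1] (mod 4) \<and> [b = 2] (mod 4)]"

definition cond3 :: "int \<Rightarrow> int \<Rightarrow> bool" where
  "cond3 a b \<longleftrightarrow> exactly_one
    [vp 3 a = 0,
     vp 3 a \<ge> 1 \<and> vp 3 b = 1,
     vp 3 a \<ge> 1 \<and> \<not> [a = 3] (mod 9) \<and> vp 3 b = 0 \<and> \<not> [b\<^sup>2 = a + 1] (mod 9),
     [a = 3] (mod 9) \<and> vp 3 b = 0 \<and> \<not> [b\<^sup>2 = 4] (mod 9)]"

definition cond_gt3 :: "int \<Rightarrow> int \<Rightarrow> bool" where
  "cond_gt3 a b \<longleftrightarrow> (\<forall>p. prime p \<and> p > 3 \<longrightarrow> exactly_one
    [vp p a = 0 \<and> vp p b \<ge> 1,
     vp p a \<ge> 1 \<and> vp p b \<le> 1,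
     vp p a = 0 \<and> vp p b = 0 \<and> vp p (4 * a ^ 3 - 27 * b\<^sup>2) \<le> 1])"

definition is_subfield :: "complex set \<Rightarrow> bool" where
  "is_subfield K \<longleftrightarrow> 0 \<in> K \<and> 1 \<in> K \<and>
     (\<forall>x\<in>K. \<forall>y\<in>K. x - y \<in> K \<and> x * y \<in> K) \<and> (\<forall>x\<in>K. inverse x \<in> K)"

definition rat_adjoin :: "complex \<Rightarrow> complex set" where
  "rat_adjoin \<alpha> = \<Inter>{K. is_subfield K \<and> \<alpha> \<in> K}"

definition int_adjoin :: "complex \<Rightarrow> complex set" where
  "int_adjoin \<alpha> = range (\<lambda>p :: int poly. poly (map_poly of_int p) \<alpha>)"

definition qscale :: "rat \<Rightarrow> complex \<Rightarrow> complex" where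
  "qscale q z = of_rat q * z"

definition field_degree :: "complex set \<Rightarrow> nat" where
  "field_degree K = vector_space.dim qscale K"

definition ring_of_integers :: "complex set \<Rightarrow> complex set" where
  "ring_of_integers K = {x \<in> K. algebraic_int x}"

text \<open>Scalar multiplications are passed explicitly, and \<open>V\<close> is the carrier of the source.\<close>

definition rat_linear_on ::
  "'v set \<Rightarrow> (rat \<Rightarrow> 'v \<Rightarrow> 'v) \<Rightarrow> (rat \<Rightarrow> 'w \<Rightarrow> 'w) \<Rightarrow> ('v::plus \<Rightarrow> 'w::plus) \<Rightarrow> bool" where
  "rat_linear_on V s t f \<longleftrightarrow>
     (\<forall>x\<in>V. \<forall>y\<in>V. f (x + y) = f x + f y) \<and> (\<forall>c. \<forall>x\<in>V. f (s c x) = t c (f x))"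

text \<open>An element of \<open>V \<otimes> W\<close> is represented by a list of pairs, \<open>[(v\<^sub>1, w\<^sub>1), \<dots>]\<close> standing for
  \<open>v\<^sub>1 \<otimes> w\<^sub>1 + \<dots>\<close>; similarly, lists of triples represent elements of \<open>U \<otimes> V \<otimes> W\<close>. By the
  universal property of the tensor product, and because linear forms separate the points of a
  vector space over a field, two lists represent the same element if and only if every
  rational-valued multilinear form takes the same value on both. Concatenation of lists is
  addition of tensors.\<close>

definition tensor_eq ::
  "'v set \<Rightarrow> (rat \<Rightarrow> 'v \<Rightarrow> 'v) \<Rightarrow> 'w set \<Rightarrow> (rat \<Rightarrow> 'w \<Rightarrow> 'w) \<Rightarrow>
   ('v::plus \<times> 'w::plus) list \<Rightarrow> ('v \<times> 'w) list \<Rightarrow> bool" where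
  "tensor_eq V s W t us vs \<longleftrightarrow>
    (\<forall>B :: 'v \<Rightarrow> 'w \<Rightarrow> rat.
       (\<forall>w\<in>W. rat_linear_on V s (*) (\<lambda>v. B v w)) \<and> (\<forall>v\<in>V. rat_linear_on W t (*) (B v)) \<longrightarrow>
       (\<Sum>(v, w)\<leftarrow>us. B v w) = (\<Sum>(v, w)\<leftarrow>vs. B v w))"

definition tensor3_eq ::
  "(rat \<Rightarrow> 'v \<Rightarrow> 'v) \<Rightarrow> ('v::plus \<times> 'v \<times> 'v) list \<Rightarrow> ('v \<times> 'v \<times> 'v) list \<Rightarrow> bool" where
  "tensor3_eq s us vs \<longleftrightarrow>
    (\<forall>T :: 'v \<Rightarrow> 'v \<Rightarrow> 'v \<Rightarrow> rat.
       (\<forall>y z. rat_linear_on UNIV s (*) (\<lambda>x. T x y z)) \<and>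
       (\<forall>x z. rat_linear_on UNIV s (*) (\<lambda>y. T x y z)) \<and>
       (\<forall>x y. rat_linear_on UNIV s (*) (\<lambda>z. T x y z)) \<longrightarrow>
       (\<Sum>(x, y, z)\<leftarrow>us. T x y z) = (\<Sum>(x, y, z)\<leftarrow>vs. T x y z))"

text \<open>The Hopf algebra is the whole type \<^typ>\<open>'h\<close>, and \<open>comult h\<close> is a chosen (Sweedler)
  representative of the coproduct of \<open>h\<close>; the axioms below only constrain it up to equality of
  tensors.\<close>

locale cocommutative_rat_hopf_algebra = vector_space scale
  for scale :: "rat \<Rightarrow> 'h::ring_1 \<Rightarrow> 'h" +
  fixes comult :: "'h \<Rightarrow> ('h \<times> 'h) list"
    and counit :: "'h \<Rightarrow> rat"
    and antipode :: "'h \<Rightarrow> 'h"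
  assumes finite_dimensional: "\<exists>B. finite B \<and> span B = UNIV"
    and scale_mult_left: "scale c h * k = scale c (h * k)"
    and scale_mult_right: "h * scale c k = scale c (h * k)"
    and comult_add: "tensor_eq UNIV scale UNIV scale (comult (h + k)) (comult h @ comult k)"
    and comult_scale: "tensor_eq UNIV scale UNIV scale (comult (scale c h))
          (map (\<lambda>(x, y). (scale c x, y)) (comult h))"
    and coassoc: "tensor3_eq scale
          (concat (map (\<lambda>(x, y). map (\<lambda>(x1, x2). (x1, x2, y)) (comult x)) (comult h)))
          (concat (map (\<lambda>(x, y). map (\<lambda>(y1, y2). (x, y1, y2)) (comult y)) (comult h)))"
    and counit_linear: "rat_linear_on UNIV scale (*) counit"
    and counit_left: "(\<Sum>(x, y)\<leftarrow>comult h. scale (counit x) y) = h"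
    and counit_right: "(\<Sum>(x, y)\<leftarrow>comult h. scale (counit y) x) = h"
    and comult_one: "tensor_eq UNIV scale UNIV scale (comult 1) [(1, 1)]"
    and comult_mult: "tensor_eq UNIV scale UNIV scale (comult (h * k))
          (concat (map (\<lambda>(x, y). map (\<lambda>(x', y'). (x * x', y * y')) (comult k)) (comult h)))"
    and counit_one: "counit 1 = 1"
    and counit_mult: "counit (h * k) = counit h * counit k"
    and antipode_linear: "rat_linear_on UNIV scale scale antipode"
    and antipode_left: "(\<Sum>(x, y)\<leftarrow>comult h. antipode x * y) = scale (counit h) 1"
    and antipode_right: "(\<Sum>(x, y)\<leftarrow>comult h. x * antipode y) = scale (counit h) 1"
    and cocommutative: "tensor_eq UNIV scale UNIV scale
          (map (\<lambda>(x, y). (y, x)) (comult h)) (comult h)"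

text \<open>The action is only relevant on \<open>L\<close>. The last two axioms state that
  \<open>L \<otimes> H \<rightarrow> End(L)\<close>, \<open>x \<otimes> h \<mapsto> (y \<mapsto> x (h \<cdot> y))\<close>, is injective and surjective.\<close>

locale hopf_galois_structure = cocommutative_rat_hopf_algebra scale comult counit antipode
  for scale :: "rat \<Rightarrow> 'h::ring_1 \<Rightarrow> 'h"
    and comult :: "'h \<Rightarrow> ('h \<times> 'h) list"
    and counit :: "'h \<Rightarrow> rat"
    and antipode :: "'h \<Rightarrow> 'h" +
  fixes act :: "'h \<Rightarrow> complex \<Rightarrow> complex"
    and L :: "complex set"
  assumes act_closed: "x \<in> L \<Longrightarrow> act h x \<in> L"
    and act_linear_right: "rat_linear_on L qscale qscale (act h)"
    and act_linear_left: "x \<in> L \<Longrightarrow> rat_linear_on UNIV scale qscale (\<lambda>h. act h x)"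
    and act_one: "x \<in> L \<Longrightarrow> act 1 x = x"
    and act_mult: "x \<in> L \<Longrightarrow> act (h * k) x = act h (act k x)"
    and act_on_mult: "x \<in> L \<Longrightarrow> y \<in> L \<Longrightarrow>
          act h (x * y) = (\<Sum>(h1, h2)\<leftarrow>comult h. act h1 x * act h2 y)"
    and act_on_one: "act h 1 = qscale (counit h) 1"
    and galois_inj: "fst ` set us \<subseteq> L \<Longrightarrow> (\<forall>y\<in>L. (\<Sum>(x, h)\<leftarrow>us. x * act h y) = 0) \<Longrightarrow>
          tensor_eq L qscale UNIV scale us []"
    and galois_surj: "E ` L \<subseteq> L \<Longrightarrow> rat_linear_on L qscale qscale E \<Longrightarrow>
          \<exists>us. fst ` set us \<subseteq> L \<and> (\<forall>y\<in>L. (\<Sum>(x, h)\<leftarrow>us. x * act h y) = E y)"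

definition associated_order :: "('h \<Rightarrow> complex \<Rightarrow> complex) \<Rightarrow> complex set \<Rightarrow> 'h set" where
  "associated_order act L = {h. \<forall>x\<in>ring_of_integers L. act h x \<in> ring_of_integers L}"

text \<open>Freeness is the existence of a basis, of unspecified cardinality; \<open>c\<close> is the finitely
  supported family of coordinates with respect to it.\<close>

definition free_over ::
  "'h::zero set \<Rightarrow> ('h \<Rightarrow> complex \<Rightarrow> complex) \<Rightarrow> complex set \<Rightarrow> bool" where
  "free_over A act M \<longleftrightarrow>
    (\<exists>B\<subseteq>M. \<forall>x\<in>M. \<exists>!c. range c \<subseteq> A \<and> {t. c t \<noteq> 0} \<subseteq> B \<and> finite {t. c t \<noteq> 0} \<and>
       x = (\<Sum>t | c t \<noteq> 0. act (c t) t))"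

end

theory Submission
  imports Defs "Jordan_Normal_Form.Char_Poly"
begin

text \<open>Let \<open>\<sigma>\<^sub>0, \<sigma>\<^sub>1, \<sigma>\<^sub>2\<close> be the embeddings of \<open>L\<close> and write \<open>\<sigma>\<^sub>m (h \<cdot> y) = \<Sum>\<^sub>n e\<^sub>m\<^sub>n(h) \<sigma>\<^sub>n(y)\<close>.
  The Hopf-Galois axioms say that for each \<open>m\<close> the functionals \<open>e\<^sub>m\<^sub>0, e\<^sub>m\<^sub>1, e\<^sub>m\<^sub>2\<close> are a basis of
  the complexified dual of the Hopf algebra consisting of orthogonal idempotents, so these bases
  agree up to order. Descending to \<open>\<rat>\<close>, every \<open>h\<close> acts as \<open>k + l Tr + m \<delta> (\<sigma> - \<sigma>\<^sup>2)\<close> with rational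
  \<open>k, l, m\<close>, where \<open>\<delta>\<^sup>2\<close> is the discriminant. If \<open>\<O>\<^sub>L = \<int>[\<alpha>]\<close>, a basis of the associated order can be
  written down; the ring of integers is free iff some element of it has a unimodular matrix, and
  the determinant of that matrix is a linear form times a binary quadratic form of discriminant
  proportional to \<open>\<Delta>\<close>. Completing the square gives the norm equation.

  For the criterion for \<open>\<O>\<^sub>L = \<int>[\<alpha>]\<close>, an integral element with denominator \<open>p\<close> can be normalised to
  one of degree at most 2 and with leading coefficient \<open>1 / p\<close>, which exhibits a point \<open>s\<close> with
  \<open>f'(s) = 0\<close> modulo \<open>p\<close> and \<open>f(s) = 0\<close> modulo \<open>p\<^sup>2\<close>.\<close>

subsection \<open>Sums and products of algebraic integers\<close>

text \<open>The Hopf algebra is abstract: its elements are known only through their action, and its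
  coproduct only up to tensors tested by rational-valued forms. Its structure is therefore
  determined in coordinates, with no normal closure and no Galois group: an embedding is evaluation
  of the same rational coordinates at another root, and rationality is obtained from traces, so the
  Galois and the non-Galois case are treated together. An element of the associated order sends a
  fixed point x + y\<alpha> + z\<alpha>^2 to a point depending linearly on its three integer
  coordinates. The determinant of this map is the trace divided by \<kappa>, times
  \<open>qform y z\<close>, where d * \<open>qform y z\<close> = 3a y^2 - 9b yz + a^2 z^2 has
  discriminant -3\<Delta>. Multiplication by 12a completes the square; d equals g, 3g or 9g in the
  three regimes, whence 12, 36 and 108. Divisibility by 6a recovers the variable absorbed into the
  square, and the condition modulo 3 in the first regime says that the trace factor can be made a
  unit.\<close>

definition int_span :: "'a :: comm_ring_1 set \<Rightarrow> 'a set" where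
  "int_span W = range (\<lambda>c. \<Sum>w\<in>W. of_int (c w) * w)"

lemma int_span_base: "finite W \<Longrightarrow> w \<in> W \<Longrightarrow> w \<in> int_span W"
  unfolding int_span_def
  by (rule image_eqI[where x = "\<lambda>v. if v = w then 1 else 0"])
     (auto simp: if_distrib[of of_int] if_distrib[of "\<lambda>c. c * _"] cong: if_cong)

lemma int_span_zero: "0 \<in> int_span W"
  unfolding int_span_def by (rule image_eqI[where x = "\<lambda>v. 0"]) auto

lemma int_span_add: "x \<in> int_span W \<Longrightarrow> y \<in> int_span W \<Longrightarrow> x + y \<in> int_span W"
  unfolding int_span_def
  by (clarify, rule_tac x = "\<lambda>v. c v + ca v" in image_eqI)
     (auto simp: algebra_simps sum.distrib)

lemma int_span_scale: "x \<in> int_span W \<Longrightarrow> of_int n * x \<in> int_span W"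
  unfolding int_span_def
  by (clarify, rule_tac x = "\<lambda>v. n * c v" in image_eqI)
     (auto simp: algebra_simps sum_distrib_left)

lemma int_span_sum: "(\<And>i. i \<in> I \<Longrightarrow> f i \<in> int_span W) \<Longrightarrow> (\<Sum>i\<in>I. f i) \<in> int_span W"
  by (induction I rule: infinite_finite_induct) (auto simp: int_span_zero int_span_add)

lemma int_span_mult_closed:
  assumes "\<And>w. w \<in> W \<Longrightarrow> x * w \<in> int_span W" and "y \<in> int_span W"
  shows "x * y \<in> int_span W"
proof -
  obtain c where y: "y = (\<Sum>w\<in>W. of_int (c w) * w)"
    using assms(2) by (auto simp: int_span_def)
  have "x * y = (\<Sum>w\<in>W. of_int (c w) * (x * w))"
    by (simp add: y sum_distrib_left algebra_simps)
  then show ?thesis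
    using assms(1) by (auto intro!: int_span_sum int_span_scale)
qed

text \<open>The determinant trick: multiplication by x has an integer matrix on the family W, and
  the vector of members of W is an eigenvector, so x is a root of a monic integral characteristic
  polynomial. Having 1 in W is what makes this vector nonzero.\<close>

lemma algebraic_int_if_int_span_invariant:
  fixes x :: "'a :: field_char_0"
  assumes fin: "finite W" and one: "1 \<in> W" and inv: "\<And>w. w \<in> W \<Longrightarrow> x * w \<in> int_span W"
  shows "algebraic_int x"
proof -
  define n where "n = card W"
  obtain e where e: "bij_betw e {..<n} W"
    unfolding n_def using ex_bij_betw_nat_finite[OF fin] by (auto simp: atLeast0LessThan)
  have "\<forall>w\<in>W. \<exists>c. x * w = (\<Sum>v\<in>W. of_int (c v) * v)"
    using inv by (auto simp: int_span_def)
  then obtain c :: "'a \<Rightarrow> 'a \<Rightarrow> int" where c: "\<And>w. w \<in> W \<Longrightarrow> x * w = (\<Sum>v\<in>W. of_int (c w v) * v)"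
    by metis
  define A where "A = mat n n (\<lambda>(i, j). c (e i) (e j))"
  define v where "v = vec n e"
  have A: "A \<in> carrier_mat n n" by (simp add: A_def)
  have eW: "e i \<in> W" if "i < n" for i using e that by (auto simp: bij_betw_def)
  obtain k where k: "k < n" "e k = 1" using e one by (auto simp: bij_betw_def)
  have "map_mat of_int A *\<^sub>v v = x \<cdot>\<^sub>v v"
  proof (rule eq_vecI)
    fix i assume "i < dim_vec (x \<cdot>\<^sub>v v)"
    then have i: "i < n" by (simp add: v_def)
    have "(map_mat of_int A *\<^sub>v v) $ i = (\<Sum>j<n. of_int (c (e i) (e j)) * e j)"
      using i by (simp add: A_def v_def scalar_prod_def atLeast0LessThan)
    also have "\<dots> = (\<Sum>w\<in>W. of_int (c (e i) w) * w)"
      by (rule sum.reindex_bij_betw[OF e])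
    finally show "(map_mat of_int A *\<^sub>v v) $ i = (x \<cdot>\<^sub>v v) $ i"
      using i c[OF eW[OF i]] by (simp add: v_def)
  qed (simp add: A_def v_def)
  moreover have "v \<noteq> 0\<^sub>v n"
  proof
    assume "v = 0\<^sub>v n"
    then have "v $ k = 0" using k by simp
    with k show False by (simp add: v_def)
  qed
  ultimately have "eigenvalue (map_mat of_int A) x"
    unfolding eigenvalue_def eigenvector_def by (intro exI[of _ v]) (simp add: A_def v_def)
  then have "poly (char_poly (map_mat of_int A)) x = 0"
    using eigenvalue_root_char_poly[of "map_mat of_int A" n x] A by simp
  then have "poly (map_poly of_int (char_poly A)) x = 0"
    by (simp add: of_int_hom.char_poly_hom[OF A])
  moreover have "lead_coeff (char_poly A) = 1"
    using degree_monic_char_poly[OF A] by simp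
  ultimately show ?thesis
    by (auto simp: algebraic_int_altdef_ipoly)
qed

lemma algebraic_int_power_reduction:
  fixes x :: "'a :: field_char_0"
  assumes "algebraic_int x"
  obtains d and q :: "nat \<Rightarrow> int" where "d > 0" "x ^ d = (\<Sum>i<d. of_int (q i) * x ^ i)"
proof -
  obtain p where p: "poly (map_poly of_int p) x = 0" "lead_coeff p = 1"
    using assms by (auto simp: algebraic_int_altdef_ipoly)
  define d where "d = degree p"
  have deg: "degree (map_poly of_int p :: 'a poly) = d"
    by (simp add: d_def degree_map_poly)
  have "(\<Sum>i\<le>d. of_int (coeff p i) * x ^ i) = 0"
    using p(1) unfolding poly_altdef deg by (simp add: coeff_map_poly)
  moreover have "(\<Sum>i\<le>d. of_int (coeff p i) * x ^ i) = (\<Sum>i<d. of_int (coeff p i) * x ^ i) + x ^ d"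
    using p(2) by (simp add: d_def lessThan_Suc_atMost[symmetric])
  ultimately have "x ^ d = (\<Sum>i<d. of_int (- coeff p i) * x ^ i)"
    by (simp add: sum_negf eq_neg_iff_add_eq_0 add.commute)
  moreover have "d > 0"
    using p by (cases "d = 0") (auto simp: d_def elim!: degree_eq_zeroE)
  ultimately show ?thesis by (rule that[rotated])
qed

text \<open>The monomials x^i y^j below the degrees of two monic equations span Z[x, y]. One family
  serves both multiplications, so it is also invariant under x + y and x y.\<close>

lemma algebraic_int_pair_int_span:
  fixes x y :: "'a :: field_char_0"
  assumes "algebraic_int x" "algebraic_int y"
  obtains W where "finite W" "1 \<in> W"
    "\<And>w. w \<in> W \<Longrightarrow> x * w \<in> int_span W" "\<And>w. w \<in> W \<Longrightarrow> y * w \<in> int_span W"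
proof -
  obtain d q where d: "d > 0" "x ^ d = (\<Sum>i<d. of_int (q i) * x ^ i)"
    by (rule algebraic_int_power_reduction[OF assms(1)])
  obtain e r where e: "e > 0" "y ^ e = (\<Sum>i<e. of_int (r i) * y ^ i)"
    by (rule algebraic_int_power_reduction[OF assms(2)])
  define W where "W = (\<lambda>(i, j). x ^ i * y ^ j) ` ({..<d} \<times> {..<e})"
  have fin: "finite W" by (simp add: W_def)
  have W: "x ^ i * y ^ j \<in> int_span W" if "i < d" "j < e" for i j
    by (rule int_span_base[OF fin]) (use that in \<open>auto simp: W_def\<close>)
  show ?thesis
  proof (rule that[OF fin])
    show "1 \<in> W"
      unfolding W_def by (rule image_eqI[where x = "(0, 0)"]) (use d e in auto)
  next
    fix w assume "w \<in> W"
    then obtain i j where ij: "i < d" "j < e" "w = x ^ i * y ^ j" by (auto simp: W_def)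
    show "x * w \<in> int_span W"
    proof (cases "Suc i < d")
      case True
      then show ?thesis using W[of "Suc i" j] ij by (simp add: mult.assoc)
    next
      case False
      with ij have "d = Suc i" by simp
      then have "x * w = x ^ d * y ^ j" by (simp add: ij mult.assoc)
      also have "\<dots> = (\<Sum>i<d. of_int (q i) * (x ^ i * y ^ j))"
        by (simp add: d sum_distrib_right mult.assoc)
      finally show ?thesis using W ij by (auto intro!: int_span_sum int_span_scale)
    qed
    show "y * w \<in> int_span W"
    proof (cases "Suc j < e")
      case True
      then show ?thesis using W[of i "Suc j"] ij by (simp add: mult_ac)
    next
      case False
      with ij have "e = Suc j" by simp
      then have "y * w = x ^ i * y ^ e" by (simp add: ij mult_ac)
      also have "\<dots> = (\<Sum>j<e. of_int (r j) * (x ^ i * y ^ j))"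
        by (simp add: e sum_distrib_left mult_ac)
      finally show ?thesis using W ij by (auto intro!: int_span_sum int_span_scale)
    qed
  qed
qed

lemma algebraic_int_add:
  fixes x y :: "'a :: field_char_0"
  assumes "algebraic_int x" "algebraic_int y"
  shows "algebraic_int (x + y)"
proof (rule algebraic_int_pair_int_span[OF assms])
  fix W assume "finite W" "1 \<in> W"
    "\<And>w. w \<in> W \<Longrightarrow> x * w \<in> int_span W" "\<And>w. w \<in> W \<Longrightarrow> y * w \<in> int_span W"
  then show ?thesis
    by (intro algebraic_int_if_int_span_invariant[of W]) (auto simp: distrib_right int_span_add)
qed

lemma algebraic_int_mult:
  fixes x y :: "'a :: field_char_0"
  assumes "algebraic_int x" "algebraic_int y"
  shows "algebraic_int (x * y)"
proof (rule algebraic_int_pair_int_span[OF assms])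
  fix W assume "finite W" "1 \<in> W"
    "\<And>w. w \<in> W \<Longrightarrow> x * w \<in> int_span W" "\<And>w. w \<in> W \<Longrightarrow> y * w \<in> int_span W"
  then show ?thesis
    by (intro algebraic_int_if_int_span_invariant[of W]) (auto simp: mult.assoc int_span_mult_closed)
qed

subsection \<open>The field generated by a root of a cubic\<close>

text \<open>The point is an argument because the same rational coordinates are evaluated at every
  root of the cubic: at \<alpha> they give an element of the field, at another root its
  conjugate.\<close>

definition quad :: "rat \<Rightarrow> rat \<Rightarrow> rat \<Rightarrow> complex \<Rightarrow> complex" where
  "quad r s t x = of_rat r + of_rat s * x + of_rat t * x\<^sup>2"

interpretation ratvs: vector_space qscale
  by unfold_locales (auto simp: qscale_def algebra_simps of_rat_add of_rat_mult)

lemma quad_in_rat_adjoin: "quad r s t x \<in> rat_adjoin x"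
proof -
  have "quad r s t x \<in> K" if K: "is_subfield K" "x \<in> K" for K
  proof -
    have minus: "u - v \<in> K" if "u \<in> K" "v \<in> K" for u v using K that by (auto simp: is_subfield_def)
    have mult: "u * v \<in> K" if "u \<in> K" "v \<in> K" for u v using K that by (auto simp: is_subfield_def)
    have inv: "inverse u \<in> K" if "u \<in> K" for u using K that by (auto simp: is_subfield_def)
    have "0 \<in> K" "1 \<in> K" using K by (auto simp: is_subfield_def)
    then have uminus: "- u \<in> K" if "u \<in> K" for u using minus[of 0 u] that by simp
    have plus: "u + v \<in> K" if "u \<in> K" "v \<in> K" for u v using minus[of u "- v"] uminus that by simp
    have nat: "of_nat n \<in> K" for n
      by (induction n) (use plus \<open>0 \<in> K\<close> \<open>1 \<in> K\<close> in auto)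
    have int: "of_int n \<in> K" for n
      by (cases n) (use nat uminus in \<open>auto simp del: of_nat_Suc\<close>)
    have "of_rat q \<in> K" for q
      by (cases q) (use int mult inv in \<open>auto simp: of_rat_rat divide_inverse\<close>)
    then show ?thesis
      using K by (auto simp: quad_def power2_eq_square intro!: plus mult)
  qed
  then show ?thesis by (auto simp: rat_adjoin_def)
qed

lemma span_powers_eq_quad: "ratvs.span {1, x, x\<^sup>2} = {quad r s t x | r s t. True}"
proof -
  have "v \<in> ratvs.span {1, x, x\<^sup>2} \<longleftrightarrow> (\<exists>r s t. v = quad r s t x)" for v
    by (auto simp: ratvs.span_insert ratvs.span_singleton qscale_def quad_def algebra_simps)
  then show ?thesis by blast
qed

text \<open>Kept apart from the independence of the powers of the root, so that the multiplication
  rule can be reused at each conjugate.\<close>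

locale cubic_equation =
  fixes a b :: int and \<beta> :: complex
  assumes root: "\<beta> ^ 3 - of_int a * \<beta> + of_int b = 0"
begin

lemma cube: "\<beta> ^ 3 = of_int a * \<beta> - of_int b"
  using root by (simp add: algebra_simps eq_neg_iff_add_eq_0 add_eq_0_iff2)

lemma quadratic_mult:
  "(r + s * \<beta> + t * \<beta>\<^sup>2) * (r' + s' * \<beta> + t' * \<beta>\<^sup>2) =
    (r * r' - of_int b * (s * t' + t * s')) +
    (r * s' + s * r' + of_int a * (s * t' + t * s') - of_int b * t * t') * \<beta> +
    (r * t' + s * s' + t * r' + of_int a * t * t') * \<beta>\<^sup>2" (is "?l = ?r")
proof -
  \<comment> \<open>The last factor is the quotient in the division of the product by the
    cubic.\<close>
  have "?l = ?r + (\<beta> ^ 3 - (of_int a * \<beta> - of_int b)) * (s * t' + t * s' + t * t' * \<beta>)"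
    by (simp add: algebra_simps power2_eq_square power3_eq_cube)
  then show ?thesis by (simp add: cube)
qed

lemma quad_mult:
  "quad r s t \<beta> * quad r' s' t' \<beta> =
    quad (r * r' - of_int b * (s * t' + t * s'))
         (r * s' + s * r' + of_int a * (s * t' + t * s') - of_int b * t * t')
         (r * t' + s * s' + t * r' + of_int a * t * t') \<beta>"
  unfolding quad_def of_rat_add of_rat_mult of_rat_diff of_rat_of_int_eq
  by (rule quadratic_mult)

text \<open>Inverses come from finite dimension: multiplication by a nonzero x maps a basis of the
  span of the powers to an independent family of the same size, whose span must then contain
  1.\<close>

lemma rat_adjoin_eq: "rat_adjoin \<beta> = {quad r s t \<beta> | r s t. True}" (is "_ = ?V")
proof
  have V: "?V = ratvs.span {1, \<beta>, \<beta>\<^sup>2}" by (simp add: span_powers_eq_quad)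
  have one: "1 \<in> ?V" unfolding V by (auto intro: ratvs.span_base)
  have mult: "x * y \<in> ?V" if "x \<in> ?V" "y \<in> ?V" for x y
    using that quad_mult by blast
  have "inverse x \<in> ?V" if "x \<in> ?V" for x
  proof (cases "x = 0")
    case True
    then show ?thesis by (auto intro!: exI[of _ 0] simp: quad_def)
  next
    case False
    obtain B where B: "B \<subseteq> ?V" "ratvs.independent B" "?V \<subseteq> ratvs.span B"
      by (rule ratvs.maximal_independent_subset)
    have finB: "finite B"
      using ratvs.independent_span_bound[of "{1, \<beta>, \<beta>\<^sup>2}" B] B V by auto
    have spanB: "ratvs.span B = ?V"
      using B V by (metis ratvs.span_minimal ratvs.subspace_span subset_antisym)
    interpret vector_space_pair qscale qscale ..
    have lin: "Vector_Spaces.linear qscale qscale ((*) x)"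
      by unfold_locales (simp_all add: qscale_def algebra_simps)
    have inj: "inj_on ((*) x) (ratvs.span B)" using False by (auto intro: inj_onI)
    have ind: "ratvs.independent ((*) x ` B)"
      by (rule linear_independent_injective_image[OF lin B(2) inj])
    have sub: "(*) x ` B \<subseteq> ?V" using B(1) mult[OF that] by (simp only: image_subset_iff) blast
    have card: "card ((*) x ` B) = card B" using False by (simp add: card_image inj_on_def)
    have "1 \<in> ratvs.span ((*) x ` B)"
    proof (rule ccontr)
      assume "1 \<notin> ratvs.span ((*) x ` B)"
      then have "ratvs.independent (insert 1 ((*) x ` B))" "1 \<notin> (*) x ` B"
        using ratvs.independent_insertI[OF _ ind] by (auto intro: ratvs.span_base)
      moreover have "insert 1 ((*) x ` B) \<subseteq> ratvs.span B"
        using sub one unfolding spanB by blast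
      ultimately have "card (insert 1 ((*) x ` B)) \<le> card B"
        using ratvs.independent_span_bound[OF finB] by blast
      then show False using card finB \<open>1 \<notin> (*) x ` B\<close> by simp
    qed
    also have "ratvs.span ((*) x ` B) = (*) x ` ?V"
      using linear_span_image[OF lin] spanB by simp
    finally obtain y where "y \<in> ?V" "1 = x * y" by blast
    then have "inverse x = y" by (intro inverse_unique) simp
    then show ?thesis using \<open>y \<in> ?V\<close> by simp
  qed
  moreover have "x - y \<in> ?V" if "x \<in> ?V" "y \<in> ?V" for x y
    using that unfolding V by (rule ratvs.span_diff)
  moreover note mult
  moreover have "0 \<in> ?V" "1 \<in> ?V" "\<beta> \<in> ?V"
    unfolding V by (auto intro: ratvs.span_base ratvs.span_zero)
  ultimately have "is_subfield ?V" "\<beta> \<in> ?V"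
    by (auto simp: is_subfield_def simp del: mem_Collect_eq)
  then show "rat_adjoin \<beta> \<subseteq> ?V" unfolding rat_adjoin_def by blast
qed (use quad_in_rat_adjoin in auto)

lemma int_adjoin_eq: "int_adjoin \<beta> = {quad (of_int i) (of_int j) (of_int k) \<beta> | i j k. True}"
  (is "_ = ?V")
proof
  have "poly (map_poly of_int p) \<beta> \<in> ?V" for p :: "int poly"
  proof (induction p)
    case 0
    show ?case by (auto intro!: exI[of _ 0] simp: quad_def)
  next
    case (pCons c p)
    then obtain i j k where p: "poly (map_poly of_int p) \<beta> = quad (of_int i) (of_int j) (of_int k) \<beta>"
      by auto
    have "of_int k * \<beta> ^ 3 = of_int k * (of_int a * \<beta> - of_int b)" by (simp add: cube)
    then have "poly (map_poly of_int (pCons c p)) \<beta> =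
        quad (of_int (c - b * k)) (of_int (i + a * k)) (of_int j) \<beta>"
      by (simp add: of_int_hom.map_poly_pCons_hom p quad_def algebra_simps power2_eq_square power3_eq_cube of_rat_add of_rat_mult of_rat_diff)
    then show ?case by blast
  qed
  then show "int_adjoin \<beta> \<subseteq> ?V" by (auto simp: int_adjoin_def)
  show "?V \<subseteq> int_adjoin \<beta>"
  proof clarify
    fix i j k
    show "quad (of_int i) (of_int j) (of_int k) \<beta> \<in> int_adjoin \<beta>"
      unfolding int_adjoin_def
      by (rule image_eqI[where x = "[:i, j, k:]"])
         (auto simp: quad_def of_int_hom.map_poly_pCons_hom algebra_simps power2_eq_square)
  qed
qed

text \<open>A relation with t or s nonzero would leave two elements spanning a space of dimension
  three.\<close>

lemma quad_eq_0_if_degree_3: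
  assumes deg: "field_degree (rat_adjoin \<beta>) = 3" and "quad r s t \<beta> = 0"
  shows "r = 0 \<and> s = 0 \<and> t = 0"
proof -
  have dim: "ratvs.dim (ratvs.span {1, \<beta>, \<beta>\<^sup>2}) = 3"
    using deg by (simp add: field_degree_def rat_adjoin_eq span_powers_eq_quad)
  have small: "\<not> {1, \<beta>, \<beta>\<^sup>2} \<subseteq> ratvs.span {x, y}" for x y
  proof
    assume "{1, \<beta>, \<beta>\<^sup>2} \<subseteq> ratvs.span {x, y}"
    then have "ratvs.span {1, \<beta>, \<beta>\<^sup>2} \<subseteq> ratvs.span {x, y}"
      by (simp add: ratvs.span_minimal)
    from ratvs.dim_le_card[OF this] have "ratvs.dim (ratvs.span {1, \<beta>, \<beta>\<^sup>2}) \<le> card {x, y}" by simp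
    also have "\<dots> \<le> 2" by (simp add: card_insert_if)
    finally show False using dim by simp
  qed
  have eq: "of_rat r + of_rat s * \<beta> + of_rat t * \<beta>\<^sup>2 = 0" using assms(2) by (simp add: quad_def)
  have t: "t = 0"
  proof (rule ccontr)
    assume "t \<noteq> 0"
    moreover have "of_rat t * \<beta>\<^sup>2 = - of_rat r - of_rat s * \<beta>"
      using eq by (simp add: eq_diff_eq eq_neg_iff_add_eq_0 ac_simps)
    ultimately have "\<beta>\<^sup>2 = qscale (- r / t) 1 + qscale (- s / t) \<beta>"
      by (simp add: qscale_def of_rat_divide of_rat_minus field_simps)
    also have "\<dots> \<in> ratvs.span {1, \<beta>}"
      by (intro ratvs.span_add ratvs.span_scale ratvs.span_base) auto
    finally show False using small[of 1 \<beta>] by (auto intro: ratvs.span_base)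
  qed
  have s: "s = 0"
  proof (rule ccontr)
    assume "s \<noteq> 0"
    moreover have "of_rat s * \<beta> = - of_rat r"
      using eq t by (simp add: eq_neg_iff_add_eq_0 add.commute)
    ultimately have "\<beta> = qscale (- r / s) 1"
      by (simp add: qscale_def of_rat_divide of_rat_minus field_simps)
    also have "\<dots> \<in> ratvs.span {1, \<beta>\<^sup>2}"
      by (intro ratvs.span_add ratvs.span_scale ratvs.span_base) auto
    finally show False using small[of 1 "\<beta>\<^sup>2"] by (auto intro: ratvs.span_base)
  qed
  from eq s t show ?thesis by simp
qed

end

subsection \<open>Conjugates\<close>

text \<open>Explicit cofactors placing the discriminant in the ideal generated by f and f'^2, for f
  = X^3 - AX + B. At a root it reads disc = f'^2 (4A - 3X^2); at an integer where p divides f' and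
  p^2 divides f it shows that p^2 divides the discriminant.\<close>

lemma disc_identity:
  fixes A B X :: "'a :: comm_ring_1"
  shows "4 * A ^ 3 - 27 * B\<^sup>2 = (X ^ 3 - A * X + B) * (27 * X ^ 3 - 27 * A * X - 27 * B)
     - (3 * X\<^sup>2 - A)\<^sup>2 * (3 * X\<^sup>2 - 4 * A)"
  by (simp add: algebra_simps power2_eq_square power3_eq_cube)

lemma less_3_cases: "(n::nat) < 3 \<Longrightarrow> (n = 0 \<Longrightarrow> P) \<Longrightarrow> (n = 1 \<Longrightarrow> P) \<Longrightarrow> (n = 2 \<Longrightarrow> P) \<Longrightarrow> P"
  by linarith

lemma sum_less_3: "(\<Sum>n<3::nat. f n) = f 0 + f 1 + f 2"
  by (simp add: eval_nat_numeral)

lemma third_index: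
  assumes "(m::nat) < 3" obtains n k where "n < 3" "k < 3" "n \<noteq> m" "k \<noteq> m" "n \<noteq> k"
  using assms by (elim less_3_cases) (rule that[of 1 2] that[of 0 2] that[of 0 1]; simp)+

lemma quad_add: "quad r s t x + quad r' s' t' x = quad (r + r') (s + s') (t + t') x"
  by (simp add: quad_def of_rat_add algebra_simps)

lemma quad_scale: "of_rat c * quad r s t x = quad (c * r) (c * s) (c * t) x"
  by (simp add: quad_def of_rat_mult algebra_simps)

locale cubic_field = cubic_equation a b \<alpha> for a b \<alpha> +
  assumes quad_eq_0: "quad r s t \<alpha> = 0 \<Longrightarrow> r = 0 \<and> s = 0 \<and> t = 0"
begin

abbreviation "L \<equiv> rat_adjoin \<alpha>"

text \<open>Dividing the cubic by x - \<alpha> leaves x^2 + \<alpha> x + \<alpha>^2 - a, of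
  discriminant 4a - 3\<alpha>^2; the indices 1 and 2 are its roots.\<close>

definition rt :: "nat \<Rightarrow> complex" where
  "rt n = (if n = 0 then \<alpha> else
    (- \<alpha> + (if n = 1 then 1 else - 1) * csqrt (4 * of_int a - 3 * \<alpha>\<^sup>2)) / 2)"

lemma rt_0 [simp]: "rt 0 = \<alpha>"
  by (simp add: rt_def)

lemma rt_12:
  "rt 1 + rt 2 = - \<alpha>" "rt 1 * rt 2 = \<alpha>\<^sup>2 - of_int a" "(rt 1 - rt 2)\<^sup>2 = 4 * of_int a - 3 * \<alpha>\<^sup>2"
proof -
  define q where "q = csqrt (4 * of_int a - 3 * \<alpha>\<^sup>2)"
  have q: "q * q = 4 * of_int a - 3 * \<alpha>\<^sup>2" by (simp add: q_def flip: power2_eq_square)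
  have r: "rt 1 = (- \<alpha> + q) / 2" "rt 2 = (- \<alpha> - q) / 2" by (simp_all add: rt_def q_def)
  show "rt 1 + rt 2 = - \<alpha>" unfolding r by (simp add: field_simps)
  show "rt 1 * rt 2 = \<alpha>\<^sup>2 - of_int a" unfolding r using q by (simp add: field_simps power2_eq_square)
  show "(rt 1 - rt 2)\<^sup>2 = 4 * of_int a - 3 * \<alpha>\<^sup>2" unfolding r using q by (simp add: field_simps power2_eq_square)
qed

text \<open>The divided difference (f(x) - f(y)) / (x - y) is x^2 + xy + y^2 - a. It is derived from
  the sum and product of the roots, so it is available before the roots are known to be distinct,
  which follows from it.\<close>

lemma rt_relation:
  assumes "n < 3" "m < 3" "n \<noteq> m"
  shows "(rt n)\<^sup>2 + rt n * rt m + (rt m)\<^sup>2 = of_int a"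
proof -
  have r2: "rt 2 = - \<alpha> - rt 1" using rt_12(1) by (simp add: algebra_simps eq_neg_iff_add_eq_0)
  have p: "rt 1 * (- \<alpha> - rt 1) = \<alpha>\<^sup>2 - of_int a" using rt_12(2) by (simp only: r2)
  then have "rt 1 * rt 1 = of_int a - \<alpha>\<^sup>2 - rt 1 * \<alpha>" by (simp add: algebra_simps)
  with assms show ?thesis
    by (elim less_3_cases) (simp_all add: r2 algebra_simps power2_eq_square)
qed

lemma rt_root: "n < 3 \<Longrightarrow> rt n ^ 3 - of_int a * rt n + of_int b = 0"
proof -
  assume n: "n < 3"
  have "rt n ^ 3 - of_int a * rt n + of_int b = 0" if "n \<noteq> 0"
  proof -
    have rel: "(rt n)\<^sup>2 + rt n * \<alpha> + \<alpha>\<^sup>2 = of_int a" using rt_relation[of n 0] n that by simp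
    have "rt n ^ 3 - of_int a * rt n + of_int b =
      (rt n - \<alpha>) * ((rt n)\<^sup>2 + rt n * \<alpha> + \<alpha>\<^sup>2 - of_int a) + (\<alpha> ^ 3 - of_int a * \<alpha> + of_int b)"
      by (simp add: algebra_simps power2_eq_square power3_eq_cube)
    then show ?thesis using rel root by simp
  qed
  then show ?thesis using root by (cases "n = 0") auto
qed

lemma cubic_equation_rt: "n < 3 \<Longrightarrow> cubic_equation a b (rt n)"
  by unfold_locales (rule rt_root)

lemma disc_nonzero: "4 * a ^ 3 - 27 * b\<^sup>2 \<noteq> 0"
proof
  assume "4 * a ^ 3 - 27 * b\<^sup>2 = 0"
  then have eq: "of_int (4 * a ^ 3) = (of_int (27 * b\<^sup>2) :: complex)" by simp
  \<comment> \<open>For nonzero a and vanishing discriminant the cubic has the double root 3b/(2a)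
    and the simple root -3b/a. This is that factorisation with denominators cleared; it would make
    \<alpha> a root of a rational linear equation.\<close>
  have "4 * of_int a ^ 3 * (\<alpha> ^ 3 - of_int a * \<alpha> + of_int b) =
      (2 * of_int a * \<alpha> - 3 * of_int b)\<^sup>2 * (of_int a * \<alpha> + 3 * of_int b)
      + (of_int (27 * b\<^sup>2) - of_int (4 * a ^ 3)) * (of_int a * \<alpha> - of_int b)"
    by (simp add: algebra_simps power2_eq_square power3_eq_cube)
  then have "(2 * of_int a * \<alpha> - 3 * of_int b)\<^sup>2 * (of_int a * \<alpha> + 3 * of_int b) = 0"
    using root eq by simp
  moreover have "quad (- 3 * of_int b) (2 * of_int a) 0 \<alpha> = 2 * of_int a * \<alpha> - 3 * of_int b"
    "quad (3 * of_int b) (of_int a) 0 \<alpha> = of_int a * \<alpha> + 3 * of_int b"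
    by (simp_all add: quad_def of_rat_mult of_rat_minus)
  ultimately have "quad (- 3 * of_int b) (2 * of_int a) 0 \<alpha> = 0 \<or> quad (3 * of_int b) (of_int a) 0 \<alpha> = 0"
    by simp
  then have "a = 0" "b = 0" using quad_eq_0 by fastforce+
  then have "quad 0 1 0 \<alpha> = 0" using root by (simp add: quad_def)
  then show False using quad_eq_0 by fastforce
qed

lemma deriv_rt_nonzero:
  assumes "n < 3"
  shows "3 * (rt n)\<^sup>2 - of_int a \<noteq> 0"
proof
  assume *: "3 * (rt n)\<^sup>2 - of_int a = 0"
  have "of_int (4 * a ^ 3 - 27 * b\<^sup>2) = (0::complex)"
    using disc_identity[of "of_int a" "of_int b" "rt n"] by (simp add: * rt_root[OF assms])
  then show False using disc_nonzero of_int_eq_0_iff by blast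
qed

lemma rt_distinct: "n < 3 \<Longrightarrow> m < 3 \<Longrightarrow> n \<noteq> m \<Longrightarrow> rt n \<noteq> rt m"
  using rt_relation[of n m] deriv_rt_nonzero[of m] by (auto simp: power2_eq_square)

lemma rt_sum: "rt 0 + rt 1 + rt 2 = 0"
  using rt_12(1) by (simp add: add.assoc)

lemma rt_prod: "rt 0 * rt 1 * rt 2 = - of_int b"
proof -
  have "rt 0 * rt 1 * rt 2 = \<alpha> * (\<alpha>\<^sup>2 - of_int a)"
    by (simp only: rt_0 mult.assoc rt_12(2))
  also have "\<dots> = - of_int b" using cube by (simp add: algebra_simps power2_eq_square power3_eq_cube)
  finally show ?thesis .
qed

lemma quad_inject:
  "quad r s t \<alpha> = quad r' s' t' \<alpha> \<longleftrightarrow> r = r' \<and> s = s' \<and> t = t'"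
proof
  assume "quad r s t \<alpha> = quad r' s' t' \<alpha>"
  then have "quad (r - r') (s - s') (t - t') \<alpha> = 0"
    by (simp add: quad_def of_rat_diff algebra_simps)
  from quad_eq_0[OF this] show "r = r' \<and> s = s' \<and> t = t'" by simp
qed simp

lemma L_cases:
  assumes "x \<in> L" obtains r s t where "x = quad r s t \<alpha>"
  using assms by (auto simp: rat_adjoin_eq)

lemma quad_in_L [simp]: "quad r s t \<alpha> \<in> L"
  by (rule quad_in_rat_adjoin)

lemma L_add: "x \<in> L \<Longrightarrow> y \<in> L \<Longrightarrow> x + y \<in> L"
  by (elim L_cases) (simp add: quad_add)

lemma L_mult: "x \<in> L \<Longrightarrow> y \<in> L \<Longrightarrow> x * y \<in> L"
  by (elim L_cases) (simp add: quad_mult)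

lemma L_of_rat: "of_rat q \<in> L"
  using quad_in_L[of q 0 0] by (simp add: quad_def)

lemma L_sum_list: "(\<And>x. x \<in> set xs \<Longrightarrow> f x \<in> L) \<Longrightarrow> (\<Sum>x\<leftarrow>xs. f x) \<in> L"
  using L_of_rat[of 0] by (induction xs) (auto intro: L_add)

definition emb :: "nat \<Rightarrow> complex \<Rightarrow> complex" where
  "emb n x = (THE y. \<exists>r s t. x = quad r s t \<alpha> \<and> y = quad r s t (rt n))"

lemma emb_quad [simp]: "emb n (quad r s t \<alpha>) = quad r s t (rt n)"
  unfolding emb_def by (rule the_equality) (auto simp: quad_inject)

lemma emb_0: "x \<in> L \<Longrightarrow> emb 0 x = x"
  by (elim L_cases) simp

lemma emb_of_rat: "emb n (of_rat q) = of_rat q"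
  using emb_quad[of n q 0 0] by (simp add: quad_def)

lemma emb_add: "x \<in> L \<Longrightarrow> y \<in> L \<Longrightarrow> emb n (x + y) = emb n x + emb n y"
  by (elim L_cases) (simp add: quad_add)

lemma emb_mult: "n < 3 \<Longrightarrow> x \<in> L \<Longrightarrow> y \<in> L \<Longrightarrow> emb n (x * y) = emb n x * emb n y"
  using cubic_equation.quad_mult[OF cubic_equation_rt, of n] by (elim L_cases) (simp add: quad_mult)

lemma emb_sum_list:
  "(\<And>x. x \<in> set xs \<Longrightarrow> f x \<in> L) \<Longrightarrow> emb n (\<Sum>x\<leftarrow>xs. f x) = (\<Sum>x\<leftarrow>xs. emb n (f x))"
  using emb_of_rat[of n 0] by (induction xs) (auto simp: emb_add L_sum_list)

lemma emb_gen: "emb n \<alpha> = rt n" "emb n (\<alpha>\<^sup>2) = (rt n)\<^sup>2" "\<alpha> \<in> L" "\<alpha>\<^sup>2 \<in> L"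
  using emb_quad[of n 0 1 0] emb_quad[of n 0 0 1] quad_in_L[of 0 1 0] quad_in_L[of 0 0 1]
  by (simp_all add: quad_def)

lemma emb_eq_0_iff: "x \<in> L \<Longrightarrow> n < 3 \<Longrightarrow> emb n x = 0 \<longleftrightarrow> x = 0"
proof
  assume x: "x \<in> L" "n < 3" "emb n x = 0"
  show "x = 0"
  proof (rule ccontr)
    assume "x \<noteq> 0"
    moreover have "inverse x \<in> L" using x(1) by (auto simp: rat_adjoin_def is_subfield_def)
    ultimately have "emb n (x * inverse x) = emb n x * emb n (inverse x)"
      using x by (intro emb_mult) auto
    then show False using \<open>x \<noteq> 0\<close> x(3) emb_of_rat[of n 1] by simp
  qed
next
  assume "x = 0" then show "emb n x = 0" using emb_of_rat[of n 0] by simp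
qed

text \<open>The roots have power sums 0 and 2a, so the middle coordinate drops out of the
  trace.\<close>

definition tr :: "rat \<Rightarrow> rat \<Rightarrow> rat" where
  "tr r t = 3 * r + 2 * of_int a * t"

lemma conjugates_sum: "quad r s t (rt 0) + quad r s t (rt 1) + quad r s t (rt 2) = of_rat (tr r t)"
proof -
  have "quad r s t (rt 0) + quad r s t (rt 1) + quad r s t (rt 2) =
      of_rat (tr r t) + of_rat s * (rt 0 + rt 1 + rt 2)
      + of_rat t * ((rt 1 + rt 2)\<^sup>2 - 2 * (rt 1 * rt 2) + \<alpha>\<^sup>2 - 2 * of_int a)"
    by (simp add: quad_def tr_def of_rat_add of_rat_mult algebra_simps power2_eq_square)
  then show ?thesis by (simp only: rt_12 rt_sum) simp
qed

end

subsection \<open>Linear operators in terms of the embeddings\<close>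

text \<open>Equality of tensors is tested only by rational-valued forms, while the coefficients of
  the action are complex; a separating functional passes from one to the other.\<close>

lemma rat_functional_separates:
  fixes s :: "rat \<Rightarrow> 'v::ab_group_add \<Rightarrow> 'v"
  assumes "vector_space s" and "z \<noteq> 0"
  obtains \<phi> :: "'v \<Rightarrow> rat" where "Vector_Spaces.linear s (*) \<phi>" "\<phi> z \<noteq> 0"
proof -
  interpret V: vector_space s by fact
  interpret Q: vector_space "(*) :: rat \<Rightarrow> rat \<Rightarrow> rat"
    by unfold_locales (simp_all add: algebra_simps)
  interpret vector_space_pair s "(*) :: rat \<Rightarrow> rat \<Rightarrow> rat" ..
  have "V.independent {z}" using \<open>z \<noteq> 0\<close> by simp
  from linear_independent_extend[OF this, of "\<lambda>_. 1"]
  obtain \<phi> where "Vector_Spaces.linear s (*) \<phi>" "\<phi> z = 1" by auto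
  then show ?thesis by (intro that) auto
qed

lemma linear_sum_list:
  assumes "Vector_Spaces.linear s t f"
  shows "f (\<Sum>x\<leftarrow>xs. g x) = (\<Sum>x\<leftarrow>xs. f (g x))"
proof -
  interpret Vector_Spaces.linear s t f by fact
  show ?thesis by (induction xs) (simp_all add: add zero)
qed

lemma sum_list_sum_swap:
  "(\<Sum>x\<leftarrow>xs. \<Sum>n\<in>A. f x n) = (\<Sum>n\<in>A. \<Sum>x\<leftarrow>xs. (f x n :: 'b::comm_monoid_add))"
  by (induction xs) (simp_all add: sum.distrib)

text \<open>Euler's identities for the sums of x^k / f'(x) over the roots, read off over the common
  Vandermonde denominator.\<close>

lemma lagrange_power_sums:
  fixes x y z :: "'a :: field"
  assumes "x \<noteq> y" "x \<noteq> z" "y \<noteq> z"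
  shows "1 / ((x - y) * (x - z)) + 1 / ((y - x) * (y - z)) + 1 / ((z - x) * (z - y)) = 0"
    and "x / ((x - y) * (x - z)) + y / ((y - x) * (y - z)) + z / ((z - x) * (z - y)) = 0"
    and "x\<^sup>2 / ((x - y) * (x - z)) + y\<^sup>2 / ((y - x) * (y - z)) + z\<^sup>2 / ((z - x) * (z - y)) = 1"
proof -
  have nz: "x - y \<noteq> 0" "x - z \<noteq> 0" "y - z \<noteq> 0" using assms by auto
  define D where "D = (x - y) * (x - z) * (y - z)"
  have "D \<noteq> 0" using nz by (simp add: D_def)
  have f: "u / ((x - y) * (x - z)) = u * (y - z) / D"
    "u / ((y - x) * (y - z)) = - u * (x - z) / D"
    "u / ((z - x) * (z - y)) = u * (x - y) / D" for u
    using nz assms by (simp_all add: D_def divide_simps) (simp_all add: algebra_simps)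
  show "1 / ((x - y) * (x - z)) + 1 / ((y - x) * (y - z)) + 1 / ((z - x) * (z - y)) = 0"
    "x / ((x - y) * (x - z)) + y / ((y - x) * (y - z)) + z / ((z - x) * (z - y)) = 0"
    "x\<^sup>2 / ((x - y) * (x - z)) + y\<^sup>2 / ((y - x) * (y - z)) + z\<^sup>2 / ((z - x) * (z - y)) = 1"
    unfolding f add_divide_distrib[symmetric] using \<open>D \<noteq> 0\<close>
    by (simp_all add: divide_simps) (simp_all add: D_def algebra_simps power2_eq_square)
qed

context cubic_field
begin

text \<open>Since f(X) / (X - x) = X^2 + x X + (x^2 - a) for a root x, the quotients of x^2 - a, x
  and 1 by f'(x) form the trace-dual basis of 1, x, x^2. Pairing it with the images of the powers of
  \<alpha> gives the coefficient of the n-th embedding in the m-th conjugate of E.\<close>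

definition coef :: "(complex \<Rightarrow> complex) \<Rightarrow> nat \<Rightarrow> nat \<Rightarrow> complex" where
  "coef E m n = (emb m (E (\<alpha>\<^sup>2)) + rt n * emb m (E \<alpha>) + ((rt n)\<^sup>2 - of_int a) * emb m (E 1))
     / (3 * (rt n)\<^sup>2 - of_int a)"

lemma deriv_rt:
  "3 * (rt 0)\<^sup>2 - of_int a = (rt 0 - rt 1) * (rt 0 - rt 2)"
  "3 * (rt 1)\<^sup>2 - of_int a = (rt 1 - rt 0) * (rt 1 - rt 2)"
  "3 * (rt 2)\<^sup>2 - of_int a = (rt 2 - rt 0) * (rt 2 - rt 1)"
proof -
  have a: "(of_int a :: complex) = (rt 0)\<^sup>2 + rt 0 * rt 1 + (rt 1)\<^sup>2"
    using rt_relation[of 0 1] by simp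
  have r2: "rt 2 = - rt 0 - rt 1"
    using rt_sum by (simp add: algebra_simps eq_neg_iff_add_eq_0)
  show "3 * (rt 0)\<^sup>2 - of_int a = (rt 0 - rt 1) * (rt 0 - rt 2)"
    "3 * (rt 1)\<^sup>2 - of_int a = (rt 1 - rt 0) * (rt 1 - rt 2)"
    "3 * (rt 2)\<^sup>2 - of_int a = (rt 2 - rt 0) * (rt 2 - rt 1)"
    unfolding a r2 by (simp_all add: algebra_simps power2_eq_square)
qed

lemma rt_power_sums:
  "(\<Sum>n<3. 1 / (3 * (rt n)\<^sup>2 - of_int a)) = 0"
  "(\<Sum>n<3. rt n / (3 * (rt n)\<^sup>2 - of_int a)) = 0"
  "(\<Sum>n<3. (rt n)\<^sup>2 / (3 * (rt n)\<^sup>2 - of_int a)) = 1"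
  "(\<Sum>n<3. (rt n) ^ 3 / (3 * (rt n)\<^sup>2 - of_int a)) = 0"
  "(\<Sum>n<3. (rt n) ^ 4 / (3 * (rt n)\<^sup>2 - of_int a)) = of_int a"
proof -
  have d: "rt 0 \<noteq> rt 1" "rt 0 \<noteq> rt 2" "rt 1 \<noteq> rt 2"
    using rt_distinct[of 0 1] rt_distinct[of 0 2] rt_distinct[of 1 2] by simp_all
  show 0: "(\<Sum>n<3. 1 / (3 * (rt n)\<^sup>2 - of_int a)) = 0"
    and 1: "(\<Sum>n<3. rt n / (3 * (rt n)\<^sup>2 - of_int a)) = 0"
    and 2: "(\<Sum>n<3. (rt n)\<^sup>2 / (3 * (rt n)\<^sup>2 - of_int a)) = 1"
    unfolding sum_less_3 deriv_rt using lagrange_power_sums[OF d] by simp_all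
  have c: "rt n ^ 3 = of_int a * rt n - of_int b" if "n < 3" for n
    using rt_root[OF that] by (simp add: algebra_simps eq_neg_iff_add_eq_0 add_eq_0_iff2)
  have "(\<Sum>n<3. (rt n) ^ 3 / (3 * (rt n)\<^sup>2 - of_int a)) =
      of_int a * (\<Sum>n<3. rt n / (3 * (rt n)\<^sup>2 - of_int a))
      - of_int b * (\<Sum>n<3. 1 / (3 * (rt n)\<^sup>2 - of_int a))"
    unfolding sum_distrib_left sum_subtractf[symmetric]
    by (rule sum.cong) (simp_all add: c diff_divide_distrib)
  then show "(\<Sum>n<3. (rt n) ^ 3 / (3 * (rt n)\<^sup>2 - of_int a)) = 0" by (simp only: 0 1) simp
  have c4: "rt n ^ 4 = of_int a * (rt n)\<^sup>2 - of_int b * rt n" if "n < 3" for n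
  proof -
    have "rt n ^ 4 = rt n * rt n ^ 3" by (simp add: eval_nat_numeral)
    also have "\<dots> = of_int a * (rt n)\<^sup>2 - of_int b * rt n"
      unfolding c[OF that] by (simp add: algebra_simps power2_eq_square)
    finally show ?thesis .
  qed
  have "(\<Sum>n<3. (rt n) ^ 4 / (3 * (rt n)\<^sup>2 - of_int a)) =
      of_int a * (\<Sum>n<3. (rt n)\<^sup>2 / (3 * (rt n)\<^sup>2 - of_int a))
      - of_int b * (\<Sum>n<3. rt n / (3 * (rt n)\<^sup>2 - of_int a))"
    unfolding sum_distrib_left sum_subtractf[symmetric]
    by (rule sum.cong) (simp_all add: c4 diff_divide_distrib)
  then show "(\<Sum>n<3. (rt n) ^ 4 / (3 * (rt n)\<^sup>2 - of_int a)) = of_int a" by (simp only: 1 2) simp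
qed

text \<open>A dual basis vector times a quadratic has degree at most four in the root, so the five
  sums in \<open>rt_power_sums\<close> suffice.\<close>

lemma lagrange_interpolation:
  "(\<Sum>n<3. (u\<^sub>2 + rt n * u\<^sub>1 + ((rt n)\<^sup>2 - of_int a) * u\<^sub>0) / (3 * (rt n)\<^sup>2 - of_int a)
      * quad r s t (rt n)) = of_rat r * u\<^sub>0 + of_rat s * u\<^sub>1 + of_rat t * u\<^sub>2"
proof -
  define x y z A where "x = (of_rat r :: complex)" "y = (of_rat s :: complex)"
    "z = (of_rat t :: complex)" "A = (of_int a :: complex)"
  define D where "D n = inverse (3 * (rt n)\<^sup>2 - A)" for n
  have "(\<Sum>n<3. (u\<^sub>2 + rt n * u\<^sub>1 + ((rt n)\<^sup>2 - of_int a) * u\<^sub>0) / (3 * (rt n)\<^sup>2 - of_int a)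
      * quad r s t (rt n)) =
    (\<Sum>n<3. (x * (u\<^sub>2 - A * u\<^sub>0)) * (1 * D n) + (y * (u\<^sub>2 - A * u\<^sub>0) + x * u\<^sub>1) * (rt n * D n)
      + (z * (u\<^sub>2 - A * u\<^sub>0) + y * u\<^sub>1 + x * u\<^sub>0) * ((rt n)\<^sup>2 * D n)
      + (z * u\<^sub>1 + y * u\<^sub>0) * (rt n ^ 3 * D n) + (z * u\<^sub>0) * (rt n ^ 4 * D n))"
    unfolding divide_inverse D_def[symmetric] quad_def x_y_z_A_def[symmetric]
    by (rule sum.cong[OF refl]) (simp add: algebra_simps power2_eq_square eval_nat_numeral)
  also have "\<dots> = (z * (u\<^sub>2 - A * u\<^sub>0) + y * u\<^sub>1 + x * u\<^sub>0) + (z * u\<^sub>0) * A"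
    unfolding sum.distrib sum_distrib_left[symmetric] D_def x_y_z_A_def(4) divide_inverse[symmetric] rt_power_sums
    by (simp add: x_y_z_A_def)
  finally show ?thesis by (simp add: x_y_z_A_def algebra_simps)
qed

lemma rat_linear_quad:
  assumes "rat_linear_on L qscale qscale E"
  shows "E (quad r s t \<alpha>) = of_rat r * E 1 + of_rat s * E \<alpha> + of_rat t * E (\<alpha>\<^sup>2)"
proof -
  have L: "1 \<in> L" "\<alpha> \<in> L" "\<alpha>\<^sup>2 \<in> L" using L_of_rat[of 1] emb_gen by simp_all
  have add: "E (x + y) = E x + E y" if "x \<in> L" "y \<in> L" for x y
    using assms that by (auto simp: rat_linear_on_def)
  have add3: "E (x + y + z) = E x + E y + E z" if "x \<in> L" "y \<in> L" "z \<in> L" for x y z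
    using that by (simp add: add L_add)
  have sc: "E (of_rat c * x) = of_rat c * E x" if "x \<in> L" for x c
    using assms that by (auto simp: rat_linear_on_def qscale_def)
  have scL: "of_rat c * x \<in> L" if "x \<in> L" for x c using that by (intro L_mult L_of_rat)
  have "E (quad r s t \<alpha>) = E (of_rat r * 1 + of_rat s * \<alpha> + of_rat t * \<alpha>\<^sup>2)"
    by (simp add: quad_def)
  also have "\<dots> = E (of_rat r * 1) + E (of_rat s * \<alpha>) + E (of_rat t * \<alpha>\<^sup>2)"
    by (rule add3) (simp_all add: scL L L_of_rat)
  also have "\<dots> = of_rat r * E 1 + of_rat s * E \<alpha> + of_rat t * E (\<alpha>\<^sup>2)"
    using L by (simp only: sc)
  finally show ?thesis .
qed

lemma emb_rat_linear:
  assumes "rat_linear_on L qscale qscale E" "E ` L \<subseteq> L" "m < 3" "y \<in> L"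
  shows "emb m (E y) = (\<Sum>n<3. coef E m n * emb n y)"
proof -
  obtain r s t where y: "y = quad r s t \<alpha>" using assms(4) by (rule L_cases)
  have L: "E 1 \<in> L" "E \<alpha> \<in> L" "E (\<alpha>\<^sup>2) \<in> L"
    using assms(2) L_of_rat[of 1] emb_gen by auto
  have sc: "of_rat c * x \<in> L" "emb m (of_rat c * x) = of_rat c * emb m x" if "x \<in> L" for x c
    using that \<open>m < 3\<close> by (simp_all add: L_mult L_of_rat emb_mult emb_of_rat)
  have "emb m (E y) = of_rat r * emb m (E 1) + of_rat s * emb m (E \<alpha>) + of_rat t * emb m (E (\<alpha>\<^sup>2))"
    using L unfolding y rat_linear_quad[OF assms(1)] by (simp add: emb_add L_add sc)
  also have "\<dots> = (\<Sum>n<3. coef E m n * emb n y)"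
    unfolding lagrange_interpolation[symmetric] by (simp add: coef_def y)
  finally show ?thesis .
qed

text \<open>The combination formed below evaluates f(X) / (X - \<open>rt n\<close>), which vanishes
  at the other two roots and equals f' at the n-th, so it isolates \<open>d n\<close>.\<close>

lemma rt_powers_independent:
  assumes "(\<Sum>n<3. d n) = 0" "(\<Sum>n<3. d n * rt n) = 0" "(\<Sum>n<3. d n * (rt n)\<^sup>2) = 0" "n < 3"
  shows "d n = 0"
proof -
  have "0 = (\<Sum>k<3. d k * (rt k)\<^sup>2) + rt n * (\<Sum>k<3. d k * rt k)
      + ((rt n)\<^sup>2 - of_int a) * (\<Sum>k<3. d k)"
    by (simp only: assms) simp
  also have "\<dots> = (\<Sum>k<3. d k * ((rt n)\<^sup>2 + rt n * rt k + (rt k)\<^sup>2 - of_int a))"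
    unfolding sum_distrib_left sum.distrib[symmetric]
    by (rule sum.cong) (simp_all add: algebra_simps)
  also have "\<dots> = (\<Sum>k<3. if k = n then d n * (3 * (rt n)\<^sup>2 - of_int a) else 0)"
  proof (rule sum.cong[OF refl])
    fix k :: nat assume "k \<in> {..<3}"
    then show "d k * ((rt n)\<^sup>2 + rt n * rt k + (rt k)\<^sup>2 - of_int a) =
        (if k = n then d n * (3 * (rt n)\<^sup>2 - of_int a) else 0)"
      using rt_relation[of n k] \<open>n < 3\<close> by (auto simp: power2_eq_square)
  qed
  also have "\<dots> = d n * (3 * (rt n)\<^sup>2 - of_int a)" using \<open>n < 3\<close> by simp
  finally show ?thesis using deriv_rt_nonzero[OF \<open>n < 3\<close>] by simp
qed

lemma emb_independent:
  assumes "\<And>y. y \<in> L \<Longrightarrow> (\<Sum>n<3. d n * emb n y) = 0" "n < 3"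
  shows "d n = 0"
proof (rule rt_powers_independent[OF _ _ _ \<open>n < 3\<close>])
  show "(\<Sum>n<3. d n) = 0" using assms(1)[of 1] L_of_rat[of 1] emb_of_rat[of _ 1] by simp
  show "(\<Sum>n<3. d n * rt n) = 0" using assms(1)[of \<alpha>] by (simp add: emb_gen)
  show "(\<Sum>n<3. d n * (rt n)\<^sup>2) = 0" using assms(1)[of "\<alpha>\<^sup>2"] by (simp add: emb_gen)
qed

lemma emb_independent2:
  assumes "\<And>x y. x \<in> L \<Longrightarrow> y \<in> L \<Longrightarrow> (\<Sum>n<3. \<Sum>k<3. d n k * emb n x * emb k y) = 0" "n < 3" "k < 3"
  shows "d n k = 0"
proof (rule emb_independent[where d = "d n", OF _ \<open>k < 3\<close>])
  fix y assume y: "y \<in> L"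
  show "(\<Sum>k<3. d n k * emb k y) = 0"
  proof (rule emb_independent[where d = "\<lambda>n. \<Sum>k<3. d n k * emb k y", OF _ \<open>n < 3\<close>])
    fix x assume x: "x \<in> L"
    show "(\<Sum>n<3. (\<Sum>k<3. d n k * emb k y) * emb n x) = 0"
      using assms(1)[OF x y] by (simp add: sum_distrib_left sum_distrib_right mult_ac)
  qed
qed

definition crd :: "nat \<Rightarrow> complex \<Rightarrow> rat" where
  "crd i x = (THE q. \<exists>r s t. x = quad r s t \<alpha> \<and> q = (if i = 0 then r else if i = 1 then s else t))"

lemma crd_quad [simp]:
  "crd i (quad r s t \<alpha>) = (if i = 0 then r else if i = 1 then s else t)"
  unfolding crd_def by (rule the_equality) (auto simp: quad_inject)

lemma crd_add: "x \<in> L \<Longrightarrow> y \<in> L \<Longrightarrow> crd i (x + y) = crd i x + crd i y"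
  by (elim L_cases) (simp add: quad_add)

lemma crd_scale: "x \<in> L \<Longrightarrow> crd i (of_rat c * x) = c * crd i x"
  by (elim L_cases) (simp add: quad_scale)

lemma crd_sum_list:
  "(\<And>x. x \<in> set xs \<Longrightarrow> f x \<in> L) \<Longrightarrow> crd i (\<Sum>x\<leftarrow>xs. f x) = (\<Sum>x\<leftarrow>xs. crd i (f x))"
  using crd_quad[of i 0 0 0] by (induction xs) (auto simp: crd_add L_sum_list quad_def)

end

subsection \<open>The action of the Hopf algebra\<close>

locale hopf_galois_cubic = cubic_field a b \<alpha> +
  hopf_galois_structure scale comult counit antipode act "rat_adjoin \<alpha>"
  for a b :: int and \<alpha> :: complex
    and scale :: "rat \<Rightarrow> 'h::ring_1 \<Rightarrow> 'h"
    and comult :: "'h \<Rightarrow> ('h \<times> 'h) list"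
    and counit :: "'h \<Rightarrow> rat"
    and antipode :: "'h \<Rightarrow> 'h"
    and act :: "'h \<Rightarrow> complex \<Rightarrow> complex"
begin

definition act_coef :: "nat \<Rightarrow> nat \<Rightarrow> 'h \<Rightarrow> complex" where
  "act_coef m n h = coef (act h) m n"

lemma act_image: "act h ` L \<subseteq> L"
  using act_closed by auto

lemma emb_act:
  "m < 3 \<Longrightarrow> y \<in> L \<Longrightarrow> emb m (act h y) = (\<Sum>n<3. act_coef m n h * emb n y)"
  unfolding act_coef_def by (rule emb_rat_linear[OF act_linear_right act_image])

lemma L_gen: "1 \<in> L" "\<alpha> \<in> L" "\<alpha>\<^sup>2 \<in> L"
  using L_of_rat[of 1] emb_gen by simp_all

lemma act_add: "x \<in> L \<Longrightarrow> act (h + k) x = act h x + act k x"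
  using act_linear_left[of x] by (simp add: rat_linear_on_def)

lemma act_scale: "x \<in> L \<Longrightarrow> act (scale c h) x = of_rat c * act h x"
  using act_linear_left[of x] by (simp add: rat_linear_on_def qscale_def)

lemma act_zero: "x \<in> L \<Longrightarrow> act 0 x = 0"
  using act_add[of x 0 0] by simp

lemma act_sum_list: "x \<in> L \<Longrightarrow> act (\<Sum>h\<leftarrow>hs. f h) x = (\<Sum>h\<leftarrow>hs. act (f h) x)"
  by (induction hs) (simp_all add: act_add act_zero)

lemma act_coef_add: "m < 3 \<Longrightarrow> act_coef m n (h + k) = act_coef m n h + act_coef m n k"
  by (simp add: act_coef_def coef_def act_add L_gen emb_add act_closed add_divide_distrib
      diff_divide_distrib algebra_simps)

lemma act_coef_scale: "m < 3 \<Longrightarrow> act_coef m n (scale c h) = of_rat c * act_coef m n h"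
  by (simp add: act_coef_def coef_def act_scale L_gen emb_mult L_of_rat emb_of_rat act_closed
      algebra_simps add_divide_distrib diff_divide_distrib)

text \<open>Coefficients of the conjugates of x and y are compared in the axiom for the action on a
  product. In the dual algebra, whose multiplication is the coproduct, the result says that the
  coefficients with fixed m are orthogonal idempotents.\<close>

lemma act_coef_comult:
  assumes "m < 3" "n < 3" "k < 3"
  shows "(\<Sum>(h1, h2)\<leftarrow>comult h. act_coef m n h1 * act_coef m k h2)
    = (if n = k then act_coef m n h else 0)"
proof -
  define S where "S n k = (\<Sum>(h1, h2)\<leftarrow>comult h. act_coef m n h1 * act_coef m k h2)" for n k
  define d where "d n k = S n k - (if n = k then act_coef m n h else 0)" for n k
  have "(\<Sum>n<3. \<Sum>k<3. d n k * emb n x * emb k y) = 0" if xy: "x \<in> L" "y \<in> L" for x y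
  proof -
    have "(\<Sum>n<3. act_coef m n h * (emb n x * emb n y)) = emb m (act h (x * y))"
      using xy \<open>m < 3\<close> by (simp add: emb_act L_mult emb_mult)
    also have "\<dots> = (\<Sum>(h1, h2)\<leftarrow>comult h. emb m (act h1 x * act h2 y))"
      unfolding act_on_mult[OF xy] using xy
      by (subst emb_sum_list) (auto intro!: L_mult act_closed simp: split_def)
    also have "\<dots> = (\<Sum>(h1, h2)\<leftarrow>comult h.
        \<Sum>n<3. \<Sum>k<3. act_coef m n h1 * act_coef m k h2 * (emb n x * emb k y))"
      using xy \<open>m < 3\<close>
      by (simp add: emb_mult act_closed emb_act sum_product mult_ac)
    also have "\<dots> = (\<Sum>n<3. \<Sum>k<3. S n k * (emb n x * emb k y))"
      by (simp add: S_def split_def sum_list_sum_swap sum_list_mult_const)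
    finally have *: "(\<Sum>n<3. \<Sum>k<3. S n k * (emb n x * emb k y)) =
        (\<Sum>n<3. act_coef m n h * (emb n x * emb n y))" by simp
    have "(\<Sum>n<3. \<Sum>k<3. d n k * emb n x * emb k y) =
        (\<Sum>n<3. \<Sum>k<3. S n k * (emb n x * emb k y))
        - (\<Sum>n<3. \<Sum>k<3. if n = k then act_coef m n h * (emb n x * emb n y) else 0)"
      unfolding sum_subtractf[symmetric] d_def by (intro sum.cong) (auto simp: algebra_simps)
    then show ?thesis using * by simp
  qed
  from emb_independent2[OF this assms(2,3)] show ?thesis by (simp add: d_def S_def)
qed

lemma act_coef_counit: "m < 3 \<Longrightarrow> (\<Sum>n<3. act_coef m n h) = of_rat (counit h)"
  using emb_act[of m 1 h] act_on_one[of h] emb_of_rat[of _ 1] emb_of_rat[of m "counit h"] L_gen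
  by (simp add: qscale_def)

lemma act_coef_one:
  assumes "m < 3" "n < 3"
  shows "act_coef m n 1 = (if m = n then 1 else 0)"
proof -
  have "act_coef m n 1 - (if m = n then 1 else 0) = 0"
  proof (rule emb_independent[OF _ \<open>n < 3\<close>])
    fix y assume "y \<in> L"
    then have "(\<Sum>n<3. act_coef m n 1 * emb n y) = emb m y"
      using emb_act[OF \<open>m < 3\<close>, of y 1] by (simp add: act_one)
    moreover have "(\<Sum>n<3. (if m = n then 1 else 0) * emb n y) = emb m y"
      using \<open>m < 3\<close> by (simp add: if_distrib[of "\<lambda>c. c * _"] cong: if_cong)
    ultimately show "(\<Sum>n<3. (act_coef m n 1 - (if m = n then 1 else 0)) * emb n y) = 0"
      by (simp add: left_diff_distrib sum_subtractf)
  qed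
  then show ?thesis by (auto split: if_splits)
qed

text \<open>Rational-valued endomorphisms are chosen because every embedding fixes their values: the
  identity for the preimage tensor keeps its right-hand side under each
  \<open>emb m\<close>.\<close>

lemma endomorphism_from_coordinates:
  fixes w :: "nat \<Rightarrow> rat"
  obtains us where "fst ` set us \<subseteq> L"
    "\<And>y. y \<in> L \<Longrightarrow> (\<Sum>(x, h)\<leftarrow>us. x * act h y) = of_rat (\<Sum>i<3. w i * crd i y)"
proof -
  define E :: "complex \<Rightarrow> complex" where "E y = of_rat (\<Sum>i<3. w i * crd i y)" for y
  have "(\<Sum>i<3. w i * crd i (x + y)) = (\<Sum>i<3. w i * crd i x) + (\<Sum>i<3. w i * crd i y)"
    if "x \<in> L" "y \<in> L" for x y
    using that by (simp add: crd_add distrib_left sum.distrib)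
  moreover have "(\<Sum>i<3. w i * crd i (of_rat c * x)) = c * (\<Sum>i<3. w i * crd i x)" if "x \<in> L" for c x
    using that by (simp add: crd_scale sum_distrib_left mult.left_commute)
  ultimately have "rat_linear_on L qscale qscale E"
    by (simp add: rat_linear_on_def qscale_def E_def of_rat_add of_rat_mult del: of_rat_sum)
  moreover have "E ` L \<subseteq> L" by (auto simp: E_def L_of_rat)
  ultimately obtain us where "fst ` set us \<subseteq> L" "\<forall>y\<in>L. (\<Sum>(x, h)\<leftarrow>us. x * act h y) = E y"
    using galois_surj by blast
  then show ?thesis by (intro that[of us]) (auto simp: E_def)
qed

text \<open>A relation holding for all h persists for combinations with coefficients in L, and by
  surjectivity these realise every coordinate functional. The three resulting relations are those of
  \<open>rt_powers_independent\<close>.\<close>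

lemma act_coef_independent:
  assumes "m < 3" "\<And>h. (\<Sum>n<3. d n * act_coef m n h) = 0" "n < 3"
  shows "d n = 0"
proof -
  define D where "D n = 3 * (rt n)\<^sup>2 - of_int a" for n
  have key: "(\<Sum>n<3. d n * ((of_rat (w 2) + rt n * of_rat (w 1) + ((rt n)\<^sup>2 - of_int a) * of_rat (w 0)) / D n)) = 0"
    for w :: "nat \<Rightarrow> rat"
  proof -
    obtain us where us: "fst ` set us \<subseteq> L"
      "\<And>y. y \<in> L \<Longrightarrow> (\<Sum>(x, h)\<leftarrow>us. x * act h y) = of_rat (\<Sum>i<3. w i * crd i y)"
      using endomorphism_from_coordinates[of w] by blast
    have emb_us: "(\<Sum>(x, h)\<leftarrow>us. emb m x * emb m (act h y)) = of_rat (\<Sum>i<3. w i * crd i y)"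
      if "y \<in> L" for y
    proof -
      have "(\<Sum>(x, h)\<leftarrow>us. emb m x * emb m (act h y)) = (\<Sum>(x, h)\<leftarrow>us. emb m (x * act h y))"
        using us(1) that \<open>m < 3\<close>
        by (intro arg_cong[of _ _ sum_list] map_cong refl) (auto simp: emb_mult act_closed)
      also have "\<dots> = emb m (\<Sum>(x, h)\<leftarrow>us. x * act h y)"
        using us(1) that by (subst emb_sum_list) (auto simp: split_def intro!: L_mult act_closed)
      finally show ?thesis using us(2)[OF that] emb_of_rat by simp
    qed
    have c: "crd i 1 = (if i = 0 then 1 else 0)" "crd i \<alpha> = (if i = 1 then 1 else 0)"
      "crd i (\<alpha>\<^sup>2) = (if i = 0 \<or> i = 1 then 0 else 1)" for i
      using crd_quad[of i 1 0 0] crd_quad[of i 0 1 0] crd_quad[of i 0 0 1] by (auto simp: quad_def)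
    have "(\<Sum>(x, h)\<leftarrow>us. emb m x * act_coef m n h) =
      ((\<Sum>(x, h)\<leftarrow>us. emb m x * emb m (act h (\<alpha>\<^sup>2))) + rt n * (\<Sum>(x, h)\<leftarrow>us. emb m x * emb m (act h \<alpha>))
        + ((rt n)\<^sup>2 - of_int a) * (\<Sum>(x, h)\<leftarrow>us. emb m x * emb m (act h 1))) / D n" for n
      unfolding act_coef_def coef_def D_def[symmetric]
      by (induction us) (auto simp: algebra_simps add_divide_distrib diff_divide_distrib)
    also have "\<dots> n = (of_rat (w 2) + rt n * of_rat (w 1) + ((rt n)\<^sup>2 - of_int a) * of_rat (w 0)) / D n" for n
      unfolding emb_us[OF L_gen(1)] emb_us[OF L_gen(2)] emb_us[OF L_gen(3)]
      by (simp add: c sum_less_3)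
    finally have eq: "(\<Sum>(x, h)\<leftarrow>us. emb m x * act_coef m n h) =
       (of_rat (w 2) + rt n * of_rat (w 1) + ((rt n)\<^sup>2 - of_int a) * of_rat (w 0)) / D n" for n .
    have "(\<Sum>n<3. d n * (\<Sum>(x, h)\<leftarrow>us. emb m x * act_coef m n h)) =
      (\<Sum>(x, h)\<leftarrow>us. emb m x * (\<Sum>n<3. d n * act_coef m n h))"
      by (induction us) (auto simp: algebra_simps sum.distrib sum_distrib_left)
    then show ?thesis unfolding eq assms(2) by (simp add: split_def)
  qed
  have 0: "(\<Sum>n<3. d n / D n) = 0" using key[of "\<lambda>i. if i = 2 then 1 else 0"] by simp
  have 1: "(\<Sum>n<3. d n / D n * rt n) = 0" using key[of "\<lambda>i. if i = 1 then 1 else 0"] by simp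
  have "(\<Sum>n<3. d n / D n * (rt n)\<^sup>2) = (\<Sum>n<3. d n * (((rt n)\<^sup>2 - of_int a) / D n))
      + of_int a * (\<Sum>n<3. d n / D n)"
    unfolding sum_distrib_left sum.distrib[symmetric]
    by (rule sum.cong) (simp_all add: algebra_simps diff_divide_distrib)
  also have "\<dots> = 0" using key[of "\<lambda>i. if i = 0 then 1 else 0"] 0 by simp
  finally have "d n / D n = 0" using rt_powers_independent[OF 0 1 _ \<open>n < 3\<close>] by simp
  then show ?thesis using deriv_rt_nonzero[OF \<open>n < 3\<close>] by (simp add: D_def)
qed

text \<open>Injectivity of the Galois map, carried over to complex functionals: were the sum
  nonzero, composing with a rational functional would give a bilinear form that distinguishes
  \<open>us\<close> from the empty tensor.\<close>

lemma tensor_zero_eval: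
  assumes us: "fst ` set us \<subseteq> L" "\<And>y. y \<in> L \<Longrightarrow> (\<Sum>(x, h)\<leftarrow>us. x * act h y) = 0"
    and add: "\<And>h k. \<psi> (h + k) = \<psi> h + \<psi> k" and scale: "\<And>c h. \<psi> (scale c h) = of_rat c * \<psi> h"
  shows "(\<Sum>(x, h)\<leftarrow>us. x * \<psi> h) = 0"
proof (rule ccontr)
  assume "(\<Sum>(x, h)\<leftarrow>us. x * \<psi> h) \<noteq> 0"
  then obtain \<phi> where \<phi>: "Vector_Spaces.linear qscale (*) \<phi>" "\<phi> (\<Sum>(x, h)\<leftarrow>us. x * \<psi> h) \<noteq> 0"
    using rat_functional_separates[OF ratvs.vector_space_axioms] by blast
  interpret \<phi>: Vector_Spaces.linear qscale "(*)" \<phi> by fact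
  have \<phi>_scale: "\<phi> (of_rat c * z) = c * \<phi> z" for c z using \<phi>.scale by (simp add: qscale_def)
  have \<phi>_scale': "\<phi> (x * (of_rat c * z)) = c * \<phi> (x * z)" for c x z
    using \<phi>_scale[of c "x * z"] by (simp add: mult.left_commute)
  have "tensor_eq L qscale UNIV scale us []"
    using us by (intro galois_inj) auto
  moreover have "rat_linear_on L qscale (*) (\<lambda>x. \<phi> (x * \<psi> h))" for h
    by (simp add: rat_linear_on_def qscale_def distrib_right \<phi>.add \<phi>_scale mult.assoc)
  moreover have "rat_linear_on UNIV scale (*) (\<lambda>h. \<phi> (x * \<psi> h))" for x
    by (simp add: rat_linear_on_def add scale distrib_left \<phi>.add \<phi>_scale')
  ultimately have "(\<Sum>(x, h)\<leftarrow>us. \<phi> (x * \<psi> h)) = 0"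
    unfolding tensor_eq_def by (auto dest!: spec[where x = "\<lambda>x h. \<phi> (x * \<psi> h)"])
  then show False using \<phi>(2) linear_sum_list[OF \<phi>(1), of "\<lambda>(x, h). x * \<psi> h" us]
    by (simp add: split_def)
qed

text \<open>An operator is recovered from its values on 1, \<alpha>, \<alpha>^2 and the three
  coordinate functionals, which come from tensors \<open>us i\<close>. By injectivity this expansion
  of 1 \<otimes> h holds in the tensor product, and applying the functional turns it into a
  combination of the \<open>act_coef 0 j\<close>.\<close>

lemma functional_in_act_coef_span:
  assumes add: "\<And>h k. \<psi> (h + k) = \<psi> h + \<psi> k" and scale: "\<And>c h. \<psi> (scale c h) = of_rat c * \<psi> h"
  obtains c where "\<And>h. \<psi> h = (\<Sum>j<3. c j * act_coef 0 j h)"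
proof -
  have "\<exists>us. fst ` set us \<subseteq> L \<and> (\<forall>y\<in>L. (\<Sum>(x, h)\<leftarrow>us. x * act h y) = of_rat (crd i y))" if "i < 3" for i :: nat
  proof -
    have "(\<Sum>j<3. (if j = i then 1 else 0) * crd j y) = crd i y" for y
      using that by (simp add: if_distrib[of "\<lambda>c. c * _"] cong: if_cong)
    then show ?thesis
      using endomorphism_from_coordinates[of "\<lambda>j. if j = i then 1 else 0"] by metis
  qed
  then obtain us where us: "\<And>i::nat. i < 3 \<Longrightarrow> fst ` set (us i) \<subseteq> L"
    "\<And>i y. i < 3 \<Longrightarrow> y \<in> L \<Longrightarrow> (\<Sum>(x, h)\<leftarrow>us i. x * act h y) = of_rat (crd i y)"
    by metis
  define W where "W i = (\<Sum>(x, h)\<leftarrow>us i. x * \<psi> h)" for i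
  define c where "c j = W 0 + rt j * W 1 + (rt j)\<^sup>2 * W 2" for j
  have "\<psi> h = (\<Sum>j<3. c j * act_coef 0 j h)" for h
  proof -
    define m where "m z = map (\<lambda>(x, k). (z * x :: complex, k :: 'h))" for z
    \<comment> \<open>The expansion of the operator of h in coordinate functionals, minus 1
      \<otimes> h; it acts as zero on L.\<close>
    define vs where "vs = (- 1, h) # m (act h 1) (us 0) @ m (act h \<alpha>) (us 1) @ m (act h (\<alpha>\<^sup>2)) (us 2)"
    have m_sum: "(\<Sum>(x, k)\<leftarrow>m z xs. x * f k) = z * (\<Sum>(x, k)\<leftarrow>xs. x * f k)" for z xs and f :: "'h \<Rightarrow> complex"
      by (induction xs) (auto simp: m_def algebra_simps)
    have m_in: "fst ` set (m z xs) \<subseteq> L" if "z \<in> L" "fst ` set xs \<subseteq> L" for z xs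
      using that by (force simp: m_def intro: L_mult)
    have "(\<Sum>(x, k)\<leftarrow>vs. x * \<psi> k) = 0"
    proof (rule tensor_zero_eval[OF _ _ add scale])
      have "- 1 \<in> L" using L_of_rat[of "- 1"] by simp
      then show "fst ` set vs \<subseteq> L"
        using m_in[OF act_closed[OF L_gen(1)] us(1)] m_in[OF act_closed[OF L_gen(2)] us(1)]
          m_in[OF act_closed[OF L_gen(3)] us(1)] by (auto simp: vs_def image_Un)
    next
      fix y assume y: "y \<in> L"
      then obtain r s t where q: "y = quad r s t \<alpha>" by (rule L_cases)
      show "(\<Sum>(x, k)\<leftarrow>vs. x * act k y) = 0"
        unfolding vs_def using us(2)[OF _ y] rat_linear_quad[OF act_linear_right, of h r s t]
        by (simp add: m_sum q)
    qed
    then have "act h 1 * W 0 + act h \<alpha> * W 1 + act h (\<alpha>\<^sup>2) * W 2 = \<psi> h"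
      by (simp add: vs_def m_sum W_def add.assoc)
    then have "\<psi> h = act h 1 * W 0 + act h \<alpha> * W 1 + act h (\<alpha>\<^sup>2) * W 2" by simp
    also have "\<dots> = (\<Sum>j<3. c j * act_coef 0 j h)"
    proof -
      have "act h y = (\<Sum>j<3. act_coef 0 j h * emb j y)" if "y \<in> L" for y
        using emb_act[of 0 y h] that by (simp add: emb_0 act_closed)
      from this[OF L_gen(1)] this[OF L_gen(2)] this[OF L_gen(3)] show ?thesis
        using emb_of_rat[of _ 1]
        by (simp add: emb_gen c_def sum_distrib_left sum.distrib algebra_simps)
    qed
    finally show ?thesis .
  qed
  then show ?thesis by (rule that)
qed

text \<open>Over \<open>\<complex>\<close> the functionals \<open>act_coef m n\<close> for fixed \<open>m\<close> are the three primitive idempotents of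
  the dual of the Hopf algebra, whence they agree for different \<open>m\<close> up to a permutation, and
  evaluation at 1 fixes the diagonal ones.\<close>

lemma act_coef_permutation:
  assumes m: "m < 3" and nk: "n < 3" "k < 3" "n \<noteq> m" "k \<noteq> m" "n \<noteq> k"
  shows "act_coef m m h = act_coef 0 0 h"
    and "(act_coef m n h - act_coef m k h)\<^sup>2 = (act_coef 0 1 h - act_coef 0 2 h)\<^sup>2"
proof -
  have "\<exists>c. \<forall>h. act_coef m n h = (\<Sum>j<3. c j * act_coef 0 j h)" for n
    by (rule functional_in_act_coef_span[of "act_coef m n"])
       (use m act_coef_add act_coef_scale in auto)
  then obtain c where c: "\<And>n h. act_coef m n h = (\<Sum>j<3. c n j * act_coef 0 j h)" by metis
  \<comment> \<open>Both families are orthogonal idempotents for the same coproduct, so comparing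
    coefficients in the independent \<open>act_coef 0 j\<close> gives this for each column of
    c.\<close>
  have idem: "c n j * c k j = (if n = k then c n j else 0)" if "n < 3" "k < 3" "j < 3" for n k j
  proof -
    have "c n j * c k j - (if n = k then c n j else 0) = 0"
    proof (rule act_coef_independent[of 0, OF _ _ \<open>j < 3\<close>])
      fix h
      have "(if n = k then act_coef m n h else 0) =
          (\<Sum>(h1, h2)\<leftarrow>comult h. act_coef m n h1 * act_coef m k h2)"
        using act_coef_comult[OF m, of n k h] that by simp
      also have "\<dots> = (\<Sum>(h1, h2)\<leftarrow>comult h.
          \<Sum>i<3. \<Sum>j<3. c n i * c k j * (act_coef 0 i h1 * act_coef 0 j h2))"
        unfolding c sum_product by (simp add: mult.assoc mult.left_commute)
      also have "\<dots> = (\<Sum>i<3. \<Sum>j<3. c n i * c k j * (\<Sum>(h1, h2)\<leftarrow>comult h. act_coef 0 i h1 * act_coef 0 j h2))"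
        by (simp add: split_def sum_list_sum_swap sum_list_const_mult)
      also have "\<dots> = (\<Sum>i<3. \<Sum>j<3. if i = j then c n i * c k i * act_coef 0 i h else 0)"
        by (intro sum.cong refl) (auto simp: act_coef_comult)
      also have "\<dots> = (\<Sum>j<3. c n j * c k j * act_coef 0 j h)" by simp
      finally show "(\<Sum>j<3. (c n j * c k j - (if n = k then c n j else 0)) * act_coef 0 j h) = 0"
        by (cases "n = k") (simp_all add: left_diff_distrib sum_subtractf c)
    qed simp
    then show ?thesis by simp
  qed
  have total: "(\<Sum>n<3. c n j) = 1" if "j < 3" for j
  proof -
    have "(\<Sum>n<3. c n j) - 1 = 0"
    proof (rule act_coef_independent[of 0, OF _ _ \<open>j < 3\<close>])
      fix h
      have "(\<Sum>j<3. (\<Sum>n<3. c n j) * act_coef 0 j h) = (\<Sum>n<3. act_coef m n h)"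
        unfolding c sum_distrib_right by (rule sum.swap)
      also have "\<dots> = (\<Sum>j<3. act_coef 0 j h)" using m by (simp add: act_coef_counit)
      finally show "(\<Sum>j<3. ((\<Sum>n<3. c n j) - 1) * act_coef 0 j h) = 0"
        by (simp add: left_diff_distrib sum_subtractf)
    qed simp
    then show ?thesis by simp
  qed
  \<comment> \<open>At h = 1 only the term j = 0 survives in the expansion, so the first column of c
    is read off.\<close>
  have c0: "c n 0 = (if m = n then 1 else 0)" if "n < 3" for n
    using c[of n 1] act_coef_one[OF m that] by (simp add: act_coef_one sum_less_3)
  have nz: "c n 0 \<noteq> 0 \<or> c n 1 \<noteq> 0 \<or> c n 2 \<noteq> 0" if "n < 3" for n
  proof (rule ccontr)
    assume "\<not> ?thesis"
    then have "act_coef m n h = 0" for h by (simp add: c sum_less_3)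
    then have "(\<Sum>k<3. (if k = n then 1 else 0) * act_coef m k h) = 0" for h
      using that by (simp add: if_distrib[of "\<lambda>c. c * _"] cong: if_cong)
    from act_coef_independent[OF m this that] show False by simp
  qed
  have sq: "c n j = 0 \<or> c n j = 1" if "n < 3" "j < 3" for n j
    using idem[of n n j] that by auto
  have orth: "c n j = 0 \<or> c k j = 0" if "n < 3" "k < 3" "j < 3" "n \<noteq> k" for n k j
    using idem[of n k j] that by auto
  have n0: "c n 0 = 0" "c k 0 = 0" "c m 0 = 1" using c0 nk m by auto
  \<comment> \<open>Entries are 0 or 1, no row vanishes and no column has two ones; rows n and k
    avoid column 0, so they occupy columns 1 and 2 in one of the two orders.\<close>
  have cases: "c n 1 = 1 \<and> c n 2 = 0 \<and> c k 1 = 0 \<and> c k 2 = 1 \<or> c n 1 = 0 \<and> c n 2 = 1 \<and> c k 1 = 1 \<and> c k 2 = 0"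
    using nz[of n] nz[of k] n0 sq[of n 1] sq[of n 2] sq[of k 1] sq[of k 2]
      orth[of n k 1] orth[of n k 2] nk by auto
  then have "c m 1 = 0" "c m 2 = 0"
    using orth[of m n 1] orth[of m k 1] orth[of m n 2] orth[of m k 2] nk m by auto
  then show "act_coef m m h = act_coef 0 0 h" by (simp add: c[of m h] sum_less_3 n0)
  show "(act_coef m n h - act_coef m k h)\<^sup>2 = (act_coef 0 1 h - act_coef 0 2 h)\<^sup>2"
    unfolding c[of n h] c[of k h] sum_less_3 using cases n0 by (auto simp: power2_commute)
qed

end

section \<open>The three-parameter family of operators, and its identification with the Hopf
  algebra\<close>

context cubic_field
begin

text \<open>With \<open>\<delta> = (\<alpha>\<^sub>0 - \<alpha>\<^sub>1) (\<alpha>\<^sub>1 - \<alpha>\<^sub>2) (\<alpha>\<^sub>2 - \<alpha>\<^sub>0)\<close> a square root of the discriminant, \<open>hop k l m\<close> is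
  \<open>k + l (1 + \<sigma> + \<sigma>\<^sup>2) + m \<delta> (\<sigma> - \<sigma>\<^sup>2)\<close>, and \<open>skew\<close> is \<open>\<delta> (\<sigma>(\<alpha>) - \<sigma>\<^sup>2(\<alpha>))\<close>.\<close>

definition skew :: complex where
  "skew = quad (4 * of_int a ^ 2) (- 9 * of_int b) (- 6 * of_int a) \<alpha>"

definition hop :: "rat \<Rightarrow> rat \<Rightarrow> rat \<Rightarrow> complex \<Rightarrow> complex" where
  "hop k l m x = of_rat k * x + of_rat (l * tr (crd 0 x) (crd 2 x))
     + of_rat m * (of_rat (crd 1 x) * skew - of_rat (crd 2 x) * \<alpha> * skew)"

text \<open>For roots x, y, z the product of \<delta> and y - z is (x - y)(z - x)(y - z)^2; here (x
  - y)(z - x) = -f'(x) and (y - z)^2 = 4a - 3x^2.\<close>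

lemma emb_skew: "n < 3 \<Longrightarrow> emb n skew = - (3 * (rt n)\<^sup>2 - of_int a) * (4 * of_int a - 3 * (rt n)\<^sup>2)"
proof -
  assume "n < 3"
  have "emb n skew = - (3 * (rt n)\<^sup>2 - of_int a) * (4 * of_int a - 3 * (rt n)\<^sup>2)
      - 9 * rt n * (rt n ^ 3 - of_int a * rt n + of_int b)"
    unfolding skew_def emb_quad
    by (simp add: quad_def of_rat_mult of_rat_power of_rat_minus algebra_simps
        power2_eq_square power3_eq_cube)
  then show ?thesis by (simp add: rt_root[OF \<open>n < 3\<close>])
qed

lemma rt_diff_square:
  assumes "m < 3" "n < 3" "k < 3" "n \<noteq> m" "k \<noteq> m" "n \<noteq> k"
  shows "(rt n - rt k)\<^sup>2 = 4 * of_int a - 3 * (rt m)\<^sup>2" "rt n + rt k = - rt m"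
proof -
  have "rt m + rt n + rt k = 0"
    using assms rt_sum by (elim less_3_cases) (simp_all add: ac_simps)
  then show s: "rt n + rt k = - rt m" by (simp add: eq_neg_iff_add_eq_0 ac_simps)
  then have k: "rt k = - rt m - rt n" by (simp add: algebra_simps eq_neg_iff_add_eq_0)
  have a: "(of_int a :: complex) = (rt n)\<^sup>2 + rt n * rt m + (rt m)\<^sup>2" using rt_relation[of n m] assms by simp
  show "(rt n - rt k)\<^sup>2 = 4 * of_int a - 3 * (rt m)\<^sup>2"
    unfolding k a by (simp add: algebra_simps power2_eq_square)
qed

lemma diff_factor_nonzero: "m < 3 \<Longrightarrow> 4 * of_int a - 3 * (rt m)\<^sup>2 \<noteq> 0"
proof -
  assume m: "m < 3"
  then obtain n k where nk: "n < 3" "k < 3" "n \<noteq> m" "k \<noteq> m" "n \<noteq> k" by (rule third_index)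
  show ?thesis using rt_diff_square(1)[OF m nk] rt_distinct[OF nk(1,2,5)] by auto
qed

lemma skew_nonzero: "skew \<noteq> 0"
  using emb_skew[of 0] deriv_rt_nonzero[of 0] diff_factor_nonzero[of 0] emb_of_rat[of 0 0] by auto

lemma skew_in_L: "skew \<in> L"
  by (simp add: skew_def)

lemma inverse_in_L: "x \<in> L \<Longrightarrow> inverse x \<in> L"
  by (auto simp: rat_adjoin_def is_subfield_def)

lemma emb_inverse:
  assumes "x \<in> L" "n < 3"
  shows "emb n (inverse x) = inverse (emb n x)"
proof (cases "x = 0")
  case True
  then show ?thesis using emb_of_rat[of n 0] by simp
next
  case False
  then have "emb n x * emb n (inverse x) = 1"
    using emb_mult[OF assms(2,1) inverse_in_L[OF assms(1)]] emb_of_rat[of n 1] by simp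
  then show ?thesis by (simp add: inverse_unique)
qed

text \<open>The conjugate of index 0 is x itself, so the trace is 3x, x or -x: an odd number of
  signs cannot cancel, and the trace is rational.\<close>

lemma rational_if_conjugates_eq_up_to_sign:
  assumes "x \<in> L" "\<And>n. n < 3 \<Longrightarrow> emb n x = x \<or> emb n x = - x"
  obtains q where "x = of_rat q"
proof -
  obtain r s t where x: "x = quad r s t \<alpha>" using assms(1) by (rule L_cases)
  have "emb 0 x = x" by (rule emb_0[OF assms(1)])
  then have s: "x + emb 1 x + emb 2 x = of_rat (tr r t)"
    using conjugates_sum[of r s t] by (simp add: x)
  have "emb 1 x = x \<or> emb 1 x = - x" "emb 2 x = x \<or> emb 2 x = - x" using assms(2) by auto
  with s have "x + x + x = of_rat (tr r t) \<or> x = of_rat (tr r t) \<or> - x = of_rat (tr r t)" by auto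
  then consider "x + x + x = of_rat (tr r t)" | "x = of_rat (tr r t)" | "- x = of_rat (tr r t)"
    by blast
  then show ?thesis
  proof cases
    case 1
    then have "x = of_rat (tr r t / 3)" by (simp add: of_rat_divide mult.commute)
    then show ?thesis by (rule that)
  next
    case 3
    then have "x = of_rat (- tr r t)" by (simp add: of_rat_minus flip: 3)
    then show ?thesis by (rule that)
  qed (rule that)
qed

lemma hop_quad:
  "hop k l m (quad r s t \<alpha>) = of_rat k * quad r s t \<alpha> + of_rat (l * tr r t)
     + of_rat m * (of_rat s * skew - of_rat t * \<alpha> * skew)"
  by (simp add: hop_def)

lemma gen_skew: "\<alpha> * skew = quad (6 * of_int a * of_int b) (- 2 * of_int a ^ 2) (- 9 * of_int b) \<alpha>"
proof -
  have "\<alpha> = quad 0 1 0 \<alpha>" by (simp add: quad_def)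
  then have "\<alpha> * skew = quad 0 1 0 \<alpha> * skew" by simp
  then show ?thesis by (simp add: skew_def quad_mult power2_eq_square mult_ac)
qed

lemma hop_coordinates:
  "hop k l m (quad r s t \<alpha>) =
     quad (k * r + l * tr r t + m * (4 * of_int a ^ 2 * s - 6 * of_int a * of_int b * t))
          (k * s + m * (2 * of_int a ^ 2 * t - 9 * of_int b * s))
          (k * t + m * (9 * of_int b * t - 6 * of_int a * s)) \<alpha>"
proof -
  have "hop k l m (quad r s t \<alpha>) = of_rat k * quad r s t \<alpha> + of_rat (l * tr r t)
     + of_rat m * (of_rat s * skew - of_rat t * (\<alpha> * skew))" by (simp add: hop_quad mult.assoc)
  then show ?thesis unfolding gen_skew unfolding skew_def quad_def
    by (simp add: of_rat_add of_rat_mult of_rat_diff of_rat_minus of_rat_power algebra_simps)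
qed

end

context hopf_galois_cubic
begin

text \<open>The diagonal coefficient equals all its conjugates, and the antisymmetric part of the
  other two, divided by \<delta>, equals its conjugates up to sign. Both are therefore rational, and
  with the counit they determine the parameters.\<close>

lemma act_eq_hop: "\<exists>k l m. \<forall>x\<in>L. act h x = hop k l m x"
proof -
  define E P Q \<epsilon> where "E = act_coef 0 0 h" "P = act_coef 0 1 h" "Q = act_coef 0 2 h"
    "\<epsilon> = (of_rat (counit h) :: complex)"
  note defs = E_P_Q_\<epsilon>_def
  have perm: "act_coef m m h = E" "(act_coef m n h - act_coef m k h)\<^sup>2 = (P - Q)\<^sup>2"
    if "m < 3" "n < 3" "k < 3" "n \<noteq> m" "k \<noteq> m" "n \<noteq> k" for m n k
    using act_coef_permutation[OF that] by (simp_all add: defs)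
  have diag: "act_coef m m h = E" if "m < 3" for m
    using third_index[OF that] perm(1)[OF that] by metis
  have sum3: "(\<Sum>i<3. f i) = f m + f n + f k"
    if "m < 3" "n < 3" "k < 3" "n \<noteq> m" "k \<noteq> m" "n \<noteq> k" for m n k :: nat and f :: "nat \<Rightarrow> complex"
    using that unfolding sum_less_3 by (elim less_3_cases) (simp_all add: ac_simps)
  have tot: "\<epsilon> = E + P + Q" using act_coef_counit[of 0 h] by (simp add: sum_less_3 defs)
  have L1: "act h 1 = \<epsilon>" using act_on_one[of h] by (simp add: qscale_def defs)
  have actL: "act h 1 \<in> L" "act h \<alpha> \<in> L" "act h (\<alpha>\<^sup>2) \<in> L" by (auto intro: act_closed L_gen)
  \<comment> \<open>The formula of \<open>coef\<close> for m = n = 0, written inside L, so that its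
    conjugates are the diagonal coefficients.\<close>
  define z where "z = (act h (\<alpha>\<^sup>2) + \<alpha> * act h \<alpha> + (\<alpha>\<^sup>2 - of_int a) * act h 1)
      * inverse (3 * \<alpha>\<^sup>2 - of_int a)"
  have aL: "of_int k \<in> L" for k using L_of_rat[of "of_int k"] by simp
  have ea: "emb n (of_int k) = of_int k" for n k using emb_of_rat[of n "of_int k"] by simp
  have fL: "\<alpha>\<^sup>2 - of_int a \<in> L" "3 * \<alpha>\<^sup>2 - of_int a \<in> L"
    using quad_in_L[of "- of_int a" 0 1] quad_in_L[of "- of_int a" 0 3] by (simp_all add: quad_def of_rat_minus)
  have ef: "emb n (\<alpha>\<^sup>2 - of_int a) = (rt n)\<^sup>2 - of_int a" "emb n (3 * \<alpha>\<^sup>2 - of_int a) = 3 * (rt n)\<^sup>2 - of_int a" for n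
    using emb_quad[of n "- of_int a" 0 1] emb_quad[of n "- of_int a" 0 3] by (simp_all add: quad_def of_rat_minus)
  have zL: "z \<in> L" unfolding z_def by (intro L_mult L_add inverse_in_L actL fL L_gen)
  have "emb n z = E" if "n < 3" for n
    unfolding diag[OF that, symmetric] act_coef_def coef_def z_def divide_inverse using that
    by (simp add: emb_mult emb_add emb_inverse L_mult L_add inverse_in_L actL fL L_gen ef emb_gen)
  with emb_0[OF zL] have "z = E" "\<And>n. n < 3 \<Longrightarrow> emb n z = z \<or> emb n z = - z" by auto
  with rational_if_conjugates_eq_up_to_sign[OF zL] obtain e where e: "E = of_rat e" by metis
  \<comment> \<open>The multiple of \<alpha> removes the symmetric part: in the m-th conjugate there
    remains the difference of the two off-diagonal coefficients times the difference of the two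
    other roots.\<close>
  define w where "w = of_rat 2 * act h \<alpha> + of_rat (counit h - 3 * e) * \<alpha>"
  have wL: "w \<in> L" unfolding w_def by (intro L_add L_mult L_of_rat actL L_gen)
  have emb_w: "emb m w = (act_coef m n h - act_coef m k h) * (rt n - rt k)"
    if i: "m < 3" "n < 3" "k < 3" "n \<noteq> m" "k \<noteq> m" "n \<noteq> k" for m n k
  proof -
    have "emb m w = of_rat 2 * emb m (act h \<alpha>) + of_rat (counit h - 3 * e) * rt m"
      unfolding w_def using i(1)
      by (simp only: emb_add emb_mult emb_of_rat L_mult L_of_rat actL L_gen emb_gen)
    then have "emb m w = 2 * emb m (act h \<alpha>) + (\<epsilon> - 3 * E) * rt m"
      by (simp add: e defs of_rat_diff of_rat_mult)
    also have "emb m (act h \<alpha>) = E * rt m + act_coef m n h * rt n + act_coef m k h * rt k"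
      unfolding emb_act[OF i(1) L_gen(2)] sum3[OF i] by (simp add: emb_gen diag[OF i(1)])
    also have "\<epsilon> = E + act_coef m n h + act_coef m k h"
      using act_coef_counit[OF i(1), of h] unfolding sum3[OF i] by (simp add: diag[OF i(1)] defs)
    also have "rt m = - (rt n + rt k)" using rt_diff_square(2)[OF i] by simp
    finally show ?thesis by (simp add: algebra_simps)
  qed
  define v where "v = w * inverse skew"
  have vL: "v \<in> L" unfolding v_def by (intro L_mult wL inverse_in_L skew_in_L)
  define disc where "disc = (of_int (4 * a ^ 3 - 27 * b\<^sup>2) :: complex)"
  have emb_v: "(emb m v)\<^sup>2 = (P - Q)\<^sup>2 / disc" if m: "m < 3" for m
  proof -
    obtain n k where nk: "n < 3" "k < 3" "n \<noteq> m" "k \<noteq> m" "n \<noteq> k" by (rule third_index[OF m])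
    define F G where "F = 3 * (rt m)\<^sup>2 - of_int a" "G = 4 * of_int a - 3 * (rt m)\<^sup>2"
    have nz: "F \<noteq> 0" "G \<noteq> 0" using deriv_rt_nonzero[OF m] diff_factor_nonzero[OF m] by (simp_all add: F_G_def)
    have "emb m v = emb m w / (- F * G)"
      using m by (simp add: v_def emb_mult wL inverse_in_L skew_in_L emb_inverse emb_skew F_G_def divide_inverse)
    then have "(emb m v)\<^sup>2 = (emb m w)\<^sup>2 / (F * G)\<^sup>2" by (simp add: power_divide)
    also have "(emb m w)\<^sup>2 = (P - Q)\<^sup>2 * G"
      unfolding emb_w[OF m nk] power_mult_distrib perm(2)[OF m nk] rt_diff_square(1)[OF m nk] F_G_def ..
    also have "(P - Q)\<^sup>2 * G / (F * G)\<^sup>2 = (P - Q)\<^sup>2 / (F\<^sup>2 * G)"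
      using nz by (simp add: power2_eq_square)
    also have "F\<^sup>2 * G = disc"
    proof -
      have "4 * of_int a ^ 3 - 27 * (of_int b)\<^sup>2 = - (F\<^sup>2 * (3 * (rt m)\<^sup>2 - 4 * of_int a))"
        using disc_identity[of "of_int a :: complex" "of_int b" "rt m"]
        unfolding rt_root[OF m] F_G_def by simp
      then show ?thesis by (simp add: disc_def F_G_def(2) algebra_simps)
    qed
    finally show ?thesis .
  qed
  have "emb n v = v \<or> emb n v = - v" if "n < 3" for n
    using emb_v[OF that] emb_v[of 0] emb_0[OF vL] by (simp flip: power2_eq_iff)
  with rational_if_conjugates_eq_up_to_sign[OF vL] obtain c where "v = of_rat c" by metis
  then have w: "w = of_rat c * skew" using skew_nonzero by (simp add: v_def field_simps)
  \<comment> \<open>The solution of e = k + l and \<open>counit h\<close> = k + 3l; the factor in m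
    is c/2 because w contains twice the image of \<alpha>.\<close>
  define k l m where "k = (3 * e - counit h) / 2" "l = (counit h - e) / 2" "m = c / 2"
  have klm: "of_rat k = (3 * E - \<epsilon>) / 2" "of_rat l = (\<epsilon> - E) / 2" "of_rat m = of_rat c / (2::complex)"
    by (simp_all add: k_l_m_def e defs of_rat_divide of_rat_diff of_rat_mult)
  have A1: "act h \<alpha> = of_rat k * \<alpha> + of_rat m * skew"
    using w unfolding klm w_def by (simp add: e defs of_rat_diff of_rat_mult field_simps)
  have w0: "w = (P - Q) * (rt 1 - rt 2)"
    using emb_w[of 0 1 2] emb_0[OF wL] by (simp add: defs)
  have A2: "act h (\<alpha>\<^sup>2) = of_rat k * \<alpha>\<^sup>2 + of_rat (2 * of_int a) * of_rat l - of_rat m * (\<alpha> * skew)"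
  proof -
    define x y where "x = rt 1" "y = rt 2"
    have al: "\<alpha> = - (x + y)" unfolding x_y_def rt_12(1) by simp
    have h2: "act h (\<alpha>\<^sup>2) = E * \<alpha>\<^sup>2 + P * x\<^sup>2 + Q * y\<^sup>2"
      using emb_act[of 0 "\<alpha>\<^sup>2" h] emb_0[OF actL(3)] L_gen by (simp add: sum_less_3 defs emb_gen x_y_def)
    have s: "of_rat m * (\<alpha> * skew) = \<alpha> * ((P - Q) * (x - y)) / 2"
      using w w0 by (simp add: klm x_y_def)
    have a2: "of_rat (2 * of_int a) = 2 * (\<alpha>\<^sup>2 - x * y)"
      using rt_12(2) by (simp add: of_rat_mult x_y_def)
    show ?thesis
      unfolding h2 s a2 klm(1,2) tot unfolding al by (simp add: field_simps power2_eq_square)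
  qed
  have A0: "act h 1 = of_rat k + 3 * of_rat l"
    unfolding L1 klm by (simp add: field_simps)
  have "act h x = hop k l m x" if "x \<in> L" for x
  proof -
    from that obtain r s t where x: "x = quad r s t \<alpha>" by (rule L_cases)
    show ?thesis
      unfolding x rat_linear_quad[OF act_linear_right] hop_quad A0 A1 A2
      by (simp add: quad_def tr_def of_rat_add of_rat_mult algebra_simps)
  qed
  then show ?thesis by blast
qed

end

context cubic_field
begin

lemma hop_add: "hop (k + k') (l + l') (m + m') x = hop k l m x + hop k' l' m' x"
  by (simp add: hop_def of_rat_add of_rat_mult algebra_simps)

lemma hop_scale: "hop (c * k) (c * l) (c * m) x = of_rat c * hop k l m x"
  by (simp add: hop_def of_rat_mult algebra_simps)

lemma hop_gen:
  "hop k l m 1 = of_rat (k + 3 * l)" "hop k l m \<alpha> = of_rat k * \<alpha> + of_rat m * skew"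
  "hop k l m (\<alpha>\<^sup>2) = of_rat k * \<alpha>\<^sup>2 + of_rat (2 * of_int a * l) - of_rat m * (\<alpha> * skew)"
  using hop_quad[of k l m 1 0 0] hop_quad[of k l m 0 1 0] hop_quad[of k l m 0 0 1]
  by (simp_all add: quad_def tr_def of_rat_add of_rat_mult mult_ac)

lemma hop_in_L: "x \<in> L \<Longrightarrow> hop k l m x \<in> L"
  by (elim L_cases) (simp add: hop_coordinates)

lemma hop_rat_linear: "rat_linear_on L qscale qscale (hop k l m)"
  unfolding rat_linear_on_def qscale_def
proof (intro conjI ballI allI)
  fix x y c assume "x \<in> L" "y \<in> L"
  then show "hop k l m (x + y) = hop k l m x + hop k l m y"
    by (simp add: hop_def crd_add tr_def of_rat_add of_rat_mult algebra_simps)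
next
  fix x c assume "x \<in> L"
  then have "hop k l m (of_rat c * x) = of_rat k * (of_rat c * x)
      + of_rat (l * tr (c * crd 0 x) (c * crd 2 x))
      + of_rat m * (of_rat (c * crd 1 x) * skew - of_rat (c * crd 2 x) * \<alpha> * skew)"
    by (simp only: hop_def crd_scale)
  then show "hop k l m (of_rat c * x) = of_rat c * hop k l m x"
    by (simp add: hop_def tr_def of_rat_add of_rat_mult algebra_simps)
qed

text \<open>The parameters are complex because this is applied to sums with coefficients in L.
  Eliminating M and N from the values at 1, \<alpha>, \<alpha>^2 leaves 2K f'(\<alpha>) = 0.\<close>

lemma hop_operators_independent:
  assumes "K + 3 * M = 0" "K * \<alpha> + N * skew = 0" "K * \<alpha>\<^sup>2 + 2 * of_int a * M - N * (\<alpha> * skew) = 0"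
  shows "K = 0" "M = 0" "N = 0"
proof -
  have "2 * K * (3 * \<alpha>\<^sup>2 - of_int a) =
      3 * (K * \<alpha>\<^sup>2 + 2 * of_int a * M - N * (\<alpha> * skew)) + 3 * \<alpha> * (K * \<alpha> + N * skew)
      - 2 * of_int a * (K + 3 * M)"
    by (simp add: algebra_simps power2_eq_square)
  then have "2 * K * (3 * \<alpha>\<^sup>2 - of_int a) = 0" by (simp only: assms) simp
  then show "K = 0" using deriv_rt_nonzero[of 0] by simp
  then show "M = 0" "N = 0" using assms skew_nonzero by auto
qed

end

context hopf_galois_cubic
begin

text \<open>The tensor 1 \<otimes> h acts as zero, so every rational functional must vanish at
  h.\<close>

lemma act_injective:
  assumes "\<And>x. x \<in> L \<Longrightarrow> act h x = 0"
  shows "h = 0"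
proof (rule ccontr)
  assume "h \<noteq> 0"
  then obtain \<phi> :: "'h \<Rightarrow> rat" where \<phi>: "Vector_Spaces.linear scale (*) \<phi>" "\<phi> h \<noteq> 0"
    using rat_functional_separates[OF vector_space_axioms] by blast
  interpret \<phi>: Vector_Spaces.linear scale "(*)" \<phi> by fact
  have "(\<Sum>(x, k)\<leftarrow>[(1, h)]. x * of_rat (\<phi> k)) = (0 :: complex)"
    by (rule tensor_zero_eval) (use assms L_gen in \<open>auto simp: \<phi>.add \<phi>.scale of_rat_add of_rat_mult\<close>)
  then show False using \<phi>(2) by simp
qed

text \<open>Surjectivity only provides an L-combination of operators. Its total parameters are
  rational, so replacing each coefficient x by \<open>crd 0 x\<close>, a rational-linear retraction
  of L onto the rationals, leaves them unchanged and yields a single element of the Hopf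
  algebra.\<close>

lemma hop_eq_act: "\<exists>h. \<forall>x\<in>L. act h x = hop k l m x"
proof -
  have "hop k l m ` L \<subseteq> L" using hop_in_L by auto
  from galois_surj[OF this hop_rat_linear]
  obtain us where "fst ` set us \<subseteq> L \<and> (\<forall>y\<in>L. (\<Sum>(x, h)\<leftarrow>us. x * act h y) = hop k l m y)" ..
  then have us: "fst ` set us \<subseteq> L" "\<And>y. y \<in> L \<Longrightarrow> (\<Sum>(x, h)\<leftarrow>us. x * act h y) = hop k l m y"
    by auto
  obtain K M N where KMN: "\<And>h x. x \<in> L \<Longrightarrow> act h x = hop (K h) (M h) (N h) x"
    using act_eq_hop by metis
  define SK SM SN where "SK = (\<Sum>(x, h)\<leftarrow>us. x * of_rat (K h))"
    "SM = (\<Sum>(x, h)\<leftarrow>us. x * of_rat (M h))" "SN = (\<Sum>(x, h)\<leftarrow>us. x * of_rat (N h))"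
  note defs = SK_SM_SN_def
  have "SK + 3 * SM = (\<Sum>(x, h)\<leftarrow>us. x * act h 1)"
    unfolding KMN[OF L_gen(1)] hop_gen defs
    by (induction us) (auto simp: of_rat_add of_rat_mult algebra_simps)
  then have 1: "(SK - of_rat k) + 3 * (SM - of_rat l) = 0"
    unfolding us(2)[OF L_gen(1)] hop_gen by (simp add: of_rat_add of_rat_mult algebra_simps)
  have "SK * \<alpha> + SN * skew = (\<Sum>(x, h)\<leftarrow>us. x * act h \<alpha>)"
    unfolding KMN[OF L_gen(2)] hop_gen defs by (induction us) (auto simp: algebra_simps)
  then have 2: "(SK - of_rat k) * \<alpha> + (SN - of_rat m) * skew = 0"
    unfolding us(2)[OF L_gen(2)] hop_gen by (simp add: algebra_simps)
  have "SK * \<alpha>\<^sup>2 + 2 * of_int a * SM - SN * (\<alpha> * skew) = (\<Sum>(x, h)\<leftarrow>us. x * act h (\<alpha>\<^sup>2))"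
    unfolding KMN[OF L_gen(3)] hop_gen defs
    by (induction us) (auto simp: of_rat_add of_rat_mult algebra_simps)
  then have 3: "(SK - of_rat k) * \<alpha>\<^sup>2 + 2 * of_int a * (SM - of_rat l) - (SN - of_rat m) * (\<alpha> * skew) = 0"
    unfolding us(2)[OF L_gen(3)] hop_gen by (simp add: of_rat_mult algebra_simps)
  from hop_operators_independent[OF 1 2 3] have S: "SK = of_rat k" "SM = of_rat l" "SN = of_rat m" by auto
  have crd_S: "crd 0 (\<Sum>(x, h)\<leftarrow>us. x * of_rat (f h)) = (\<Sum>(x, h)\<leftarrow>us. crd 0 x * f h)" for f
  proof -
    have "crd 0 (\<Sum>(x, h)\<leftarrow>us. x * of_rat (f h)) = (\<Sum>(x, h)\<leftarrow>us. crd 0 (of_rat (f h) * x))"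
      using us(1) by (subst crd_sum_list) (auto simp: split_def mult.commute intro!: L_mult L_of_rat)
    also have "\<dots> = (\<Sum>(x, h)\<leftarrow>us. crd 0 x * f h)"
      using us(1) by (intro arg_cong[of _ _ sum_list] map_cong refl) (auto simp: crd_scale)
    finally show ?thesis .
  qed
  have crd_0: "crd 0 (of_rat q) = q" for q using crd_quad[of 0 q 0 0] by (simp add: quad_def)
  have k: "(\<Sum>(x, h)\<leftarrow>us. crd 0 x * K h) = k" "(\<Sum>(x, h)\<leftarrow>us. crd 0 x * M h) = l"
    "(\<Sum>(x, h)\<leftarrow>us. crd 0 x * N h) = m"
    unfolding crd_S[symmetric] defs[symmetric] S crd_0 by (rule refl)+
  have "act (\<Sum>(x, h)\<leftarrow>us. scale (crd 0 x) h) y = hop k l m y" if "y \<in> L" for y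
  proof -
    have "act (\<Sum>(x, h)\<leftarrow>us. scale (crd 0 x) h) y =
        (\<Sum>(x, h)\<leftarrow>us. hop (crd 0 x * K h) (crd 0 x * M h) (crd 0 x * N h) y)"
      unfolding act_sum_list[OF that] split_def
      by (simp only: hop_scale KMN[OF that, symmetric] act_scale[OF that])
    also have "\<dots> = hop (\<Sum>(x, h)\<leftarrow>us. crd 0 x * K h) (\<Sum>(x, h)\<leftarrow>us. crd 0 x * M h)
        (\<Sum>(x, h)\<leftarrow>us. crd 0 x * N h) y"
      by (induction us) (auto simp: hop_add, simp add: hop_def)
    finally show ?thesis by (simp only: k)
  qed
  then show ?thesis by blast
qed

end

section \<open>Freeness and its families of coordinates\<close>

lemma free_over_singleton:
  assumes "t \<in> M" "0 \<in> A" "act 0 t = 0" "\<And>x. x \<in> M \<Longrightarrow> \<exists>!h. h \<in> A \<and> x = act h t"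
  shows "free_over A act M"
  unfolding free_over_def
proof (intro exI[of _ "{t}"] conjI ballI)
  fix x assume "x \<in> M"
  then obtain h where h: "h \<in> A" "x = act h t" "\<And>k. k \<in> A \<Longrightarrow> x = act k t \<Longrightarrow> k = h"
    using assms(4) by blast
  have sum: "(\<Sum>s | c s \<noteq> 0. act (c s) s) = act (c t) t" if "{s. c s \<noteq> 0} \<subseteq> {t}" for c
  proof (cases "c t = 0")
    case True
    with that have "{s. c s \<noteq> 0} = {}" by auto
    then show ?thesis using True assms(3) by (simp only: sum.empty)
  next
    case False
    with that have "{s. c s \<noteq> 0} = {t}" by auto
    then show ?thesis by simp
  qed
  let ?P = "\<lambda>c. range c \<subseteq> A \<and> {t. c t \<noteq> 0} \<subseteq> {t} \<and> finite {t. c t \<noteq> 0} \<and>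
       x = (\<Sum>t | c t \<noteq> 0. act (c t) t)"
  show "\<exists>!c. ?P c"
  proof (rule ex1I[of _ "(\<lambda>_. 0)(t := h)"])
    have sub: "{s. ((\<lambda>_. 0)(t := h)) s \<noteq> 0} \<subseteq> {t}" by auto
    show "?P ((\<lambda>_. 0)(t := h))"
      using h sum[OF sub] assms(2) finite_subset[OF sub] by (auto split: if_splits)
  next
    fix c assume c: "?P c"
    then have "c t = h" using h(3)[of "c t"] sum[of c] by auto
    moreover have "c s = 0" if "s \<noteq> t" for s using c that by auto
    ultimately show "c = (\<lambda>_. 0)(t := h)" by auto
  qed
qed (use assms(1) in auto)

text \<open>Two singly supported families representing one element must coincide. This excludes
  annihilators of a basis element (the case s = t, k = 0) as well as a second basis element.\<close>

lemma free_over_unique_coefficient: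
  assumes B: "\<And>x. x \<in> M \<Longrightarrow> \<exists>!c. range c \<subseteq> A \<and> {t. c t \<noteq> 0} \<subseteq> B \<and> finite {t. c t \<noteq> 0} \<and>
       x = (\<Sum>t | c t \<noteq> 0. act (c t) t)"
    and "act h t \<in> M" "act h t = act k s" "h \<in> A" "k \<in> A" "0 \<in> A" "t \<in> B" "s \<in> B"
    and zero: "act 0 t = 0" "act 0 s = 0"
  shows "(\<lambda>_. 0)(t := h) = (\<lambda>_. 0)(s := k)"
proof -
  have P: "range ((\<lambda>_. 0)(u := j)) \<subseteq> A \<and> {v. ((\<lambda>_. 0)(u := j)) v \<noteq> 0} \<subseteq> B \<and>
      finite {v. ((\<lambda>_. 0)(u := j)) v \<noteq> 0} \<and>
      act j u = (\<Sum>v | ((\<lambda>_. 0)(u := j)) v \<noteq> 0. act (((\<lambda>_. 0)(u := j)) v) v)"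
    if "j \<in> A" "u \<in> B" "act 0 u = 0" for j u
  proof (cases "j = 0")
    case True
    then show ?thesis using that assms(6) by auto
  next
    case False
    then have "{v. ((\<lambda>_. 0)(u := j)) v \<noteq> 0} = {u}" by auto
    then show ?thesis using that assms(6) by (auto split: if_splits)
  qed
  note 1 = P[OF assms(4,7) zero(1)] and 2 = P[OF assms(5,8) zero(2), folded assms(3)]
  show ?thesis
    by (rule alt_ex1E[OF B[OF assms(2)]]) (use 1 2 in blast)
qed

subsection \<open>The associated order\<close>

context hopf_galois_cubic
begin

lemma quad_of_int_in_iff:
  "quad r s t \<alpha> \<in> int_adjoin \<alpha> \<longleftrightarrow> r \<in> \<int> \<and> s \<in> \<int> \<and> t \<in> \<int>"
  unfolding int_adjoin_eq by (auto simp: quad_inject elim!: Ints_cases)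

lemma act_scale_one: "x \<in> L \<Longrightarrow> act (scale c 1) x = of_rat c * x"
  by (simp add: act_scale act_one)

lemma act_agree:
  assumes "\<And>x. x \<in> L \<Longrightarrow> act h x = act k x"
  shows "h = k"
proof -
  have "act (h - k) x = 0" if "x \<in> L" for x
    using act_add[OF that, of "h - k" k] assms[OF that] by simp
  then show ?thesis using act_injective[of "h - k"] by simp
qed

end

text \<open>In the applications \<open>d = gcd(3a, a\<^sup>2, 9b)\<close> and \<open>\<kappa> = gcd(3, a)\<close>, and the associated order has
  the \<open>\<int>\<close>-basis \<open>1\<close>, \<open>Tr / \<kappa>\<close>, \<open>(\<delta> (\<sigma> - \<sigma>\<^sup>2) - 3b Tr + 9b) / 2d\<close>, which acts on coordinates through
  \<open>order_op\<close>.\<close>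

locale monogenic_hopf_galois_cubic =
  hopf_galois_cubic a b \<alpha> scale comult counit antipode act
  for a b :: int and \<alpha> :: complex
    and scale :: "rat \<Rightarrow> 'h::ring_1 \<Rightarrow> 'h" and comult counit antipode act +
  fixes d \<kappa> p q r :: int
  assumes monogenic: "ring_of_integers L = int_adjoin \<alpha>"
    and d_pos: "d \<noteq> 0" and p: "3 * a = p * d" and q: "a\<^sup>2 = q * d" and r: "9 * b = r * d"
    and bezout: "\<exists>x y z. d = 3 * a * x + a\<^sup>2 * y + 9 * b * z"
    and \<kappa>: "\<kappa> = 1 \<and> \<not> 3 dvd a \<or> \<kappa> = 3 \<and> 3 dvd a"
begin

text \<open>Traces of integral points fill the ideal generated by 3 and 2a, that is by \<kappa>, so
  the division is exact.\<close>

definition tr_div :: "int \<Rightarrow> int \<Rightarrow> int" where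
  "tr_div x z = (3 * x + 2 * a * z) div \<kappa>"

lemma tr_div: "3 * x + 2 * a * z = \<kappa> * tr_div x z"
proof -
  have "\<kappa> dvd 3 * x + 2 * a * z" using \<kappa> by auto
  then show ?thesis by (simp add: tr_div_def)
qed

definition order_op :: "int \<Rightarrow> int \<Rightarrow> int \<Rightarrow> int \<Rightarrow> int \<Rightarrow> int \<Rightarrow> complex" where
  "order_op i j n x y z = quad
     (of_int (i * x + j * tr_div x z + n * (2 * q * y - 2 * b * p * z)))
     (of_int (i * y + n * (q * z)))
     (of_int (i * z + n * (r * z - p * y))) \<alpha>"

abbreviation "ASO \<equiv> associated_order act L"

abbreviation ipoint :: "int \<Rightarrow> int \<Rightarrow> int \<Rightarrow> complex" where
  "ipoint x y z \<equiv> quad (of_int x) (of_int y) (of_int z) \<alpha>"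

text \<open>In the third generator the summand 9b removes the denominator 2 from the coordinates of
  \<alpha> and \<alpha>^2, and -3b Tr cancels the multiple of x which 9b brings into the constant
  coordinate.\<close>

lemma hop_eq_order_op:
  "hop (of_int i + of_int n * (9 * of_int b) / (2 * of_int d))
       (of_int j / of_int \<kappa> - of_int n * (3 * of_int b) / (2 * of_int d))
       (of_int n / (2 * of_int d)) (ipoint x y z) = order_op i j n x y z"
proof -
  define A B D where "A = (of_int a :: rat)" "B = (of_int b :: rat)" "D = (of_int d :: rat)"
  define P Q R where "P = (of_int p :: rat)" "Q = (of_int q :: rat)" "R = (of_int r :: rat)"
  have D: "D \<noteq> 0" using d_pos by (simp add: A_B_D_def)
  have "of_int (3 * a) = (of_int (p * d) :: rat)" "of_int (a\<^sup>2) = (of_int (q * d) :: rat)"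
    "of_int (9 * b) = (of_int (r * d) :: rat)"
    by (simp_all only: p q r)
  then have "3 * A = P * D" "A\<^sup>2 = Q * D" "9 * B = R * D"
    by (simp_all add: A_B_D_def P_Q_R_def)
  then have PQR: "P = 3 * A / D" "Q = A\<^sup>2 / D" "R = 9 * B / D" using D by simp_all
  have \<kappa>0: "of_int \<kappa> \<noteq> (0::rat)" using \<kappa> by auto
  have "of_int (3 * x + 2 * a * z) = (of_int (\<kappa> * tr_div x z) :: rat)" by (simp only: tr_div)
  then have T: "tr (of_int x) (of_int z) = of_int \<kappa> * of_int (tr_div x z)"
    by (simp add: tr_def)
  have T2: "of_int \<kappa> * of_int (tr_div x z) = 3 * of_int x + 2 * A * (of_int z :: rat)"
    unfolding T[symmetric] by (simp add: tr_def A_B_D_def)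
  have 1: "(of_int i + of_int n * (9 * B) / (2 * D)) * of_int x
      + (of_int j / of_int \<kappa> - of_int n * (3 * B) / (2 * D)) * (of_int \<kappa> * of_int (tr_div x z))
      + of_int n / (2 * D) * (4 * A\<^sup>2 * of_int y - 6 * A * B * of_int z)
    = of_int (i * x + j * tr_div x z + n * (2 * q * y - 2 * b * p * z))"
  proof -
    have "(of_int i + of_int n * (9 * B) / (2 * D)) * of_int x
      + (of_int j / of_int \<kappa> - of_int n * (3 * B) / (2 * D)) * (of_int \<kappa> * of_int (tr_div x z))
      + of_int n / (2 * D) * (4 * A\<^sup>2 * of_int y - 6 * A * B * of_int z)
      = (of_int i + of_int n * (9 * B) / (2 * D)) * of_int x + of_int j * of_int (tr_div x z)
      - of_int n * (3 * B) / (2 * D) * (3 * of_int x + 2 * A * of_int z)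
      + of_int n / (2 * D) * (4 * A\<^sup>2 * of_int y - 6 * A * B * of_int z)"
      unfolding T2[symmetric] using \<kappa>0 by (simp add: algebra_simps)
    also have "\<dots> = of_int i * of_int x + of_int j * of_int (tr_div x z)
        + of_int n * (2 * Q * of_int y - 2 * B * P * of_int z)"
      unfolding PQR using D by (simp add: field_simps)
    finally show ?thesis by (simp add: A_B_D_def P_Q_R_def)
  qed
  have 2: "(of_int i + of_int n * (9 * B) / (2 * D)) * of_int y
      + of_int n / (2 * D) * (2 * A\<^sup>2 * of_int z - 9 * B * of_int y) = of_int (i * y + n * (q * z))"
  proof -
    have "(of_int i + of_int n * (9 * B) / (2 * D)) * of_int y
      + of_int n / (2 * D) * (2 * A\<^sup>2 * of_int z - 9 * B * of_int y)
      = of_int i * of_int y + of_int n * (Q * of_int z)"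
      unfolding PQR using D by (simp add: field_simps)
    then show ?thesis by (simp add: P_Q_R_def)
  qed
  have 3: "(of_int i + of_int n * (9 * B) / (2 * D)) * of_int z
      + of_int n / (2 * D) * (9 * B * of_int z - 6 * A * of_int y) = of_int (i * z + n * (r * z - p * y))"
  proof -
    have "(of_int i + of_int n * (9 * B) / (2 * D)) * of_int z
      + of_int n / (2 * D) * (9 * B * of_int z - 6 * A * of_int y)
      = of_int i * of_int z + of_int n * (R * of_int z - P * of_int y)"
      unfolding PQR using D by (simp add: field_simps)
    then show ?thesis by (simp add: P_Q_R_def)
  qed
  show ?thesis
    unfolding hop_coordinates T order_op_def A_B_D_def[symmetric] 1 2 3 ..
qed

lemma in_ASO_iff: "h \<in> ASO \<longleftrightarrow> (\<forall>x y z. act h (ipoint x y z) \<in> int_adjoin \<alpha>)"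
  unfolding associated_order_def monogenic int_adjoin_eq by blast

lemma order_op_in: "order_op i j n x y z \<in> int_adjoin \<alpha>"
  by (simp add: order_op_def quad_of_int_in_iff)

lemma ASO_element: "\<exists>h\<in>ASO. \<forall>x y z. act h (ipoint x y z) = order_op i j n x y z"
proof -
  obtain h where "\<forall>x\<in>L. act h x = hop (of_int i + of_int n * (9 * of_int b) / (2 * of_int d))
       (of_int j / of_int \<kappa> - of_int n * (3 * of_int b) / (2 * of_int d))
       (of_int n / (2 * of_int d)) x"
    using hop_eq_act by blast
  then have "act h (ipoint x y z) = order_op i j n x y z" for x y z
    by (simp add: hop_eq_order_op)
  then show ?thesis by (intro bexI[of _ h]) (auto simp: in_ASO_iff order_op_in)
qed

text \<open>Integrality of the images of 1, \<alpha>, \<alpha>^2 makes 6am, 2a^2 m and 18bm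
  integers, hence 2dm by Bezout. After removal of the third generator, k', 3l' and 2al' are
  integers, so the denominator of l' divides \<kappa>.\<close>

lemma ASO_cases:
  assumes "h \<in> ASO"
  obtains i j n where "\<And>x y z. act h (ipoint x y z) = order_op i j n x y z"
proof -
  obtain k l m where h: "\<And>x. x \<in> L \<Longrightarrow> act h x = hop k l m x" using act_eq_hop by blast
  have "hop k l m (ipoint x y z) \<in> int_adjoin \<alpha>" for x y z
    unfolding h[OF quad_in_L, symmetric] using assms in_ASO_iff by blast
  then have int: "k * of_int x + l * tr (of_int x) (of_int z)
      + m * (4 * of_int a ^ 2 * of_int y - 6 * of_int a * of_int b * of_int z) \<in> \<int>"
    "k * of_int y + m * (2 * of_int a ^ 2 * of_int z - 9 * of_int b * of_int y) \<in> \<int>"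
    "k * of_int z + m * (9 * of_int b * of_int z - 6 * of_int a * of_int y) \<in> \<int>" for x y z
    unfolding hop_coordinates quad_of_int_in_iff by blast+
  have "- (m * (6 * of_int a)) \<in> \<int>" using int(3)[where y = 1 and z = 0] by simp
  then have m1: "m * (6 * of_int a) \<in> \<int>" using Ints_minus by fastforce
  have m2: "m * (2 * of_int a ^ 2) \<in> \<int>" using int(2)[where y = 0 and z = 1] by simp
  have k9: "k - m * (9 * of_int b) \<in> \<int>" using int(2)[where y = 1 and z = 0] by simp
  have "k + m * (9 * of_int b) \<in> \<int>" using int(3)[where y = 0 and z = 1] by simp
  then have "(k + m * (9 * of_int b)) - (k - m * (9 * of_int b)) \<in> \<int>"
    using k9 by (rule Ints_diff)
  then have m3: "m * (18 * of_int b) \<in> \<int>" by (simp add: algebra_simps)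
  obtain x y z where xyz: "d = 3 * a * x + a\<^sup>2 * y + 9 * b * z" using bezout by blast
  have "2 * of_int d * m = of_int x * (m * (6 * of_int a)) + of_int y * (m * (2 * of_int a ^ 2))
      + of_int z * (m * (18 * of_int b))"
    by (simp add: xyz algebra_simps)
  also have "\<dots> \<in> \<int>" by (intro Ints_add Ints_mult[OF Ints_of_int] m1 m2 m3)
  finally obtain n where "2 * of_int d * m = of_int n" by (auto elim: Ints_cases)
  then have n: "m = of_int n / (2 * of_int d)" using d_pos by (simp add: field_simps)
  define k' l' where "k' = k - of_int n * (9 * of_int b) / (2 * of_int d)"
    "l' = l + of_int n * (3 * of_int b) / (2 * of_int d)"
  have "k' = k - m * (9 * of_int b)" by (simp add: k'_l'_def n)
  with k9 have "k' \<in> \<int>" by simp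
  have "k' + 3 * l' = k + 3 * l" by (simp add: k'_l'_def)
  also have "\<dots> \<in> \<int>" using int(1)[where x = 1 and y = 0 and z = 0] by (simp add: tr_def mult.commute)
  finally have "(k' + 3 * l') - k' \<in> \<int>" using \<open>k' \<in> \<int>\<close> by (rule Ints_diff)
  then have l3: "3 * l' \<in> \<int>" by simp
  have "2 * of_int a * l' = (l * tr 0 1 - m * (6 * of_int a * of_int b)) + of_int (2 * b) * (m * (6 * of_int a))"
    by (simp add: k'_l'_def n tr_def field_simps)
  also have "\<dots> \<in> \<int>"
    using int(1)[where x = 0 and y = 0 and z = 1] m1 by (intro Ints_add Ints_mult[of "of_int (2 * b)"]) (simp_all add: mult_ac)
  finally have la: "2 * of_int a * l' \<in> \<int>" .
  have "of_int \<kappa> * l' \<in> \<int>"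
  proof (cases "3 dvd a")
    case True
    then show ?thesis using \<kappa> l3 by auto
  next
    case False
    then have "a mod 3 = 1 \<or> a mod 3 = 2" by presburger
    then obtain c where "a = 3 * c + 1 \<or> a = 3 * c + 2" by (metis mult_div_mod_eq)
    \<comment> \<open>The numbers 2a and 3(2c + 1) differ by one in either residue class.\<close>
    then have "l' = of_int (2 * c + 1) * (3 * l') - 2 * of_int a * l'
        \<or> l' = 2 * of_int a * l' - of_int (2 * c + 1) * (3 * l')"
      by (auto simp: algebra_simps)
    moreover have "of_int (2 * c + 1) * (3 * l') \<in> \<int>" by (intro Ints_mult[OF Ints_of_int] l3)
    ultimately have "l' \<in> \<int>" using la Ints_diff by metis
    then show ?thesis using False \<kappa> by auto
  qed
  then obtain i j where ij: "k' = of_int i" "of_int \<kappa> * l' = of_int j"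
    using \<open>k' \<in> \<int>\<close> by (auto elim!: Ints_cases)
  have \<kappa>0: "of_int \<kappa> \<noteq> (0::rat)" using \<kappa> by auto
  have "k = of_int i + of_int n * (9 * of_int b) / (2 * of_int d)"
    using ij(1) by (simp add: k'_l'_def)
  moreover have "l = of_int j / of_int \<kappa> - of_int n * (3 * of_int b) / (2 * of_int d)"
    unfolding ij(2)[symmetric] using \<kappa>0 by (simp add: k'_l'_def)
  ultimately have "act h (ipoint x y z) = order_op i j n x y z" for x y z
    using h[of "ipoint x y z"] by (simp only: n hop_eq_order_op quad_in_L)
  then show ?thesis by (rule that)
qed

lemma zero_in_ASO: "0 \<in> ASO"
  using quad_of_int_in_iff[of 0 0 0] by (simp add: in_ASO_iff act_zero quad_def[of 0 0 0])

lemma order_op_eq_0: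
  assumes "\<And>x y z. order_op i j n x y z = 0"
  shows "i = 0 \<and> j = 0 \<and> n = 0"
proof -
  have z: "i * x + j * tr_div x z + n * (2 * q * y - 2 * b * p * z) = 0"
    "i * y + n * (q * z) = 0" "i * z + n * (r * z - p * y) = 0" for x y z
    using quad_eq_0[OF assms[of x y z, unfolded order_op_def]] by (simp_all only: of_int_eq_0_iff)
  have "i = 0" using z(2)[of 1 0] by simp
  moreover have "n = 0"
  proof (rule ccontr)
    assume "n \<noteq> 0"
    then have "q = 0" "r = 0" "p = 0"
      using z(2)[of 0 1] z(3)[of 1 0] z(3)[of 0 1] \<open>i = 0\<close> by simp_all
    then have "d = 0" using p q r bezout by auto
    then show False using d_pos by simp
  qed
  moreover have "j * tr_div 1 0 = 0" using z(1)[of 1 0 0] \<open>i = 0\<close> \<open>n = 0\<close> by simp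
  then have "j = 0" using tr_div[of 1 0] by auto
  ultimately show ?thesis by simp
qed

section \<open>Determinants, unimodular points and the norm equation\<close>

definition qform :: "int \<Rightarrow> int \<Rightarrow> int" where
  "qform y z = p * y\<^sup>2 - r * y * z + q * z\<^sup>2"

lemma qform: "3 * a * y\<^sup>2 - 9 * b * y * z + a\<^sup>2 * z\<^sup>2 = d * qform y z"
proof -
  have "d * qform y z = (p * d) * y\<^sup>2 - (r * d) * y * z + (q * d) * z\<^sup>2"
    by (simp add: qform_def algebra_simps)
  then show ?thesis by (simp only: p q r)
qed

lemma order_op_ipoint:
  "order_op i j n x y z = ipoint x' y' z' \<longleftrightarrow>
     i * x + j * tr_div x z + n * (2 * q * y - 2 * b * p * z) = x' \<and>
     i * y + n * (q * z) = y' \<and> i * z + n * (r * z - p * y) = z'"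
  by (simp only: order_op_def quad_inject of_int_eq_iff)

text \<open>A trivial kernel forces the integer determinant to be nonzero; it is the product of
  these two factors, because j affects only the first coordinate.\<close>

lemma nonsingular_if_injective:
  assumes "\<And>h. h \<in> ASO \<Longrightarrow> act h (ipoint x y z) = 0 \<Longrightarrow> h = 0"
  shows "tr_div x z \<noteq> 0" "qform y z \<noteq> 0"
proof -
  have ker: "i = 0 \<and> j = 0 \<and> n = 0" if "order_op i j n x y z = 0" for i j n
  proof -
    obtain h where h: "h \<in> ASO" "\<And>x y z. act h (ipoint x y z) = order_op i j n x y z"
      using ASO_element[of i j n] by blast
    then have "h = 0" using assms that by simp
    then have "order_op i j n x y z = 0" for x y z using h(2)[of x y z] by (simp add: act_zero)
    then show ?thesis by (rule order_op_eq_0)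
  qed
  have ker': "i = 0 \<and> j = 0 \<and> n = 0"
    if "i * x + j * tr_div x z + n * (2 * q * y - 2 * b * p * z) = 0"
      "i * y + n * (q * z) = 0" "i * z + n * (r * z - p * y) = 0" for i j n
  proof (rule ker)
    show "order_op i j n x y z = 0"
      using that order_op_ipoint[of i j n x y z 0 0 0] by (simp add: quad_def)
  qed
  show T: "tr_div x z \<noteq> 0" using ker'[of 0 1 0] by auto
  show "qform y z \<noteq> 0"
  proof
    assume 0: "qform y z = 0"
    \<comment> \<open>A kernel vector of the block in (i, n) lifts to the full matrix after
      multiplication by T, with j absorbing the first coordinate. The vectors tested afterwards are
      taken from the adjugate of that block.\<close>
    have lift: "i = 0 \<and> n = 0" if in_eq: "i * y + n * (q * z) = 0" "i * z + n * (r * z - p * y) = 0" for i n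
    proof -
      define T where "T = tr_div x z"
      have "(T * i) * x + (- (i * x + n * (2 * q * y - 2 * b * p * z))) * T
          + (T * n) * (2 * q * y - 2 * b * p * z) = 0"
        by (simp add: algebra_simps)
      moreover have "(T * i) * y + (T * n) * (q * z) = T * (i * y + n * (q * z))"
        "(T * i) * z + (T * n) * (r * z - p * y) = T * (i * z + n * (r * z - p * y))"
        by (simp_all add: algebra_simps)
      ultimately have "T * i = 0 \<and> - (i * x + n * (2 * q * y - 2 * b * p * z)) = 0 \<and> T * n = 0"
        unfolding T_def by (intro ker') (simp_all only: in_eq mult_zero_right)
      then show ?thesis using T by (simp add: T_def)
    qed
    have "(q * z) * y + (- y) * (q * z) = 0" by simp
    moreover have "(q * z) * z + (- y) * (r * z - p * y) = qform y z"
      by (simp add: qform_def algebra_simps power2_eq_square)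
    ultimately have y: "y = 0" using lift[of "q * z" "- y"] 0 by simp
    have "(r * z - p * y) * y + (- z) * (q * z) = - qform y z"
      by (simp add: qform_def algebra_simps power2_eq_square)
    moreover have "(r * z - p * y) * z + (- z) * (r * z - p * y) = 0" by simp
    ultimately have z: "z = 0" using lift[of "r * z - p * y" "- z"] 0 by simp
    show False using lift[of 0 1] y z by simp
  qed
qed

lemma act_scale_ipoint: "act (scale (of_int c) 1) (ipoint x y z) = ipoint (c * x) (c * y) (c * z)"
  unfolding act_scale_one[OF quad_in_L] quad_scale by simp

lemma ASO_scale: "scale (of_int c) 1 \<in> ASO"
  unfolding in_ASO_iff act_scale_ipoint by (simp add: quad_of_int_in_iff)

text \<open>Cramer's rule with denominators cleared by c = T * D. Any other point has a nonzero
  integer multiple in the orbit of a nonsingular one, which prevents a basis with two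
  elements.\<close>

lemma common_multiple:
  assumes "tr_div x z \<noteq> 0" "qform y z \<noteq> 0"
  obtains h c where "h \<in> ASO" "c \<noteq> 0" "act h (ipoint x y z) = act (scale (of_int c) 1) (ipoint x' y' z')"
proof -
  define T D where "T = tr_div x z" "D = y * (r * z - p * y) - z * (q * z)"
  have D: "D = - qform y z" by (simp add: T_D_def qform_def algebra_simps power2_eq_square)
  define i where "i = y' * (r * z - p * y) - z' * (q * z)"
  define n where "n = y * z' - z * y'"
  obtain h where h: "h \<in> ASO" "\<And>u v w. act h (ipoint u v w) =
      order_op (T * i) (D * x' - (i * x + n * (2 * q * y - 2 * b * p * z))) (T * n) u v w"
    using ASO_element[of "T * i" "D * x' - (i * x + n * (2 * q * y - 2 * b * p * z))" "T * n"]
    by blast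
  have "order_op (T * i) (D * x' - (i * x + n * (2 * q * y - 2 * b * p * z))) (T * n) x y z
      = ipoint (T * D * x') (T * D * y') (T * D * z')"
    unfolding order_op_ipoint T_D_def(1)[symmetric] i_def n_def
    by (simp add: T_D_def(2) algebra_simps)
  then have "act h (ipoint x y z) = act (scale (of_int (T * D)) 1) (ipoint x' y' z')"
    by (simp only: h(2) act_scale_ipoint)
  moreover have "T * D \<noteq> 0" using assms D by (simp add: T_D_def(1))
  ultimately show ?thesis using h(1) that by blast
qed

lemma gen_in: "ipoint x y z \<in> int_adjoin \<alpha>"
  by (simp add: quad_of_int_in_iff)

lemma free_iff:
  "free_over ASO act (ring_of_integers L) \<longleftrightarrow>
     (\<exists>x y z. \<bar>tr_div x z\<bar> = 1 \<and> \<bar>qform y z\<bar> = 1)"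
proof
  assume free: "free_over ASO act (ring_of_integers L)"
  let ?P = "\<lambda>B x c. range c \<subseteq> ASO \<and> {t. c t \<noteq> 0} \<subseteq> B \<and> finite {t. c t \<noteq> 0} \<and>
      x = (\<Sum>t | c t \<noteq> 0. act (c t) t)"
  from free obtain B where "B \<subseteq> int_adjoin \<alpha> \<and> (\<forall>x\<in>int_adjoin \<alpha>. \<exists>!c. ?P B x c)"
    unfolding free_over_def monogenic ..
  then have B: "B \<subseteq> int_adjoin \<alpha>" and ex1: "\<And>x. x \<in> int_adjoin \<alpha> \<Longrightarrow> \<exists>!c. ?P B x c"
    by auto
  have BL: "t \<in> L" if "t \<in> B" for t
  proof -
    from that B have "t \<in> int_adjoin \<alpha>" by blast
    then show ?thesis unfolding int_adjoin_eq by auto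
  qed
  have "B \<noteq> {}"
  proof
    assume "B = {}"
    moreover obtain c where "?P B (ipoint 1 0 0) c"
      using ex1_implies_ex[OF ex1[OF gen_in[of 1 0 0]]] ..
    ultimately have "ipoint 1 0 0 = 0" by simp
    then show False by (simp add: quad_def)
  qed
  then obtain t where t: "t \<in> B" by blast
  then obtain x y z where xyz: "t = ipoint x y z" using B by (auto simp: int_adjoin_eq)
  have inj: "h = 0" if "h \<in> ASO" "act h (ipoint x y z) = 0" for h
  proof -
    have "act h t \<in> int_adjoin \<alpha>" using that gen_in[of 0 0 0] by (simp add: xyz quad_def)
    moreover have "act h t = act 0 t" using that BL[OF t] by (simp add: act_zero xyz)
    ultimately have "(\<lambda>_. 0)(t := h) = (\<lambda>_. 0)(t := 0)"
      using free_over_unique_coefficient[OF ex1 _ _ \<open>h \<in> ASO\<close> zero_in_ASO zero_in_ASO t t] BL[OF t]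
      by (simp add: act_zero)
    then show ?thesis by (metis fun_upd_same)
  qed
  note ns = nonsingular_if_injective[OF inj]
  have "B = {t}"
  proof (rule ccontr)
    assume "B \<noteq> {t}"
    with t obtain s where s: "s \<in> B" "s \<noteq> t" by blast
    then obtain x' y' z' where s': "s = ipoint x' y' z'" using B by (auto simp: int_adjoin_eq)
    obtain h c where h: "h \<in> ASO" "c \<noteq> 0" "act h t = act (scale (of_int c) 1) s"
      using common_multiple[OF ns] unfolding s' xyz by blast
    have "act h t \<in> int_adjoin \<alpha>" using h(1) unfolding xyz in_ASO_iff by blast
    then have eq: "(\<lambda>_. 0)(t := h) = (\<lambda>_. 0)(s := scale (of_int c) 1)"
      using free_over_unique_coefficient[OF ex1 _ h(3) h(1) ASO_scale zero_in_ASO t s(1)] BL t s(1)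
      by (simp add: act_zero)
    have "scale (of_int c) 1 = (0::'h)" using fun_cong[OF eq, of s] s(2) by simp
    then have "of_rat (of_int c) * (1::complex) = 0"
      using act_scale_one[of 1 "of_int c"] L_gen(1) by (simp add: act_zero)
    then show False using h(2) by simp
  qed
  have surj: "\<exists>h\<in>ASO. act h t = u" if u: "u \<in> int_adjoin \<alpha>" for u
  proof -
    obtain c where c: "?P B u c"
      using ex1_implies_ex[OF ex1[OF u]] ..
    have "(\<Sum>t | c t \<noteq> 0. act (c t) t) = (\<Sum>t\<in>{t}. act (c t) t)"
      using c BL[OF t] unfolding \<open>B = {t}\<close>
      by (intro sum.mono_neutral_left) (auto simp: act_zero)
    then show ?thesis using c by auto
  qed
  have solve: "\<exists>i j n. i * x + j * tr_div x z + n * (2 * q * y - 2 * b * p * z) = x' \<and>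
     i * y + n * (q * z) = y' \<and> i * z + n * (r * z - p * y) = z'" for x' y' z'
    using surj[OF gen_in[of x' y' z']] unfolding xyz by (metis ASO_cases order_op_ipoint)
  obtain i n where 1: "i * y + n * (q * z) = 1" "i * z + n * (r * z - p * y) = 0" using solve by blast
  obtain i' n' where 2: "i' * y + n' * (q * z) = 0" "i' * z + n' * (r * z - p * y) = 1" using solve by blast
  have "(i * n' - n * i') * - qform y z =
      (i * y + n * (q * z)) * (i' * z + n' * (r * z - p * y))
      - (i * z + n * (r * z - p * y)) * (i' * y + n' * (q * z))"
    by (simp add: qform_def algebra_simps power2_eq_square)
  also have "\<dots> = 1" by (simp add: 1 2)
  finally have q1: "\<bar>qform y z\<bar> = 1" by (metis abs_minus_cancel zmult_eq_1_iff abs_1 mult.commute)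
  obtain i j n where 3: "i * x + j * tr_div x z + n * (2 * q * y - 2 * b * p * z) = 1"
    "i * y + n * (q * z) = 0" "i * z + n * (r * z - p * y) = 0" using solve by blast
  have "i * - qform y z = (i * y + n * (q * z)) * (r * z - p * y) - (i * z + n * (r * z - p * y)) * (q * z)"
    "n * - qform y z = (i * z + n * (r * z - p * y)) * y - (i * y + n * (q * z)) * z"
    by (simp_all add: qform_def algebra_simps power2_eq_square)
  then have "i = 0" "n = 0" using q1 by (auto simp: 3)
  with 3 have "j * tr_div x z = 1" by simp
  then have "\<bar>tr_div x z\<bar> = 1" by (metis abs_minus_cancel zmult_eq_1_iff abs_1 mult.commute)
  with q1 show "\<exists>x y z. \<bar>tr_div x z\<bar> = 1 \<and> \<bar>qform y z\<bar> = 1" by blast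
next
  assume "\<exists>x y z. \<bar>tr_div x z\<bar> = 1 \<and> \<bar>qform y z\<bar> = 1"
  then obtain x y z where xyz: "\<bar>tr_div x z\<bar> = 1" "\<bar>qform y z\<bar> = 1" by blast
  show "free_over ASO act (ring_of_integers L)"
    unfolding monogenic
  proof (rule free_over_singleton[OF gen_in[of x y z] zero_in_ASO])
    fix u assume "u \<in> int_adjoin \<alpha>"
    then obtain x' y' z' where u: "u = ipoint x' y' z'" by (auto simp: int_adjoin_eq)
    define T D where "T = tr_div x z" "D = - qform y z"
    \<comment> \<open>Both numbers are signs, so multiplying by them amounts to dividing, and the
      coefficients defined next are Cramer's solution.\<close>
    have TD: "T * T = 1" "D * D = 1" using xyz by (auto simp: T_D_def abs_if split: if_splits)
    define i where "i = D * (y' * (r * z - p * y) - z' * (q * z))"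
    define n where "n = D * (y * z' - z * y')"
    obtain h where h: "h \<in> ASO" "\<And>u v w. act h (ipoint u v w) =
        order_op i (T * (x' - (i * x + n * (2 * q * y - 2 * b * p * z)))) n u v w"
      using ASO_element[of i "T * (x' - (i * x + n * (2 * q * y - 2 * b * p * z)))" n] by blast
    have "T * (x' - (i * x + n * (2 * q * y - 2 * b * p * z))) * T =
        (T * T) * (x' - (i * x + n * (2 * q * y - 2 * b * p * z)))" by simp
    then have e1: "T * (x' - (i * x + n * (2 * q * y - 2 * b * p * z))) * T =
        x' - (i * x + n * (2 * q * y - 2 * b * p * z))" by (simp only: TD) simp
    have "i * y + n * (q * z) = D * D * y'" "i * z + n * (r * z - p * y) = D * D * z'"
      unfolding i_def n_def T_D_def(2) qform_def by (simp_all add: algebra_simps power2_eq_square)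
    then have "order_op i (T * (x' - (i * x + n * (2 * q * y - 2 * b * p * z)))) n x y z = u"
      unfolding u order_op_ipoint T_D_def(1)[symmetric] e1 TD by simp
    then have hu: "u = act h (ipoint x y z)" using h(2) by simp
    show "\<exists>!h. h \<in> ASO \<and> u = act h (ipoint x y z)"
    proof (rule ex1I[of _ h])
      fix k assume k: "k \<in> ASO \<and> u = act k (ipoint x y z)"
      obtain i j n where k': "\<And>x y z. act k (ipoint x y z) = order_op i j n x y z"
        using ASO_cases k by blast
      obtain i' j' n' where h': "\<And>x y z. act h (ipoint x y z) = order_op i' j' n' x y z"
        using ASO_cases h(1) by blast
      have "act k (ipoint x y z) = act h (ipoint x y z)" using k hu by simp
      then have eqs: "i * x + j * T + n * (2 * q * y - 2 * b * p * z) =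
          i' * x + j' * T + n' * (2 * q * y - 2 * b * p * z)"
        "i * y + n * (q * z) = i' * y + n' * (q * z)"
        "i * z + n * (r * z - p * y) = i' * z + n' * (r * z - p * y)"
        unfolding k' h' by (simp_all only: order_op_def quad_inject of_int_eq_iff T_D_def(1))
      have "(i - i') * D = ((i * y + n * (q * z)) - (i' * y + n' * (q * z))) * (r * z - p * y)
          - ((i * z + n * (r * z - p * y)) - (i' * z + n' * (r * z - p * y))) * (q * z)"
        "(n - n') * D = ((i * z + n * (r * z - p * y)) - (i' * z + n' * (r * z - p * y))) * y
          - ((i * y + n * (q * z)) - (i' * y + n' * (q * z))) * z"
        by (simp_all add: T_D_def(2) qform_def algebra_simps power2_eq_square)
      then have "(i - i') * D = 0" "(n - n') * D = 0" by (simp_all only: eqs) simp_all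
      then have "i = i'" "n = n'" using TD by auto
      moreover from this eqs(1) have "j * T = j' * T" by simp
      then have "j = j'" using TD by auto
      ultimately have agree: "act k (ipoint x y z) = act h (ipoint x y z)" for x y z
        by (simp add: k' h')
      show "k = h"
      proof (rule act_agree)
        fix v assume "v \<in> L"
        then obtain r s t where v: "v = quad r s t \<alpha>" by (rule L_cases)
        have "act k 1 = act h 1" "act k \<alpha> = act h \<alpha>" "act k (\<alpha>\<^sup>2) = act h (\<alpha>\<^sup>2)"
          using agree[of 1 0 0] agree[of 0 1 0] agree[of 0 0 1] by (simp_all add: quad_def)
        then show "act k v = act h v"
          unfolding v rat_linear_quad[OF act_linear_right] by simp
      qed
    qed (use h(1) hu in auto)
  qed (simp add: act_zero)
qed

text \<open>Since x does not enter \<open>qform\<close>, it is free to adjust the trace. For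
  \<kappa> = 1 the value 3x + 2az can be a unit exactly if it is nonzero modulo 3; for a = 3c
  division by 3 leaves x + 2cz, which takes the value 1.\<close>

lemma tr_div_unit_iff: "(\<exists>x. \<bar>tr_div x z\<bar> = 1) \<longleftrightarrow> (\<kappa> = 1 \<longrightarrow> \<not> 3 dvd z)"
proof (cases "\<kappa> = 1")
  case True
  then have eq: "tr_div x z = 3 * x + 2 * a * z" for x using tr_div[of x z] by (simp only: mult_1)
  have a: "\<not> 3 dvd a" using \<kappa> True by auto
  have "(\<exists>x. \<bar>3 * x + 2 * a * z\<bar> = 1) \<longleftrightarrow> \<not> 3 dvd 2 * a * z" by presburger
  also have "\<dots> \<longleftrightarrow> \<not> 3 dvd z" using a by (simp add: prime_dvd_mult_iff)
  finally show ?thesis unfolding eq using True by simp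
next
  case False
  then have \<kappa>3: "\<kappa> = 3" and "3 dvd a" using \<kappa> by auto
  then obtain c where "a = 3 * c" by (auto elim: dvdE)
  then have "3 * tr_div (1 - 2 * c * z) z = 3 * 1"
    using tr_div[of "1 - 2 * c * z" z] \<kappa>3 by (simp add: algebra_simps)
  then have "\<bar>tr_div (1 - 2 * c * z) z\<bar> = 1" by simp
  then show ?thesis using False by blast
qed

text \<open>Multiplying d * \<open>qform u y\<close> by 12a gives (6au - 9by)^2 + 3\<Delta> y^2. The
  divisibility condition returns u from x, and it is allowed for x or -x because only x^2 enters the
  equation.\<close>

lemma free_iff_norm_equation:
  defines "\<Delta> \<equiv> 4 * a ^ 3 - 27 * b\<^sup>2"
  shows "free_over ASO act (ring_of_integers L) \<longleftrightarrow>
    (\<exists>x y. (x\<^sup>2 + 3 * \<Delta> * y\<^sup>2 = 12 * a * d \<or> x\<^sup>2 + 3 * \<Delta> * y\<^sup>2 = - (12 * a * d)) \<and>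
       (6 * a dvd 9 * b * y + x \<or> 6 * a dvd 9 * b * y - x) \<and> (\<kappa> = 1 \<longrightarrow> \<not> 3 dvd y))"
    (is "_ \<longleftrightarrow> ?rhs")
proof -
  have "free_over ASO act (ring_of_integers L) \<longleftrightarrow>
      (\<exists>y z. (\<exists>x. \<bar>tr_div x z\<bar> = 1) \<and> \<bar>qform y z\<bar> = 1)"
    unfolding free_iff by blast
  also have "\<dots> \<longleftrightarrow> (\<exists>y z. (\<kappa> = 1 \<longrightarrow> \<not> 3 dvd z) \<and> \<bar>qform y z\<bar> = 1)"
    by (simp only: tr_div_unit_iff)
  also have "\<dots> \<longleftrightarrow> ?rhs"
  proof (cases "a = 0")
    \<comment> \<open>For a = 0 the multiplication by 12a loses all information, but both sides
      hold: x = y = 0 solves the equation, and \<open>qform 1 1\<close> is -r, a unit because d is a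
      multiple of 9b.\<close>
    case True
    then have "p = 0" "q = 0" using p q d_pos by auto
    obtain z where "d = 9 * b * z" using bezout True by auto
    then have "d * 1 = d * (r * z)" by (simp add: r)
    then have "r * z = 1" using d_pos by simp
    then have "\<bar>r\<bar> = 1" by (intro abs_zmult_eq_1[of r z]) simp
    moreover have "qform 1 1 = p - r + q" by (simp add: qform_def)
    ultimately have "\<bar>qform 1 1\<bar> = 1" using \<open>p = 0\<close> \<open>q = 0\<close> by simp
    moreover have "\<kappa> \<noteq> 1" using \<kappa> True by auto
    moreover have ?rhs using \<open>\<kappa> \<noteq> 1\<close> True by (intro exI[of _ 0]) auto
    ultimately show ?thesis by blast
  next
    case False
    have sq: "(6 * a * u - 9 * b * y)\<^sup>2 + 3 * \<Delta> * y\<^sup>2 = 12 * a * d * qform u y" for u y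
    proof -
      have "(6 * a * u - 9 * b * y)\<^sup>2 + 3 * \<Delta> * y\<^sup>2 =
          12 * a * (3 * a * u\<^sup>2 - 9 * b * u * y + a\<^sup>2 * y\<^sup>2)"
        by (simp add: \<Delta>_def algebra_simps power2_eq_square power3_eq_cube)
      then show ?thesis unfolding qform by (simp only: mult.assoc)
    qed
    have unit: "12 * a * d * k = 12 * a * d \<or> 12 * a * d * k = - (12 * a * d) \<longleftrightarrow> \<bar>k\<bar> = 1" for k
    proof -
      have "12 * a * d * k = - (12 * a * d) \<longleftrightarrow> 12 * a * d * k = 12 * a * d * (- 1)" by simp
      also have "\<dots> \<longleftrightarrow> k = - 1" using False d_pos by (subst mult_cancel_left) auto
      finally show ?thesis using False d_pos by auto
    qed
    show ?thesis
    proof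
      assume "\<exists>y z. (\<kappa> = 1 \<longrightarrow> \<not> 3 dvd z) \<and> \<bar>qform y z\<bar> = 1"
      then obtain u y where uy: "\<kappa> = 1 \<longrightarrow> \<not> 3 dvd y" "\<bar>qform u y\<bar> = 1" by blast
      show ?rhs
        by (rule exI[of _ "6 * a * u - 9 * b * y"], rule exI[of _ y]) (simp only: sq unit, use uy in simp)
    next
      assume ?rhs
      then obtain x y where xy: "x\<^sup>2 + 3 * \<Delta> * y\<^sup>2 = 12 * a * d \<or> x\<^sup>2 + 3 * \<Delta> * y\<^sup>2 = - (12 * a * d)"
        "6 * a dvd 9 * b * y + x \<or> 6 * a dvd 9 * b * y - x" "\<kappa> = 1 \<longrightarrow> \<not> 3 dvd y" by blast
      from xy(2) obtain u where "9 * b * y + x = 6 * a * u \<or> 9 * b * y - x = 6 * a * u" by (auto elim!: dvdE)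
      then have "x = 6 * a * u - 9 * b * y \<or> - x = 6 * a * u - 9 * b * y" by linarith
      then have x: "x\<^sup>2 = (6 * a * u - 9 * b * y)\<^sup>2" by (metis power2_minus)
      have "\<bar>qform u y\<bar> = 1" using xy(1) unfolding x sq unit .
      with xy(3) show "\<exists>y z. (\<kappa> = 1 \<longrightarrow> \<not> 3 dvd z) \<and> \<bar>qform y z\<bar> = 1" by blast
    qed
  qed
  finally show ?thesis .
qed

end

section \<open>Valuations, and the value of d in the three regimes\<close>

lemma le_vp_iff: "prime p \<Longrightarrow> enat n \<le> vp p x \<longleftrightarrow> p ^ n dvd x"
  by (auto simp: vp_def power_dvd_iff_le_multiplicity)

lemma vp_iff:
  assumes "prime p"
  shows "vp p x = 0 \<longleftrightarrow> \<not> p dvd x" "vp p x \<ge> 1 \<longleftrightarrow> p dvd x"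
    "vp p x = 1 \<longleftrightarrow> p dvd x \<and> \<not> p\<^sup>2 dvd x" "vp p x \<le> 1 \<longleftrightarrow> \<not> p\<^sup>2 dvd x"
proof -
  have 1: "enat 1 \<le> vp p x \<longleftrightarrow> p dvd x" and 2: "enat 2 \<le> vp p x \<longleftrightarrow> p\<^sup>2 dvd x"
    using le_vp_iff[OF assms, of 1 x] le_vp_iff[OF assms, of 2 x] by simp_all
  show "vp p x = 0 \<longleftrightarrow> \<not> p dvd x" "vp p x \<ge> 1 \<longleftrightarrow> p dvd x"
    "vp p x = 1 \<longleftrightarrow> p dvd x \<and> \<not> p\<^sup>2 dvd x" "vp p x \<le> 1 \<longleftrightarrow> \<not> p\<^sup>2 dvd x"
    unfolding 1[symmetric] 2[symmetric]
    by (cases "vp p x"; force simp: one_enat_def zero_enat_def)+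
qed

lemma gcd_3a_a2:
  fixes a :: int
  shows "gcd (3 * a) (a\<^sup>2) = \<bar>a\<bar> * gcd 3 a"
  using gcd_mult_distrib_int[of a 3 a] by (simp add: power2_eq_square mult.commute)

lemma coprime_3_iff: "coprime 3 (x::int) \<longleftrightarrow> \<not> 3 dvd x"
  using prime_imp_coprime[of 3 x] by (auto dest: coprime_common_divisor)

text \<open>The factors 3 and 9 are units modulo a, so d = g and 12ad = 12ag.\<close>

lemma gcd_lattice_not_3_dvd:
  assumes "\<not> 3 dvd (a::int)"
  shows "gcd (gcd (3 * a) (a\<^sup>2)) (9 * b) = gcd a b"
proof -
  have c: "coprime 3 a" using assms by (simp add: coprime_3_iff)
  then have "coprime (3 ^ 2) a" by (rule coprime_power_left_iff[THEN iffD2, OF disjI1])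
  then have "coprime a 9" by (simp add: coprime_commute)
  then have "gcd a (9 * b) = gcd a b" by (rule gcd_mult_right_left_cancel)
  moreover have "gcd 3 a = 1" using c by simp
  ultimately show ?thesis by (simp add: gcd_3a_a2)
qed

lemma gcd_lattice_3_dvd:
  assumes "3 dvd (a::int)"
  shows "gcd (gcd (3 * a) (a\<^sup>2)) (9 * b) = 3 * gcd a (3 * b)"
proof -
  have "gcd 3 a = 3" using assms by simp
  then have "gcd (gcd (3 * a) (a\<^sup>2)) (9 * b) = gcd (3 * a) (3 * (3 * b))"
    using gcd_abs1_int[of "3 * a" "9 * b"] by (simp add: gcd_3a_a2 mult.commute[of "\<bar>a\<bar>"] abs_mult)
  then show ?thesis by (simp only: gcd_mult_distrib_int[symmetric] abs_numeral)
qed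

lemma gcd_mult_3_cancel: "\<not> 3 dvd (x::int) \<Longrightarrow> gcd x (3 * y) = gcd x y"
  using coprime_3_iff[of x] by (simp add: gcd_mult_right_left_cancel coprime_commute)

text \<open>The cofactor a/3 is prime to 3, so the extra 3 is invisible; with
  \<open>gcd_lattice_3_dvd\<close> this gives d = 3g and 12ad = 36ag.\<close>

lemma gcd_times_3_vp_1:
  assumes "3 dvd (a::int)" "\<not> 9 dvd a" "3 dvd b"
  shows "gcd a (3 * b) = gcd a b"
proof -
  obtain c e where ce: "a = 3 * c" "b = 3 * e" using assms by (auto elim!: dvdE)
  then have "\<not> 3 dvd c" using assms(2) by auto
  then have "gcd c (3 * e) = gcd c e" by (rule gcd_mult_3_cancel)
  then have "3 * gcd c (3 * e) = 3 * gcd c e" by simp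
  moreover have "gcd (3 * c) (3 * (3 * e)) = 3 * gcd c (3 * e)" "gcd (3 * c) (3 * e) = 3 * gcd c e"
    by (simp_all only: gcd_mult_distrib_int[symmetric] abs_numeral)
  ultimately show ?thesis unfolding ce by (simp only:)
qed

text \<open>After division by the power of 3 in b, a still has a factor 3, which meets the extra 3
  while the rest of b is prime to 3. With \<open>gcd_lattice_3_dvd\<close> this gives d = 9g and
  12ad = 108ag.\<close>

lemma gcd_times_3_vp_less:
  assumes "vp 3 b < vp 3 a"
  shows "gcd a (3 * b) = 3 * gcd a b"
proof -
  have "b \<noteq> 0" using assms by (auto simp: vp_def)
  define k where "k = multiplicity 3 b"
  obtain e where e: "b = 3 ^ k * e" "\<not> 3 dvd e"
    using \<open>b \<noteq> 0\<close> unfolding k_def by (rule multiplicity_decompose') auto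
  have "enat (Suc k) \<le> vp 3 a" using assms \<open>b \<noteq> 0\<close> by (cases "vp 3 a") (auto simp: vp_def k_def)
  then have "3 ^ Suc k dvd a" by (subst (asm) le_vp_iff) auto
  then obtain c where c: "a = 3 ^ k * (3 * c)" by (auto elim: dvdE)
  have "gcd e (3 * c) = gcd e c" using e(2) by (rule gcd_mult_3_cancel)
  then have "gcd (3 * c) e = gcd c e" by (simp add: gcd.commute)
  then have "gcd a b = 3 ^ k * gcd c e"
    unfolding c e(1) by (simp add: gcd_mult_distrib_int[symmetric])
  moreover have "gcd a (3 * b) = 3 ^ k * 3 * gcd c e"
  proof -
    have "a = 3 ^ k * 3 * c" "3 * b = 3 ^ k * 3 * e" by (simp_all add: c e)
    then show ?thesis by (simp only: gcd_mult_distrib_int[symmetric]) simp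
  qed
  ultimately show ?thesis by simp
qed

lemma (in hopf_galois_cubic) monogenic_lattice:
  assumes "ring_of_integers L = int_adjoin \<alpha>"
    and d: "d = gcd (gcd (3 * a) (a\<^sup>2)) (9 * b)"
    and \<kappa>: "\<kappa> = 1 \<and> \<not> 3 dvd a \<or> \<kappa> = 3 \<and> 3 dvd a"
  shows "monogenic_hopf_galois_cubic a b \<alpha> scale comult counit antipode act d \<kappa>
    (3 * a div d) (a\<^sup>2 div d) (9 * b div d)"
proof unfold_locales
  show "d \<noteq> 0" using disc_nonzero by (auto simp: d)
  have "d dvd gcd (3 * a) (a\<^sup>2)" "d dvd 9 * b" unfolding d by (rule gcd_dvd1 gcd_dvd2)+
  then have "d dvd 3 * a" "d dvd a\<^sup>2" "d dvd 9 * b" by (meson dvd_trans gcd_dvd1 gcd_dvd2)+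
  then show "3 * a = 3 * a div d * d" "a\<^sup>2 = a\<^sup>2 div d * d" "9 * b = 9 * b div d * d" by simp_all
  obtain u v where uv: "u * (3 * a) + v * a\<^sup>2 = gcd (3 * a) (a\<^sup>2)" using bezout_int by blast
  obtain u' v' where uv': "u' * gcd (3 * a) (a\<^sup>2) + v' * (9 * b) = d" unfolding d using bezout_int by blast
  have "d = 3 * a * (u' * u) + a\<^sup>2 * (u' * v) + 9 * b * v'"
    unfolding uv'[symmetric] uv[symmetric] by (simp add: algebra_simps)
  then show "\<exists>x y z. d = 3 * a * x + a\<^sup>2 * y + 9 * b * z" by blast
qed (use assms in auto)

subsection \<open>Singular points modulo primes\<close>

lemma algebraic_int_of_int [simp]: "algebraic_int (of_int k :: complex)"
  by (rule int_imp_algebraic_int) simp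

lemma algebraic_int_of_rat: "algebraic_int (of_rat q :: complex) \<Longrightarrow> q \<in> \<int>"
  using rational_algebraic_int_is_int[of "of_rat q :: complex"] by (auto elim!: Ints_cases) 
    (metis of_rat_eq_iff of_rat_of_int_eq Ints_of_int)

lemma rat_Ints_dvd:
  assumes "(of_int i / of_int p :: rat) \<in> \<int>" "p \<noteq> 0"
  shows "p dvd i"
proof -
  obtain k where "(of_int i / of_int p :: rat) = of_int k" using assms(1) by (auto elim: Ints_cases)
  then have "(of_int i :: rat) = of_int (p * k)" using \<open>p \<noteq> 0\<close> by (simp add: field_simps)
  then show "p dvd i" by (simp only: of_int_eq_iff) simp
qed

lemma algebraic_int_of_int_divide:
  assumes "algebraic_int (of_int i / of_int p :: complex)" "p \<noteq> 0"
  shows "p dvd i"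
proof -
  have "algebraic_int (of_rat (of_int i / of_int p) :: complex)" using assms(1) by (simp add: of_rat_divide)
  then show ?thesis by (intro rat_Ints_dvd assms(2) algebraic_int_of_rat)
qed

text \<open>The exponent of p in a nonzero square is even, so an exponent of at least 3 is at least
  4.\<close>

lemma prime_cube_dvd_square:
  fixes p x :: int
  assumes "prime p" "p ^ 3 dvd x\<^sup>2"
  shows "p\<^sup>2 dvd x"
proof (cases "x = 0")
  case False
  have "3 \<le> multiplicity p (x\<^sup>2)"
    using assms False by (subst (asm) power_dvd_iff_le_multiplicity) auto
  also have "multiplicity p (x\<^sup>2) = 2 * multiplicity p x"
    using prime_elem_multiplicity_power_distrib[OF prime_imp_prime_elem[OF assms(1)] False] .
  finally have "2 \<le> multiplicity p x" by simp
  then show ?thesis by (rule multiplicity_dvd')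
qed simp

lemma prime_inverse_mod:
  fixes p c :: int
  assumes "prime p" "\<not> p dvd c"
  obtains u m where "u * c = 1 + p * m"
proof -
  have "coprime p c" using assms by (simp add: prime_imp_coprime)
  then obtain m u where "m * p + u * c = 1" using bezout_int[of p c] by auto
  then have "u * c = 1 + p * (- m)" by (simp add: algebra_simps)
  then show ?thesis by (rule that)
qed

lemma rat_common_denominator:
  obtains n :: int where "n > 0" "of_int n * (r::rat) \<in> \<int>" "of_int n * (s::rat) \<in> \<int>" "of_int n * (t::rat) \<in> \<int>"
proof -
  have "\<exists>d>0. of_int d * q \<in> \<int>" for q :: rat
  proof (cases q)
    case (Fract i d)
    then have "of_int d * q = of_int i" by (simp add: Fract_of_int_quotient)
    then show ?thesis using Fract by (intro exI[of _ d]) simp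
  qed
  then obtain d where d: "\<And>q :: rat. d q > 0 \<and> of_int (d q) * q \<in> \<int>" by metis
  have "of_int (d r * d s * d t) * r = of_int (d s * d t) * (of_int (d r) * r)"
    "of_int (d r * d s * d t) * s = of_int (d r * d t) * (of_int (d s) * s)"
    "of_int (d r * d s * d t) * t = of_int (d r * d s) * (of_int (d t) * t)" by simp_all
  then have "of_int (d r * d s * d t) * r \<in> \<int>" "of_int (d r * d s * d t) * s \<in> \<int>"
    "of_int (d r * d s * d t) * t \<in> \<int>"
    using d by (simp_all only: Ints_mult Ints_of_int)
  moreover have "d r * d s * d t > 0" using d by simp
  ultimately show ?thesis by (rule that[rotated])
qed

text \<open>Expanding f at s, this says for prime p that f lies in the square of the ideal (p, x -
  s), so that Z[\<alpha>] is not regular at the corresponding maximal ideal.\<close>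

definition singular_mod :: "int \<Rightarrow> int \<Rightarrow> int \<Rightarrow> int \<Rightarrow> bool" where
  "singular_mod a b p s \<longleftrightarrow> p dvd 3 * s\<^sup>2 - a \<and> p\<^sup>2 dvd s ^ 3 - a * s + b"

context cubic_field
begin

lemma emb_of_int: "emb n (of_int k) = of_int k"
  using emb_of_rat[of n "of_int k"] by simp

lemma of_int_in_L: "of_int k \<in> L"
  using L_of_rat[of "of_int k"] by simp

lemma poly_in_L: "x \<in> L \<Longrightarrow> poly (map_poly of_int p) x \<in> L"
  by (induction p) (use of_int_in_L[of 0] in
      \<open>auto simp: of_int_hom.map_poly_pCons_hom intro!: L_add L_mult of_int_in_L\<close>)

lemma emb_poly:
  "x \<in> L \<Longrightarrow> n < 3 \<Longrightarrow> emb n (poly (map_poly of_int p) x) = poly (map_poly of_int p) (emb n x)"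
  by (induction p) (use emb_of_int[of n 0] in
      \<open>auto simp: of_int_hom.map_poly_pCons_hom emb_add emb_mult emb_of_int L_mult of_int_in_L poly_in_L\<close>)

lemma algebraic_int_emb:
  assumes "x \<in> L" "algebraic_int x" "n < 3"
  shows "algebraic_int (emb n x)"
proof -
  obtain p where "poly (map_poly of_int p) x = 0" "lead_coeff p = 1"
    using assms(2) by (auto simp: algebraic_int_altdef_ipoly)
  then show ?thesis
    using emb_poly[OF assms(1,3), of p] emb_of_int[of n 0] by (auto simp: algebraic_int_altdef_ipoly)
qed

lemma algebraic_int_gen: "algebraic_int \<alpha>"
proof -
  have "poly (map_poly of_int [:b, - a, 0, 1:]) \<alpha> = 0"
    using root by (simp add: of_int_hom.map_poly_pCons_hom algebra_simps power3_eq_cube)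
  then show ?thesis unfolding algebraic_int_altdef_ipoly by (intro exI[of _ "[:b, - a, 0, 1:]"]) simp
qed

lemma int_adjoin_subset: "int_adjoin \<alpha> \<subseteq> ring_of_integers L"
proof -
  have "algebraic_int (of_int i + of_int j * \<alpha> + of_int k * (\<alpha> * \<alpha>))" for i j k
    by (intro algebraic_int_add algebraic_int_mult algebraic_int_gen algebraic_int_of_int)
  then have "algebraic_int (quad (of_int i) (of_int j) (of_int k) \<alpha>)" for i j k
    by (simp add: quad_def power2_eq_square)
  then show ?thesis unfolding int_adjoin_eq ring_of_integers_def by auto
qed

lemma conjugate_products:
  "(rt 0 - s) * (rt 1 - s) * (rt 2 - s) = - (s ^ 3 - of_int a * s + of_int b)"
  "(rt 0 - s) * (rt 1 - s) + (rt 0 - s) * (rt 2 - s) + (rt 1 - s) * (rt 2 - s) = 3 * s\<^sup>2 - of_int a"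
proof -
  have s: "\<alpha> = - (rt 1 + rt 2)" unfolding rt_12(1) by simp
  have "(rt 0 - s) * (rt 1 - s) * (rt 2 - s) =
     rt 0 * rt 1 * rt 2 - s * (\<alpha> * (rt 1 + rt 2) + rt 1 * rt 2) + s\<^sup>2 * (\<alpha> + (rt 1 + rt 2)) - s ^ 3"
    by (simp add: algebra_simps power2_eq_square power3_eq_cube)
  also have "\<dots> = - (s ^ 3 - of_int a * s + of_int b)"
    unfolding rt_prod rt_12 by (simp add: algebra_simps power2_eq_square)
  finally show "(rt 0 - s) * (rt 1 - s) * (rt 2 - s) = - (s ^ 3 - of_int a * s + of_int b)" .
  have "(rt 0 - s) * (rt 1 - s) + (rt 0 - s) * (rt 2 - s) + (rt 1 - s) * (rt 2 - s) =
     \<alpha> * (rt 1 + rt 2) + rt 1 * rt 2 - 2 * s * (\<alpha> + (rt 1 + rt 2)) + 3 * s\<^sup>2"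
    by (simp add: algebra_simps power2_eq_square)
  also have "\<dots> = 3 * s\<^sup>2 - of_int a"
    unfolding rt_12 by (simp add: algebra_simps power2_eq_square)
  finally show "(rt 0 - s) * (rt 1 - s) + (rt 0 - s) * (rt 2 - s) + (rt 1 - s) * (rt 2 - s) =
    3 * s\<^sup>2 - of_int a" .
qed

definition int_over :: "int \<Rightarrow> int \<Rightarrow> int \<Rightarrow> int \<Rightarrow> bool" where
  "int_over p i j k \<longleftrightarrow> algebraic_int (quad (of_int i / of_int p) (of_int j / of_int p) (of_int k / of_int p) \<alpha>)"

lemma algebraic_int_quad: "algebraic_int (quad (of_int i) (of_int j) (of_int k) \<alpha>)"
  using int_adjoin_subset unfolding int_adjoin_eq ring_of_integers_def by blast

lemma int_over_add: "int_over p i j k \<Longrightarrow> int_over p i' j' k' \<Longrightarrow> int_over p (i + i') (j + j') (k + k')"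
  unfolding int_over_def by (drule (1) algebraic_int_add) (simp add: quad_add add_divide_distrib)

lemma int_over_scale:
  assumes "int_over p i j k"
  shows "int_over p (c * i) (c * j) (c * k)"
proof -
  have "algebraic_int (of_rat (of_int c) * quad (of_int i / of_int p) (of_int j / of_int p) (of_int k / of_int p) \<alpha>)"
    using assms unfolding int_over_def by (intro algebraic_int_mult) simp_all
  then show ?thesis by (simp only: quad_scale int_over_def) simp
qed

lemma int_over_multiple: "p \<noteq> 0 \<Longrightarrow> int_over p (p * i) (p * j) (p * k)"
  using algebraic_int_quad[of i j k] by (simp add: int_over_def)

lemma int_over_shift:
  assumes "int_over p i j k" "p \<noteq> 0"
  shows "int_over p (i + p * i') (j + p * j') (k + p * k')"
  by (intro int_over_add int_over_multiple assms)

lemma int_over_gen: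
  assumes "int_over p i j k"
  shows "int_over p (- b * k) (i + a * k) j"
proof -
  have "algebraic_int (quad 0 1 0 \<alpha> * quad (of_int i / of_int p) (of_int j / of_int p) (of_int k / of_int p) \<alpha>)"
    using assms algebraic_int_gen unfolding int_over_def
    by (intro algebraic_int_mult) (auto simp: quad_def)
  then show ?thesis unfolding quad_mult int_over_def by (simp add: add_divide_distrib)
qed

lemma int_over_rational: "int_over p i 0 0 \<Longrightarrow> p \<noteq> 0 \<Longrightarrow> p dvd i"
  unfolding int_over_def by (intro rat_Ints_dvd algebraic_int_of_rat) (simp_all add: quad_def)

text \<open>For s = -m the norm of (\<alpha> - s)/p is -f(s)/p^3, and the second elementary
  symmetric function of its conjugates is f'(s)/p^2; both must be integers.\<close>

lemma singular_if_linear: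
  assumes p: "p \<noteq> 0" and J: "int_over p m 1 0"
  shows "singular_mod a b p (- m)"
proof -
  define s :: complex where "s = - of_int m"
  define x where "x = quad (of_int m / of_int p) (of_int 1 / of_int p) (of_int 0 / of_int p) \<alpha>"
  define P where "P = (of_int p :: complex)"
  have P: "P \<noteq> 0" using p by (simp add: P_def)
  have x: "algebraic_int x" "x \<in> L" using J by (simp_all add: int_over_def x_def)
  have e: "emb n x = (rt n - s) / P" for n
    unfolding x_def emb_quad by (simp add: quad_def s_def P_def of_rat_divide add_divide_distrib)
  have ai: "algebraic_int ((rt n - s) / P)" if "n < 3" for n
    using algebraic_int_emb[OF x(2,1) that] by (simp add: e)
  have "algebraic_int ((rt 0 - s) / P * ((rt 1 - s) / P) * ((rt 2 - s) / P))"
    by (intro algebraic_int_mult ai) auto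
  also have "(rt 0 - s) / P * ((rt 1 - s) / P) * ((rt 2 - s) / P) =
      (rt 0 - s) * (rt 1 - s) * (rt 2 - s) / P ^ 3"
    by (simp add: power3_eq_cube)
  also have "\<dots> = of_int (- ((- m) ^ 3 - a * (- m) + b)) / of_int (p ^ 3)"
    unfolding conjugate_products by (simp add: s_def P_def)
  finally have "p ^ 3 dvd - ((- m) ^ 3 - a * (- m) + b)"
    by (rule algebraic_int_of_int_divide) (use p in simp)
  then have "p ^ 3 dvd (- m) ^ 3 - a * (- m) + b" by (simp only: dvd_minus_iff)
  moreover have "p\<^sup>2 dvd p ^ 3" by (rule le_imp_power_dvd) simp
  ultimately have 1: "p\<^sup>2 dvd (- m) ^ 3 - a * (- m) + b" by (rule dvd_trans[rotated])
  have "algebraic_int ((rt 0 - s) / P * ((rt 1 - s) / P) + (rt 0 - s) / P * ((rt 2 - s) / P)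
      + (rt 1 - s) / P * ((rt 2 - s) / P))"
    by (intro algebraic_int_add algebraic_int_mult ai) auto
  also have "(rt 0 - s) / P * ((rt 1 - s) / P) + (rt 0 - s) / P * ((rt 2 - s) / P)
      + (rt 1 - s) / P * ((rt 2 - s) / P)
    = ((rt 0 - s) * (rt 1 - s) + (rt 0 - s) * (rt 2 - s) + (rt 1 - s) * (rt 2 - s)) / P\<^sup>2"
    by (simp add: power2_eq_square add_divide_distrib)
  also have "\<dots> = of_int (3 * (- m)\<^sup>2 - a) / of_int (p\<^sup>2)"
    unfolding conjugate_products by (simp add: s_def P_def)
  finally have "p\<^sup>2 dvd 3 * (- m)\<^sup>2 - a"
    by (rule algebraic_int_of_int_divide) (use p in simp)
  then have "p dvd 3 * (- m)\<^sup>2 - a" by (rule dvd_trans[rotated]) simp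
  with 1 show ?thesis by (simp add: singular_mod_def)
qed

lemma gen_diff_nonzero: "n < 3 \<Longrightarrow> rt n - of_int s \<noteq> 0"
proof
  assume n: "n < 3" and "rt n - of_int s = 0"
  then have "emb n (quad (- of_int s) 1 0 \<alpha>) = 0" unfolding emb_quad by (simp add: quad_def of_rat_minus)
  then have "quad (- of_int s) 1 0 \<alpha> = 0" using emb_eq_0_iff[OF quad_in_L n] by simp
  then show False using quad_eq_0 by fastforce
qed

lemma conjugate_factorization:
  "n < 3 \<Longrightarrow> ((rt n)\<^sup>2 + s * rt n + (s\<^sup>2 - of_int a)) * (rt n - s) = - (s ^ 3 - of_int a * s + of_int b)"
proof -
  assume n: "n < 3"
  have "((rt n)\<^sup>2 + s * rt n + (s\<^sup>2 - of_int a)) * (rt n - s) =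
      (rt n ^ 3 - of_int a * rt n + of_int b) - (s ^ 3 - of_int a * s + of_int b)"
    by (simp add: algebra_simps power2_eq_square power3_eq_cube)
  then show ?thesis by (simp add: rt_root[OF n])
qed

text \<open>The element in question is (\<alpha>^2 + s\<alpha> + s^2 - a)/p = -f(s) / (p (\<alpha> -
  s)). Its norm f(s)^2/p^3 and trace f'(s)/p give one direction. Conversely, with B = f'(s)/p and C
  = f(s)/p^2, it is a root of X^3 - B X^2 + 3sC X - p C^2.\<close>

lemma singular_iff_quadratic:
  assumes p: "prime p"
  shows "singular_mod a b p s \<longleftrightarrow> int_over p (s\<^sup>2 - a) s 1"
proof
  define S F P where "S = (of_int s :: complex)" "F = (of_int (s ^ 3 - a * s + b) :: complex)"
    "P = (of_int p :: complex)"
  define x where "x = quad (of_int (s\<^sup>2 - a) / of_int p) (of_int s / of_int p) (of_int 1 / of_int p) \<alpha>"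
  have p0: "p \<noteq> 0" "P \<noteq> 0" using p by (auto simp: S_F_P_def)
  have e: "emb n x = ((rt n)\<^sup>2 + S * rt n + (S\<^sup>2 - of_int a)) / P" for n
    unfolding x_def emb_quad
    by (simp add: quad_def S_F_P_def of_rat_divide of_rat_diff of_rat_power add_divide_distrib diff_divide_distrib)
  have xL: "x \<in> L" by (simp add: x_def)
  {
    assume "int_over p (s\<^sup>2 - a) s 1"
    then have x: "algebraic_int x" by (simp add: int_over_def x_def)
    have nz: "rt n - S \<noteq> 0" if "n < 3" for n using gen_diff_nonzero[OF that] by (simp add: S_F_P_def)
    have e': "emb n x = - F / (P * (rt n - S))" if "n < 3" for n
    proof -
      have "((rt n)\<^sup>2 + S * rt n + (S\<^sup>2 - of_int a)) * (rt n - S) = - F"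
        unfolding conjugate_factorization[OF that] by (simp add: S_F_P_def)
      then show ?thesis unfolding e by (metis nz[OF that] nonzero_mult_divide_mult_cancel_right)
    qed
    have ai: "algebraic_int (emb n x)" if "n < 3" for n
      by (rule algebraic_int_emb[OF xL x that])
    have l: "(0::nat) < 3" "(1::nat) < 3" "(2::nat) < 3" by simp_all
    have prod: "(rt 0 - S) * (rt 1 - S) * (rt 2 - S) = - F"
      unfolding conjugate_products by (simp add: S_F_P_def)
    have "algebraic_int (emb 0 x * emb 1 x * emb 2 x)"
      by (intro algebraic_int_mult ai) auto
    also have "emb 0 x * emb 1 x * emb 2 x = - (F ^ 3) / (P ^ 3 * ((rt 0 - S) * (rt 1 - S) * (rt 2 - S)))"
      unfolding e'[OF l(1)] e'[OF l(2)] e'[OF l(3)]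
      by (simp add: power3_eq_cube mult_ac)
    also note prod
    also have "- (F ^ 3) / (P ^ 3 * - F) = F\<^sup>2 / P ^ 3"
    proof -
      have "F \<noteq> 0"
        using prod nz[OF l(1)] nz[OF l(2)] nz[OF l(3)] by (metis minus_zero no_zero_divisors)
      then show ?thesis by (simp add: power3_eq_cube power2_eq_square)
    qed
    also have "\<dots> = of_int ((s ^ 3 - a * s + b)\<^sup>2) / of_int (p ^ 3)" by (simp add: S_F_P_def)
    finally have "p ^ 3 dvd (s ^ 3 - a * s + b)\<^sup>2"
      by (rule algebraic_int_of_int_divide) (use p0 in simp)
    then have 1: "p\<^sup>2 dvd s ^ 3 - a * s + b" by (rule prime_cube_dvd_square[OF p])
    have "algebraic_int (emb 0 x + emb 1 x + emb 2 x)"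
      by (intro algebraic_int_add ai) auto
    also have "emb 0 x + emb 1 x + emb 2 x =
        of_rat (tr (of_int (s\<^sup>2 - a) / of_int p) (of_int 1 / of_int p))"
      unfolding x_def emb_quad by (rule conjugates_sum)
    also have "tr (of_int (s\<^sup>2 - a) / of_int p) (of_int 1 / of_int p) = of_int (3 * s\<^sup>2 - a) / of_int p"
      using p0 by (simp add: tr_def field_simps)
    finally have "p dvd 3 * s\<^sup>2 - a" by (intro rat_Ints_dvd p0 algebraic_int_of_rat)
    with 1 show "singular_mod a b p s" by (simp add: singular_mod_def)
  }
  assume "singular_mod a b p s"
  then obtain B C where B: "3 * s\<^sup>2 - a = p * B" and C: "s ^ 3 - a * s + b = p\<^sup>2 * C"
    by (auto simp: singular_mod_def elim!: dvdE)
  \<comment> \<open>Expansion at s: eliminating y between the expression for x p as a quadratic in y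
    and the value of x y yields the monic equation for x.\<close>
  define y where "y = \<alpha> - S"
  have xp: "x * P = y\<^sup>2 + 3 * S * y + P * of_int B"
  proof -
    have "x = (\<alpha>\<^sup>2 + S * \<alpha> + (S\<^sup>2 - of_int a)) / P" using e[of 0] emb_0[OF xL] by simp
    then have 1: "x * P = \<alpha>\<^sup>2 + S * \<alpha> + (S\<^sup>2 - of_int a)" using p0 by simp
    have 2: "P * of_int B = 3 * S\<^sup>2 - of_int a"
      using arg_cong[OF B, of "of_int :: int \<Rightarrow> complex"] by (simp add: S_F_P_def)
    show ?thesis unfolding 1 2 y_def by (simp add: algebra_simps power2_eq_square)
  qed
  have "x * P * y = - F"
    using conjugate_factorization[of 0 S] e[of 0] emb_0[OF xL] p0 by (simp add: y_def S_F_P_def)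
  moreover have "F = P * (P * of_int C)"
    unfolding S_F_P_def C by (simp add: power2_eq_square)
  ultimately have "P * (x * y) = P * (- (P * of_int C))" by (simp add: mult_ac)
  then have xy: "x * y = - (P * of_int C)" by (simp only: mult_left_cancel[OF p0(2)])
  have "P * x ^ 3 = x\<^sup>2 * (x * P)" by (simp add: power2_eq_square power3_eq_cube)
  also have "\<dots> = (x * y)\<^sup>2 + 3 * S * x * (x * y) + P * of_int B * x\<^sup>2"
    unfolding xp by (simp add: algebra_simps power2_eq_square)
  also have "\<dots> = P * (P * of_int C ^ 2 - 3 * S * of_int C * x + of_int B * x\<^sup>2)"
    unfolding xy by (simp add: algebra_simps power2_eq_square)
  finally have "x ^ 3 = P * of_int C ^ 2 - 3 * S * of_int C * x + of_int B * x\<^sup>2"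
    using p0 by simp
  then have "poly (map_poly of_int [:- (p * C\<^sup>2), 3 * s * C, - B, 1:]) x = 0"
    by (simp add: of_int_hom.map_poly_pCons_hom S_F_P_def algebra_simps power2_eq_square power3_eq_cube)
  then have "algebraic_int x"
    unfolding algebraic_int_altdef_ipoly by (intro exI[of _ "[:- (p * C\<^sup>2), 3 * s * C, - B, 1:]"]) simp
  then show "int_over p (s\<^sup>2 - a) s 1" by (simp add: int_over_def x_def)
qed

text \<open>If p divided j, then i/p would be an integral rational number; so j is invertible modulo
  p and can be normalised to 1.\<close>

lemma singular_if_not_maximal_linear:
  assumes p: "prime p" and J: "int_over p i j 0" and nd: "\<not> (p dvd i \<and> p dvd j)"
  shows "\<exists>s. singular_mod a b p s"
proof -
  have p0: "p \<noteq> 0" using p by auto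
  have "\<not> p dvd j"
  proof
    assume "p dvd j"
    then obtain m where "j = p * m" by (auto elim: dvdE)
    then have "int_over p i 0 0" using int_over_shift[OF J p0, of 0 "- m" 0] by simp
    then have "p dvd i" using p0 by (rule int_over_rational)
    with nd \<open>p dvd j\<close> show False by simp
  qed
  then obtain u m where "u * j = 1 + p * m" using prime_inverse_mod[OF p] by blast
  then have "int_over p (u * i) 1 0"
    using int_over_shift[OF int_over_scale[OF J, of u] p0, of 0 "- m" 0] by simp
  then show ?thesis using singular_if_linear[OF p0] by blast
qed

lemma singular_if_not_maximal:
  assumes p: "prime p" and J: "int_over p i j k" and nd: "\<not> (p dvd i \<and> p dvd j \<and> p dvd k)"
  shows "\<exists>s. singular_mod a b p s"
proof (cases "p dvd k")
  case True
  then obtain m where "k = p * m" by (auto elim: dvdE)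
  then have "int_over p i j 0" using int_over_shift[OF J, of 0 0 "- m"] p by auto
  then show ?thesis using singular_if_not_maximal_linear[OF p] nd True by blast
next
  case False
  have p0: "p \<noteq> 0" using p by auto
  from False obtain u m where "u * k = 1 + p * m" using prime_inverse_mod[OF p] by blast
  then have "int_over p (u * i) (u * j) 1"
    using int_over_shift[OF int_over_scale[OF J, of u] p0, of 0 0 "- m"] by simp
  then obtain t s where ts: "int_over p t s 1" by blast
  \<comment> \<open>Multiplication by \<alpha> - s cancels the quadratic coefficient. Either a
    linear element with genuine denominator p remains, or t is s^2 - a modulo p, the shape treated
    in \<open>singular_iff_quadratic\<close>.\<close>
  have lin: "int_over p (- b + - s * t) (t + a + - s * s) 0"
    using int_over_add[OF int_over_gen[OF ts] int_over_scale[OF ts, of "- s"]] by simp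
  show ?thesis
  proof (cases "p dvd t + a - s * s")
    case True
    then obtain m where "t + a - s * s = p * m" by (auto elim: dvdE)
    then have "t = s\<^sup>2 - a + p * m" by (simp add: power2_eq_square)
    then have "int_over p (s\<^sup>2 - a) s 1" using int_over_shift[OF ts p0, of "- m" 0 0] by simp
    then show ?thesis using singular_iff_quadratic[OF p] by blast
  next
    case False
    then show ?thesis using singular_if_not_maximal_linear[OF p lin] by simp
  qed
qed

theorem monogenic_iff_no_singular:
  "ring_of_integers L = int_adjoin \<alpha> \<longleftrightarrow> (\<forall>p s. prime p \<longrightarrow> \<not> singular_mod a b p s)"
proof
  assume eq: "ring_of_integers L = int_adjoin \<alpha>"
  show "\<forall>p s. prime p \<longrightarrow> \<not> singular_mod a b p s"
  proof (intro allI impI notI)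
    fix p s assume p: "prime p" and "singular_mod a b p s"
    then have "algebraic_int (quad (of_int (s\<^sup>2 - a) / of_int p) (of_int s / of_int p) (of_int 1 / of_int p) \<alpha>)"
      using singular_iff_quadratic[OF p] by (simp only: int_over_def)
    then have "quad (of_int (s\<^sup>2 - a) / of_int p) (of_int s / of_int p) (of_int 1 / of_int p) \<alpha> \<in> int_adjoin \<alpha>"
      unfolding eq[symmetric] ring_of_integers_def by simp
    then obtain k where "(of_int 1 / of_int p :: rat) = of_int k"
      unfolding int_adjoin_eq by (auto simp: quad_inject)
    then have "p dvd 1" using p by (intro rat_Ints_dvd) auto
    then show False using p not_prime_unit by blast
  qed
next
  assume ns: "\<forall>p s. prime p \<longrightarrow> \<not> singular_mod a b p s"
  have "x \<in> int_adjoin \<alpha>" if "x \<in> L" "algebraic_int x" for x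
  proof -
    from \<open>x \<in> L\<close> obtain r s t where x: "x = quad r s t \<alpha>" by (rule L_cases)
    obtain n :: int where n: "n > 0" "of_int n * r \<in> \<int>" "of_int n * s \<in> \<int>" "of_int n * t \<in> \<int>"
      by (rule rat_common_denominator)
    \<comment> \<open>Induction on a common denominator: without singular points, each prime factor
      of n divides all three numerators and can be cancelled.\<close>
    have "x \<in> int_adjoin \<alpha>"
      if "n > 0" "of_int n * r \<in> \<int>" "of_int n * s \<in> \<int>" "of_int n * t \<in> \<int>" "algebraic_int (quad r s t \<alpha>)"
        "x = quad r s t \<alpha>" for n :: nat and r s t x
      using that
    proof (induction n arbitrary: r s t x rule: less_induct)
      case (less n)
      show ?case
      proof (cases "n = 1")
        case True
        then show ?thesis using less.prems unfolding int_adjoin_eq by (auto elim!: Ints_cases)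
      next
        case False
        then obtain p where p: "prime p" "p dvd n" using prime_factor_nat by blast
        then obtain m where m: "n = p * m" by (auto elim: dvdE)
        obtain i j k where ijk: "of_int n * r = of_int i" "of_int n * s = of_int j" "of_int n * t = of_int k"
          using less.prems by (auto elim!: Ints_cases)
        have pp: "prime (int p)" using p by simp
        have mr: "of_int m * r = of_int i / of_int (int p)" "of_int m * s = of_int j / of_int (int p)"
          "of_int m * t = of_int k / of_int (int p)"
          using ijk p by (simp_all add: m field_simps prime_gt_0_nat)
        have "algebraic_int (of_rat (of_int m) * quad r s t \<alpha>)"
          using less.prems algebraic_int_of_int[of "int m"] by (intro algebraic_int_mult) simp_all
        then have "int_over (int p) i j k" unfolding quad_scale mr int_over_def .
        then have "int p dvd i \<and> int p dvd j \<and> int p dvd k"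
          using singular_if_not_maximal[OF pp] ns pp by blast
        then have "of_int m * r \<in> \<int> \<and> of_int m * s \<in> \<int> \<and> of_int m * t \<in> \<int>"
          unfolding mr by (auto elim!: dvdE)
        moreover have "m < n" "m > 0" using less.prems(1) p(1) by (auto simp: m prime_gt_Suc_0_nat)
        ultimately show ?thesis using less by auto
      qed
    qed
    from this[of "nat n"] n that x show ?thesis by auto
  qed
  then show "ring_of_integers L = int_adjoin \<alpha>"
    using int_adjoin_subset unfolding ring_of_integers_def by blast
qed

end

subsection \<open>Arithmetic conditions for monogenicity\<close>

lemma exactly_one_3:
  "exactly_one [P, Q, R] \<longleftrightarrow> P \<and> \<not> Q \<and> \<not> R \<or> \<not> P \<and> Q \<and> \<not> R \<or> \<not> P \<and> \<not> Q \<and> R"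
  by (auto simp: exactly_one_def)

lemma exactly_one_4:
  "exactly_one [P, Q, R, S] \<longleftrightarrow> P \<and> \<not> Q \<and> \<not> R \<and> \<not> S \<or> \<not> P \<and> Q \<and> \<not> R \<and> \<not> S \<or>
     \<not> P \<and> \<not> Q \<and> R \<and> \<not> S \<or> \<not> P \<and> \<not> Q \<and> \<not> R \<and> S"
  by (auto simp: exactly_one_def)

text \<open>The derivative vanishes modulo \<open>p\<close> at \<open>s\<close>, so the value modulo \<open>p\<^sup>2\<close> depends only on \<open>s\<close>
  modulo \<open>p\<close>.\<close>

lemma singular_mod_shift:
  assumes "singular_mod a b p s"
  shows "singular_mod a b p (s + p * k)"
proof -
  obtain u v where u: "3 * s\<^sup>2 - a = p * u" and v: "s ^ 3 - a * s + b = p\<^sup>2 * v"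
    using assms by (auto simp: singular_mod_def elim!: dvdE)
  have "3 * (s + p * k)\<^sup>2 - a = (3 * s\<^sup>2 - a) + p * (6 * s * k + 3 * p * k\<^sup>2)"
    by (simp add: algebra_simps power2_eq_square)
  moreover have "(s + p * k) ^ 3 - a * (s + p * k) + b =
      (s ^ 3 - a * s + b) + p * k * (3 * s\<^sup>2 - a) + p\<^sup>2 * (3 * s * k\<^sup>2 + p * k ^ 3)"
    by (simp add: algebra_simps power2_eq_square power3_eq_cube)
  ultimately show ?thesis
    unfolding singular_mod_def u v by (auto simp: power2_eq_square mult.assoc mult.left_commute intro!: dvd_add)
qed

lemma singular_mod_cong:
  assumes "s mod p = t mod p"
  shows "singular_mod a b p s \<longleftrightarrow> singular_mod a b p t"
proof -
  have shift: "t = s + p * (t div p - s div p)" if "s mod p = t mod p" for s t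
    using mult_div_mod_eq[of p s] mult_div_mod_eq[of p t] that unfolding right_diff_distrib by linarith
  show ?thesis
    using singular_mod_shift[of a b p s "t div p - s div p"] singular_mod_shift[of a b p t "s div p - t div p"]
    unfolding shift[OF assms, symmetric] shift[OF assms[symmetric], symmetric] by blast
qed

lemma singular_mod_2: "(\<exists>s. singular_mod a b 2 s) \<longleftrightarrow> singular_mod a b 2 0 \<or> singular_mod a b 2 1"
proof
  assume "\<exists>s. singular_mod a b 2 s"
  then obtain s where "singular_mod a b 2 s" by blast
  moreover have "s mod 2 = 0 mod 2 \<or> s mod 2 = 1 mod 2" by presburger
  ultimately show "singular_mod a b 2 0 \<or> singular_mod a b 2 1"
    using singular_mod_cong by blast
qed blast

text \<open>At s = 0 and s = 1 the derivative is -a and 3 - a, the value b and 1 - a + b; everything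
  is decided by residues modulo 4.\<close>

lemma cond2_iff: "cond2 a b \<longleftrightarrow> (\<nexists>s. singular_mod a b 2 s)"
proof -
  have "a mod 4 = 0 \<or> a mod 4 = 1 \<or> a mod 4 = 2 \<or> a mod 4 = 3"
    "b mod 4 = 0 \<or> b mod 4 = 1 \<or> b mod 4 = 2 \<or> b mod 4 = 3" by presburger+
  then show ?thesis
    unfolding singular_mod_2 cond2_def exactly_one_4 unfolding singular_mod_def cong_def
    by (simp, presburger)
qed

lemma singular_mod_3: "(\<exists>s. singular_mod a b 3 s) \<longleftrightarrow>
    singular_mod a b 3 0 \<or> singular_mod a b 3 1 \<or> singular_mod a b 3 (- 1)"
proof
  assume "\<exists>s. singular_mod a b 3 s"
  then obtain s where "singular_mod a b 3 s" by blast
  moreover have "s mod 3 = 0 \<or> s mod 3 = 1 \<or> s mod 3 = 2" by presburger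
  then have "s mod 3 = 0 mod 3 \<or> s mod 3 = 1 mod 3 \<or> s mod 3 = (- 1) mod 3" by simp
  ultimately show "singular_mod a b 3 0 \<or> singular_mod a b 3 1 \<or> singular_mod a b 3 (- 1)"
    using singular_mod_cong by blast
qed blast

text \<open>Modulo 3 the derivative is the constant -a, and the three candidate points 0, 1, -1 have
  values b, b - (a - 1), b + (a - 1).\<close>

lemma singular_mod_3_iff:
  "(\<exists>s. singular_mod a b 3 s) \<longleftrightarrow> 3 dvd a \<and> (9 dvd b \<or> 9 dvd b - (a - 1) \<or> 9 dvd b + (a - 1))"
proof -
  have "b - (a - 1) = 1 - a + b" "b + (a - 1) = - 1 + a + b" by simp_all
  then show ?thesis
    unfolding singular_mod_3 unfolding singular_mod_def by (simp, presburger)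
qed

text \<open>If 3 divides a, then (a - 1)^2 is a + 1 modulo 9, so excluding b = a - 1 and b = 1 - a
  modulo 9 means excluding b^2 = a + 1, which for a = 3 modulo 9 reads b^2 = 4. The proof runs
  through all residues modulo 9.\<close>

lemma cond3_iff: "cond3 a b \<longleftrightarrow> (\<nexists>s. singular_mod a b 3 s)"
proof -
  have p3: "prime (3::int)" by simp
  define x y where "x = a mod 9" "y = b mod 9"
  have sq: "[b\<^sup>2 = z] (mod 9) \<longleftrightarrow> y * y mod 9 = z mod 9" for z
    by (simp add: cong_def power2_eq_square x_y_def mod_mult_eq)
  have x: "x = 0 \<or> x = 1 \<or> x = 2 \<or> x = 3 \<or> x = 4 \<or> x = 5 \<or> x = 6 \<or> x = 7 \<or> x = 8"
    and y: "y = 0 \<or> y = 1 \<or> y = 2 \<or> y = 3 \<or> y = 4 \<or> y = 5 \<or> y = 6 \<or> y = 7 \<or> y = 8"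
    unfolding x_y_def by presburger+
  have d: "3 dvd a \<longleftrightarrow> x mod 3 = 0" "3 dvd b \<longleftrightarrow> y mod 3 = 0" "3\<^sup>2 dvd b \<longleftrightarrow> y = 0" "9 dvd b \<longleftrightarrow> y = 0"
    "[a = 3] (mod 9) \<longleftrightarrow> x = 3" "(a + 1) mod 9 = (x + 1) mod 9"
    unfolding x_y_def by (simp_all add: cong_def dvd_eq_mod_eq_0 mod_mod_cancel mod_simps)
  have "9 dvd b - (a - 1) \<longleftrightarrow> b mod 9 = (a - 1) mod 9" by (simp only: mod_eq_dvd_iff)
  then have e1: "9 dvd b - (a - 1) \<longleftrightarrow> y = (x - 1) mod 9" by (simp add: x_y_def mod_simps)
  have "(b + (a - 1)) mod 9 = (y + (x - 1) mod 9) mod 9"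
    unfolding x_y_def mod_diff_left_eq by (rule mod_add_eq[symmetric])
  then have e2: "9 dvd b + (a - 1) \<longleftrightarrow> (y + (x - 1) mod 9) mod 9 = 0"
    by (simp only: dvd_eq_mod_eq_0)
  show ?thesis
    unfolding cond3_def exactly_one_4 vp_iff[OF p3] singular_mod_3_iff sq d e1 e2
    using x y by (elim disjE) simp_all
qed

text \<open>Since 3f(s) - s f'(s) = 3b - 2as, a singular point satisfies 2as = 3b modulo p. If p
  divides a, the derivative leaves only s = 0, with value b; if p divides b but not a, there is no
  candidate; otherwise the candidate is 3b/(2a), and the discriminant decides.\<close>

lemma cond_gt3_iff: "cond_gt3 a b \<longleftrightarrow> (\<forall>p. prime p \<and> p > 3 \<longrightarrow> (\<nexists>s. singular_mod a b p s))"
proof -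
  have "exactly_one
    [vp p a = 0 \<and> vp p b \<ge> 1,
     vp p a \<ge> 1 \<and> vp p b \<le> 1,
     vp p a = 0 \<and> vp p b = 0 \<and> vp p (4 * a ^ 3 - 27 * b\<^sup>2) \<le> 1] \<longleftrightarrow> (\<nexists>s. singular_mod a b p s)"
    if p: "prime p" "p > 3" for p
  proof -
    have n: "\<not> p dvd 2" "\<not> p dvd 3" using p(2) by (auto dest: zdvd_imp_le)
    have pm: "p dvd x * y \<longleftrightarrow> p dvd x \<or> p dvd y" for x y using p(1) by (rule prime_dvd_mult_iff)
    have pp: "p dvd x ^ 2 \<longleftrightarrow> p dvd x" for x using p(1) by (simp add: prime_dvd_power_iff)
    have p2: "p dvd x" if "p\<^sup>2 dvd x" for x using that by (rule dvd_trans[rotated]) simp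
    consider "p dvd a" | "\<not> p dvd a" "p dvd b" | "\<not> p dvd a" "\<not> p dvd b" by blast
    then show ?thesis
    proof cases
      case 1
      have "(\<exists>s. singular_mod a b p s) \<longleftrightarrow> p\<^sup>2 dvd b"
      proof
        assume "\<exists>s. singular_mod a b p s"
        then obtain s where s: "singular_mod a b p s" by blast
        then have "p dvd 3 * s\<^sup>2 - a" by (simp add: singular_mod_def)
        then have "p dvd (3 * s\<^sup>2 - a) + a" using 1 by (rule dvd_add)
        then have "p dvd s" using n by (simp add: pm pp)
        then have "s mod p = 0 mod p" by simp
        then have "singular_mod a b p 0" using singular_mod_cong s by blast
        then show "p\<^sup>2 dvd b" by (simp add: singular_mod_def)
      next
        assume "p\<^sup>2 dvd b"
        then show "\<exists>s. singular_mod a b p s" using 1 by (intro exI[of _ 0]) (simp add: singular_mod_def)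
      qed
      then show ?thesis unfolding exactly_one_3 vp_iff[OF p(1)] using 1 by auto
    next
      case 2
      have "\<nexists>s. singular_mod a b p s"
      proof
        assume "\<exists>s. singular_mod a b p s"
        then obtain s where s: "p dvd 3 * s\<^sup>2 - a" "p dvd s ^ 3 - a * s + b"
          unfolding singular_mod_def using p2 by blast
        have eq: "3 * (s ^ 3 - a * s + b) - s * (3 * s\<^sup>2 - a) - 3 * b = 2 * (- (a * s))"
          by (simp add: algebra_simps power2_eq_square power3_eq_cube)
        have "p dvd 3 * (s ^ 3 - a * s + b) - s * (3 * s\<^sup>2 - a) - 3 * b"
          by (rule dvd_diff[OF dvd_diff[OF dvd_mult[OF s(2)] dvd_mult[OF s(1)]] dvd_mult[OF 2(2)]])
        then have "p dvd 2 * (- (a * s))" unfolding eq .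
        then have "p dvd s" using n 2 unfolding pm by (simp add: pm)
        then have "p dvd s\<^sup>2" by (simp add: pp)
        then have "p dvd 3 * s\<^sup>2 - (3 * s\<^sup>2 - a)" using s(1) by (rule dvd_diff[OF dvd_mult])
        then show False using 2 by simp
      qed
      then show ?thesis unfolding exactly_one_3 vp_iff[OF p(1)] using 2 by auto
    next
      case 3
      define D where "D = 4 * a ^ 3 - 27 * b\<^sup>2"
      have "(\<exists>s. singular_mod a b p s) \<longleftrightarrow> p\<^sup>2 dvd D"
      proof
        assume "\<exists>s. singular_mod a b p s"
        then obtain s where s: "p dvd 3 * s\<^sup>2 - a" "p\<^sup>2 dvd s ^ 3 - a * s + b"
          unfolding singular_mod_def by blast
        have "p\<^sup>2 dvd (3 * s\<^sup>2 - a)\<^sup>2" using s(1) by (rule dvd_power_same)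
        then have "p\<^sup>2 dvd (s ^ 3 - a * s + b) * (27 * s ^ 3 - 27 * a * s - 27 * b)
            - (3 * s\<^sup>2 - a)\<^sup>2 * (3 * s\<^sup>2 - 4 * a)"
          by (rule dvd_diff[OF dvd_mult2[OF s(2)] dvd_mult2])
        then show "p\<^sup>2 dvd D" unfolding D_def disc_identity[of a b s] .
      next
        assume D: "p\<^sup>2 dvd D"
        have c: "coprime (p\<^sup>2) (2 * a)"
        proof -
          have "\<not> p dvd 2 * a" unfolding pm using n 3 by simp
          then have "coprime p (2 * a)" by (rule prime_imp_coprime[OF p(1)])
          then show ?thesis by (rule coprime_power_left_iff[THEN iffD2, OF disjI1])
        qed
        then obtain k l where "k * p\<^sup>2 + l * (2 * a) = 1" using bezout_int[of "p\<^sup>2" "2 * a"] by auto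
        then have kl: "l * (2 * a) = 1 - k * p\<^sup>2" by simp
        \<comment> \<open>As l inverts 2a modulo p^2, this is the double-root formula 3b/(2a).
          Multiplied by (2a)^2 and (2a)^3, the derivative and the value at s become -D and -bD
          modulo p^2.\<close>
        define s where "s = 3 * b * l"
        have s: "2 * a * s = 3 * b + p\<^sup>2 * (- 3 * b * k)"
        proof -
          have "2 * a * s = 3 * b * (l * (2 * a))" by (simp add: s_def)
          then show ?thesis unfolding kl by (simp add: algebra_simps)
        qed
        define w where "w = - 3 * b * k"
        have s': "2 * a * s = 3 * b + p\<^sup>2 * w" using s by (simp add: w_def)
        have "(2 * a)\<^sup>2 * (3 * s\<^sup>2 - a) = 3 * (2 * a * s)\<^sup>2 - 4 * a ^ 3"
          by (simp add: algebra_simps power2_eq_square power3_eq_cube)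
        also have "\<dots> = - D + p\<^sup>2 * (w * (18 * b + 3 * p\<^sup>2 * w))"
          unfolding s' by (simp add: D_def algebra_simps power2_eq_square)
        also have "p\<^sup>2 dvd \<dots>" using D by (intro dvd_add) simp_all
        finally have "p\<^sup>2 dvd (2 * a)\<^sup>2 * (3 * s\<^sup>2 - a)" .
        moreover have c2: "coprime (p\<^sup>2) ((2 * a)\<^sup>2)" "coprime (p\<^sup>2) ((2 * a) ^ 3)"
          using c by (simp_all only: coprime_power_right_iff simp_thms)
        ultimately have "p\<^sup>2 dvd 3 * s\<^sup>2 - a" by (simp only: coprime_dvd_mult_right_iff)
        then have 1: "p dvd 3 * s\<^sup>2 - a" by (rule p2)
        have "(2 * a) ^ 3 * (s ^ 3 - a * s + b) = (2 * a * s) ^ 3 - 4 * a ^ 3 * (2 * a * s) + 8 * a ^ 3 * b"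
          by (simp add: algebra_simps power2_eq_square power3_eq_cube)
        also have "\<dots> = - b * D + p\<^sup>2 * (w * (27 * b\<^sup>2 + 9 * b * p\<^sup>2 * w + (p\<^sup>2 * w)\<^sup>2 - 4 * a ^ 3))"
          unfolding s' by (simp add: D_def algebra_simps power2_eq_square power3_eq_cube)
        also have "p\<^sup>2 dvd \<dots>" by (rule dvd_add[OF dvd_mult[OF D] dvd_triv_left])
        finally have "p\<^sup>2 dvd (2 * a) ^ 3 * (s ^ 3 - a * s + b)" .
        with c2(2) have "p\<^sup>2 dvd s ^ 3 - a * s + b" by (simp only: coprime_dvd_mult_right_iff)
        with 1 show "\<exists>s. singular_mod a b p s" unfolding singular_mod_def by blast
      qed
      then show ?thesis unfolding exactly_one_3 vp_iff[OF p(1)] using 3 by (auto simp: D_def)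
    qed
  qed
  then show ?thesis unfolding cond_gt3_def by blast
qed

lemma prime_int_cases: "prime (p::int) \<Longrightarrow> p = 2 \<or> p = 3 \<or> p > 3"
  using prime_ge_2_int[of p] by linarith

context cubic_field
begin

theorem monogenic_iff_conds:
  "ring_of_integers L = int_adjoin \<alpha> \<longleftrightarrow> cond2 a b \<and> cond3 a b \<and> cond_gt3 a b"
proof -
  have "prime (2::int)" "prime (3::int)" by simp_all
  then show ?thesis
    unfolding monogenic_iff_no_singular cond2_iff cond3_iff cond_gt3_iff
    using prime_int_cases by blast
qed

end

section \<open>The condition at 3 in each regime, and the assembled criterion\<close>

lemma cond3_not_3_dvd: "\<not> 3 dvd a \<Longrightarrow> cond3 a b"
  by (simp add: cond3_iff singular_mod_3_iff)

text \<open>Both a and b are divisible by 3, so b - (a - 1) and b + (a - 1) are prime to 3 and only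
  the condition that 9 does not divide b remains; a valuation 1 of b then forces valuation 1 of
  a.\<close>

lemma cond3_vp_le:
  assumes "3 dvd a" "vp 3 a \<le> vp 3 b" "a \<noteq> 0 \<or> b \<noteq> 0"
  shows "cond3 a b \<longleftrightarrow> vp 3 a = 1 \<and> vp 3 b = 1"
proof -
  have p3: "prime (3::int)" by simp
  have "1 \<le> vp 3 a" using assms(1) vp_iff(2)[OF p3] by blast
  then have b: "3 dvd b" using assms(2) vp_iff(2)[OF p3, of b] order_trans by blast
  then have "\<not> 9 dvd b - (a - 1)" "\<not> 9 dvd b + (a - 1)" using assms(1) by presburger+
  then have "cond3 a b \<longleftrightarrow> \<not> 9 dvd b" using assms(1) by (simp add: cond3_iff singular_mod_3_iff)
  also have "\<dots> \<longleftrightarrow> vp 3 b = 1" using b by (simp add: vp_iff[OF p3])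
  also have "\<dots> \<longleftrightarrow> vp 3 a = 1 \<and> vp 3 b = 1"
    using \<open>1 \<le> vp 3 a\<close> assms(2) by auto
  finally show ?thesis .
qed

theorem corollary7p7:
  fixes a b \<Delta> g :: int
    and \<alpha> :: complex
    and L :: "complex set"
    and scale :: "rat \<Rightarrow> 'h::ring_1 \<Rightarrow> 'h"
    and comult :: "'h \<Rightarrow> ('h \<times> 'h) list"
    and counit :: "'h \<Rightarrow> rat"
    and antipode :: "'h \<Rightarrow> 'h"
    and act :: "'h \<Rightarrow> complex \<Rightarrow> complex"
  assumes root: "\<alpha> ^ 3 - of_int a * \<alpha> + of_int b = 0"
    and L_def: "L = rat_adjoin \<alpha>"
    and cubic: "field_degree L = 3"
    and reduced: "\<And>p :: int. prime p \<Longrightarrow> vp p a < 2 \<or> vp p b < 3"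
    and \<Delta>_def: "\<Delta> = 4 * a ^ 3 - 27 * b\<^sup>2"
    and g_def: "g = gcd a b"
  shows "(hopf_galois_structure scale comult counit antipode act L \<longrightarrow>
      (\<not> 3 dvd a \<and> cond2 a b \<and> cond_gt3 a b \<longrightarrow>
        (free_over (associated_order act L) act (ring_of_integers L) \<longleftrightarrow>
          (\<exists>x y :: int.
            (x\<^sup>2 + 3 * \<Delta> * y\<^sup>2 = 12 * a * g \<or> x\<^sup>2 + 3 * \<Delta> * y\<^sup>2 = - (12 * a * g)) \<and>
            (6 * a dvd 9 * b * y + x \<or> 6 * a dvd 9 * b * y - x) \<and> \<not> 3 dvd y))) \<and>
      (vp 3 a = 1 \<and> vp 3 b = 1 \<and> cond2 a b \<and> cond_gt3 a b \<longrightarrow>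
        (free_over (associated_order act L) act (ring_of_integers L) \<longleftrightarrow>
          (\<exists>x y :: int.
            (x\<^sup>2 + 3 * \<Delta> * y\<^sup>2 = 36 * a * g \<or> x\<^sup>2 + 3 * \<Delta> * y\<^sup>2 = - (36 * a * g)) \<and>
            (6 * a dvd 9 * b * y + x \<or> 6 * a dvd 9 * b * y - x)))) \<and>
      (vp 3 a > vp 3 b \<and> cond2 a b \<and> cond3 a b \<and> cond_gt3 a b \<longrightarrow>
        (free_over (associated_order act L) act (ring_of_integers L) \<longleftrightarrow>
          (\<exists>x y :: int.
            (x\<^sup>2 + 3 * \<Delta> * y\<^sup>2 = 108 * a * g \<or> x\<^sup>2 + 3 * \<Delta> * y\<^sup>2 = - (108 * a * g)) \<and>
            (6 * a dvd 9 * b * y + x \<or> 6 * a dvd 9 * b * y - x))))) \<and>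
    (\<not> 3 dvd a \<longrightarrow>
      (ring_of_integers L = int_adjoin \<alpha> \<longleftrightarrow> cond2 a b \<and> cond_gt3 a b)) \<and>
    (3 dvd a \<and> vp 3 a \<le> vp 3 b \<longrightarrow>
      (ring_of_integers L = int_adjoin \<alpha> \<longleftrightarrow>
        vp 3 a = 1 \<and> vp 3 b = 1 \<and> cond2 a b \<and> cond_gt3 a b)) \<and>
    (vp 3 a > vp 3 b \<longrightarrow>
      (ring_of_integers L = int_adjoin \<alpha> \<longleftrightarrow> cond2 a b \<and> cond3 a b \<and> cond_gt3 a b))"
proof -
  have p3: "prime (3::int)" by simp
  interpret cubic_equation a b \<alpha> by unfold_locales (rule root)
  interpret cubic_field a b \<alpha>
    by unfold_locales (use quad_eq_0_if_degree_3 cubic L_def in blast)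
  have ab: "a \<noteq> 0 \<or> b \<noteq> 0" using disc_nonzero by auto
  have mono: "ring_of_integers L = int_adjoin \<alpha> \<longleftrightarrow> cond2 a b \<and> cond3 a b \<and> cond_gt3 a b"
    unfolding L_def by (rule monogenic_iff_conds)
  have le: "cond3 a b" if "vp 3 a = 1" "vp 3 b = 1"
    using that cond3_vp_le[OF _ _ ab] vp_iff(3)[OF p3, of a] by simp
  \<comment> \<open>The parameters d and \<kappa> stay open so that the three items become the
    instances d = g, 3g, 9g; \<kappa> = 1 occurs only in the first, whence its extra condition on
    y.\<close>
  have free: "free_over (associated_order act L) act (ring_of_integers L) \<longleftrightarrow>
      (\<exists>x y. (x\<^sup>2 + 3 * \<Delta> * y\<^sup>2 = 12 * a * d \<or> x\<^sup>2 + 3 * \<Delta> * y\<^sup>2 = - (12 * a * d)) \<and>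
        (6 * a dvd 9 * b * y + x \<or> 6 * a dvd 9 * b * y - x) \<and> (\<kappa> = 1 \<longrightarrow> \<not> 3 dvd y))"
    if "hopf_galois_structure scale comult counit antipode act L" "cond2 a b" "cond3 a b" "cond_gt3 a b"
      "d = gcd (gcd (3 * a) (a\<^sup>2)) (9 * b)" "\<kappa> = 1 \<and> \<not> 3 dvd a \<or> \<kappa> = 3 \<and> 3 dvd a" for d \<kappa> :: int
  proof -
    interpret H: hopf_galois_structure scale comult counit antipode act "rat_adjoin \<alpha>"
      using that(1) by (simp only: L_def)
    interpret hopf_galois_cubic a b \<alpha> scale comult counit antipode act ..
    have "ring_of_integers (rat_adjoin \<alpha>) = int_adjoin \<alpha>" using mono that unfolding L_def by simp
    from monogenic_lattice[OF this that(5,6)]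
    show ?thesis unfolding L_def \<Delta>_def by (rule monogenic_hopf_galois_cubic.free_iff_norm_equation)
  qed
  have d1: "gcd (gcd (3 * a) (a\<^sup>2)) (9 * b) = g" if "\<not> 3 dvd a"
    using gcd_lattice_not_3_dvd[OF that] by (simp add: g_def)
  have d2: "gcd (gcd (3 * a) (a\<^sup>2)) (9 * b) = 3 * g" if "vp 3 a = 1" "vp 3 b = 1"
    using that gcd_lattice_3_dvd[of a b] gcd_times_3_vp_1[of a b] by (simp add: vp_iff[OF p3] g_def)
  have dvd3: "3 dvd a" if "vp 3 b < vp 3 a"
    using that vp_iff(1)[OF p3, of a] by (cases "3 dvd a") auto
  have d3: "gcd (gcd (3 * a) (a\<^sup>2)) (9 * b) = 9 * g" if "vp 3 b < vp 3 a"
    using gcd_lattice_3_dvd[OF dvd3[OF that], of b] gcd_times_3_vp_less[OF that] by (simp add: g_def)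
  let ?free = "free_over (associated_order act L) act (ring_of_integers L)"
  let ?hgs = "hopf_galois_structure scale comult counit antipode act L"
  have F1: "?free \<longleftrightarrow> (\<exists>x y. (x\<^sup>2 + 3 * \<Delta> * y\<^sup>2 = 12 * a * g \<or> x\<^sup>2 + 3 * \<Delta> * y\<^sup>2 = - (12 * a * g)) \<and>
        (6 * a dvd 9 * b * y + x \<or> 6 * a dvd 9 * b * y - x) \<and> \<not> 3 dvd y)"
    if "?hgs" "\<not> 3 dvd a" "cond2 a b" "cond_gt3 a b"
    using free[OF that(1,3) cond3_not_3_dvd[OF that(2)] that(4) d1[OF that(2), symmetric], of 1] that(2)
    by simp
  have F2: "?free \<longleftrightarrow> (\<exists>x y. (x\<^sup>2 + 3 * \<Delta> * y\<^sup>2 = 36 * a * g \<or> x\<^sup>2 + 3 * \<Delta> * y\<^sup>2 = - (36 * a * g)) \<and>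
        (6 * a dvd 9 * b * y + x \<or> 6 * a dvd 9 * b * y - x))"
    if "?hgs" "vp 3 a = 1" "vp 3 b = 1" "cond2 a b" "cond_gt3 a b"
    using free[OF that(1,4) le[OF that(2,3)] that(5) d2[OF that(2,3), symmetric], of 3] that(2)
    by (simp add: vp_iff[OF p3] mult.assoc mult.left_commute[of a 3])
  have F3: "?free \<longleftrightarrow> (\<exists>x y. (x\<^sup>2 + 3 * \<Delta> * y\<^sup>2 = 108 * a * g \<or> x\<^sup>2 + 3 * \<Delta> * y\<^sup>2 = - (108 * a * g)) \<and>
        (6 * a dvd 9 * b * y + x \<or> 6 * a dvd 9 * b * y - x))"
    if "?hgs" "vp 3 b < vp 3 a" "cond2 a b" "cond3 a b" "cond_gt3 a b"
    using free[OF that(1,3,4,5) d3[OF that(2), symmetric], of 3] dvd3[OF that(2)]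
    by (simp add: mult.assoc mult.left_commute[of a 9])
  show ?thesis
  proof (intro conjI impI, goal_cases)
    case 1 then show ?case by (intro F1) simp_all
  next
    case 2 then show ?case by (intro F2) simp_all
  next
    case 3 then show ?case by (intro F3) simp_all
  next
    case 4 then show ?case unfolding mono using cond3_not_3_dvd by blast
  next
    case 5 then show ?case unfolding mono using cond3_vp_le[OF _ _ ab] by blast
  next
    case 6 show ?case by (rule mono)
  qed
qed

end
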